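(* Let $\mathbf{k}$ be a field. Let $\Pi$ be a finite simplicial complex, $\sigma\in\Pi$, and $k:=\dim\Pi-\dim\sigma$. Then for every $j\ge0$, $$\mathrm{SC}^j(\sigma)\le\binom{k}{j}.$$ This bound is asymptotically tight: if $\Pi=\Delta_n^{(k)}$ is the $k$-skeleton of the $n$-simplex, $v$ is a vertex of $\Delta_n^{(k)}$, and $j$ (and $k$) is fixed, then $$\mathrm{SC}^j(v)\xrightarrow{\,n\to\infty\,}\binom{k}{j}.$$
   Context: A simplicial complex consists of nonempty simplices and is viewed as a poset under the face relation; the $n$-simplex has $n+1$ vertices. For $\sigma\in\Pi$, $\mathrm{St}\,\sigma=\{\tau\in\Pi:\sigma\le\tau\}$. A sheaf $F$ on a finite poset $\Pi$ assigns to each $\pi\in\Pi$ a finite-dimensional $\mathbf{k}$-vector space $F(\pi)$ and to each relation $\tau\le\gamma$ a linear map $F(\tau\le\gamma):F(\tau)\to F(\gamma)$, with $F(\tau\le\tau)=\mathrm{id}$ and $F(\tau\le\gamma)\circ F(\sigma\le\tau)=F(\sigma\le\gamma)$. A natural transformation is a collection of linear maps commuting with the sheaf maps; it is injective if all its components are; kernels and images are pointwise. The constant sheaf $\mathbf{k}_\Pi$ assigns $\mathbf{k}$ to each element and $\mathrm{id}_{\mathbf{k}}$ to each relation. A sheaf $I$ is injective if for each injective natural transformation $A\hookrightarrow B$, every natural transformation $A\to I$ extends to $B\to I$. For $\pi\in\Pi$, the indecomposable injective sheaf $[\pi]$ has $[\pi](\gamma)=\mathbf{k}$ if $\gamma\le\pi$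 and $0$ otherwise, with identity maps $[\pi](\gamma\le\tau)$ when $\gamma\le\tau\le\pi$ and zero maps otherwise. Every injective sheaf is isomorphic to a direct sum of indecomposable injective sheaves, with well-defined multiplicities. An injective resolution of $F$ is an exact sequence $0\to F\to I^0\to I^1\to\cdots$ with each $I^j$ injective; it is minimal if, for each $j$, the number of indecomposable injective summands of $I^j$ is minimal among all injective resolutions of $F$. Each sheaf on a finite poset has a minimal injective resolution, unique up to isomorphism of complexes. Let $I^\bullet$ be the minimal injective resolution of $\mathbf{k}_\Pi$ and let $m^j_{\mathbf{k}_\Pi}(\pi)$ be the multiplicity of $[\pi]$ in $I^j$. Define $$m^j(\mathrm{St}\,\sigma):=\sum_{\pi\in\mathrm{St}\,\sigma}m^j_{\mathbf{k}_\Pi}(\pi),\qquad \mathrm{SC}^j(\sigma):=\frac{m^j(\mathrm{St}\,\sigma)}{\#\mathrm{St}\,\sigma}$$ (the latter is called the $j$-th star complexity of $\sigma$). *)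

theory Defs
  imports Complex_Main "HOL-Library.FuncSet" "HOL-Library.Function_Algebras"
begin

section \<open>Finite-dimensional vector spaces\<close>

text \<open>Finite-dimensional vector spaces over the field \<open>'k\<close> are modelled as the finite-dimensional
  subspaces of the coordinate space \<open>nat \<Rightarrow> 'k\<close>.  Every finite-dimensional space is isomorphic to
  such a subspace, so quantifying over them (as in the definition of injective sheaves) loses
  nothing.  Addition on \<open>nat \<Rightarrow> 'k\<close> is pointwise.\<close>

type_synonym 'k vect = "nat \<Rightarrow> 'k"

definition cscale :: "'k::field \<Rightarrow> 'k vect \<Rightarrow> 'k vect" where
  "cscale c x = (\<lambda>i. c * x i)"

interpretation coord: vector_space "cscale :: 'k::field \<Rightarrow> 'k vect \<Rightarrow> 'k vect"
  by unfold_locales (auto simp: cscale_def fun_eq_iff algebra_simps)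

definition fd_space :: "'k::field vect set \<Rightarrow> bool" where
  "fd_space V \<longleftrightarrow> coord.subspace V \<and> (\<exists>B. finite B \<and> V = coord.span B)"

definition linear_map :: "'k::field vect set \<Rightarrow> 'k vect set \<Rightarrow> ('k vect \<Rightarrow> 'k vect) \<Rightarrow> bool" where
  "linear_map V W f \<longleftrightarrow>
     (\<forall>x\<in>V. f x \<in> W) \<and>
     (\<forall>x\<in>V. \<forall>y\<in>V. f (x + y) = f x + f y) \<and>
     (\<forall>c. \<forall>x\<in>V. f (cscale c x) = cscale c (f x))"

text \<open>The one-dimensional space \<open>'k\<close>, as the zeroth coordinate line.\<close>

definition line :: "'k::field vect set" where
  "line = {x. \<forall>i. i \<noteq> 0 \<longrightarrow> x i = 0}"


section \<open>Sheaves on finite posets\<close>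

text \<open>A finite poset is a finite subset \<open>P\<close> of an ordered type.  The components of a sheaf or of a
  natural transformation are relevant only at elements of \<open>P\<close> (and at vectors of the stalks).\<close>

record ('p, 'k) sheaf =
  stalk :: "'p \<Rightarrow> 'k vect set"
  smap :: "'p \<Rightarrow> 'p \<Rightarrow> 'k vect \<Rightarrow> 'k vect"

type_synonym ('p, 'k) nat_map = "'p \<Rightarrow> 'k vect \<Rightarrow> 'k vect"

definition is_sheaf :: "'p::order set \<Rightarrow> ('p, 'k::field) sheaf \<Rightarrow> bool" where
  "is_sheaf P F \<longleftrightarrow>
     (\<forall>\<pi>\<in>P. fd_space (stalk F \<pi>)) \<and>
     (\<forall>\<tau>\<in>P. \<forall>\<gamma>\<in>P. \<tau> \<le> \<gamma> \<longrightarrow> linear_map (stalk F \<tau>) (stalk F \<gamma>) (smap F \<tau> \<gamma>)) \<and>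
     (\<forall>\<tau>\<in>P. \<forall>x\<in>stalk F \<tau>. smap F \<tau> \<tau> x = x) \<and>
     (\<forall>\<sigma>\<in>P. \<forall>\<tau>\<in>P. \<forall>\<gamma>\<in>P. \<sigma> \<le> \<tau> \<and> \<tau> \<le> \<gamma> \<longrightarrow>
        (\<forall>x\<in>stalk F \<sigma>. smap F \<tau> \<gamma> (smap F \<sigma> \<tau> x) = smap F \<sigma> \<gamma> x))"

definition nat_trans ::
  "'p::order set \<Rightarrow> ('p, 'k::field) sheaf \<Rightarrow> ('p, 'k) sheaf \<Rightarrow> ('p, 'k) nat_map \<Rightarrow> bool" where
  "nat_trans P F G f \<longleftrightarrow>
     (\<forall>\<pi>\<in>P. linear_map (stalk F \<pi>) (stalk G \<pi>) (f \<pi>)) \<and>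
     (\<forall>\<tau>\<in>P. \<forall>\<gamma>\<in>P. \<tau> \<le> \<gamma> \<longrightarrow>
        (\<forall>x\<in>stalk F \<tau>. f \<gamma> (smap F \<tau> \<gamma> x) = smap G \<tau> \<gamma> (f \<tau> x)))"

definition inj_trans ::
  "'p::order set \<Rightarrow> ('p, 'k::field) sheaf \<Rightarrow> ('p, 'k) sheaf \<Rightarrow> ('p, 'k) nat_map \<Rightarrow> bool" where
  "inj_trans P F G f \<longleftrightarrow> nat_trans P F G f \<and> (\<forall>\<pi>\<in>P. inj_on (f \<pi>) (stalk F \<pi>))"

definition ker_at :: "('p, 'k::field) sheaf \<Rightarrow> ('p, 'k) nat_map \<Rightarrow> 'p \<Rightarrow> 'k vect set" where
  "ker_at F f \<pi> = {x \<in> stalk F \<pi>. f \<pi> x = 0}"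

definition im_at :: "('p, 'k::field) sheaf \<Rightarrow> ('p, 'k) nat_map \<Rightarrow> 'p \<Rightarrow> 'k vect set" where
  "im_at F f \<pi> = f \<pi> ` stalk F \<pi>"

definition const_sheaf :: "('p, 'k::field) sheaf" where
  "const_sheaf = \<lparr>stalk = (\<lambda>\<pi>. line), smap = (\<lambda>\<tau> \<gamma> x. x)\<rparr>"

definition injective_sheaf :: "'p::order set \<Rightarrow> ('p, 'k::field) sheaf \<Rightarrow> bool" where
  "injective_sheaf P I \<longleftrightarrow> is_sheaf P I \<and>
     (\<forall>(A :: ('p, 'k) sheaf) (B :: ('p, 'k) sheaf) i f.
        is_sheaf P A \<and> is_sheaf P B \<and> inj_trans P A B i \<and> nat_trans P A I f \<longrightarrow>
        (\<exists>g. nat_trans P B I g \<and> (\<forall>\<pi>\<in>P. \<forall>x\<in>stalk A \<pi>. g \<pi> (i \<pi> x) = f \<pi> x)))"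

text \<open>The indecomposable injective sheaf \<open>[\<pi>]\<close>.\<close>

definition indec_inj :: "'p::order \<Rightarrow> ('p, 'k::field) sheaf" where
  "indec_inj \<pi> =
     \<lparr>stalk = (\<lambda>\<gamma>. if \<gamma> \<le> \<pi> then line else {0}),
      smap = (\<lambda>\<gamma> \<tau> x. if \<gamma> \<le> \<tau> \<and> \<tau> \<le> \<pi> then x else 0)\<rparr>"

text \<open>\<open>I\<close> is isomorphic to the direct sum of the finite family \<open>G i\<close>, \<open>i \<in> S\<close>: there are natural
  transformations \<open>G i \<rightarrow> I\<close> for which the induced map \<open>(x\<^sub>i) \<mapsto> \<Sum> \<iota> i x\<^sub>i\<close> from the direct sum
  of the stalks is bijective at every element.\<close>

definition iso_direct_sum ::
  "'p::order set \<Rightarrow> ('p, 'k::field) sheaf \<Rightarrow> 'i set \<Rightarrow> ('i \<Rightarrow> ('p, 'k) sheaf) \<Rightarrow> bool" where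
  "iso_direct_sum P I S G \<longleftrightarrow> finite S \<and>
     (\<exists>\<iota>. (\<forall>i\<in>S. nat_trans P (G i) I (\<iota> i)) \<and>
          (\<forall>\<gamma>\<in>P. bij_betw (\<lambda>x. \<Sum>i\<in>S. \<iota> i \<gamma> (x i))
                    (PiE S (\<lambda>i. stalk (G i) \<gamma>)) (stalk I \<gamma>)))"

text \<open>\<open>I\<close> is isomorphic to the direct sum over \<open>\<pi> \<in> P\<close> of \<open>m \<pi>\<close> copies of \<open>[\<pi>]\<close>.\<close>

definition indec_decomposition ::
  "'p::order set \<Rightarrow> ('p, 'k::field) sheaf \<Rightarrow> ('p \<Rightarrow> nat) \<Rightarrow> bool" where
  "indec_decomposition P I m \<longleftrightarrow>
     iso_direct_sum P I (SIGMA \<pi>:P. {..<m \<pi>}) (\<lambda>(\<pi>, i). indec_inj \<pi>)"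

definition multiplicity_indec :: "'p::order set \<Rightarrow> ('p, 'k::field) sheaf \<Rightarrow> 'p \<Rightarrow> nat" where
  "multiplicity_indec P I \<pi> = (THE n. \<exists>m. indec_decomposition P I m \<and> m \<pi> = n)"

definition num_summands :: "'p::order set \<Rightarrow> ('p, 'k::field) sheaf \<Rightarrow> nat" where
  "num_summands P I = (\<Sum>\<pi>\<in>P. multiplicity_indec P I \<pi>)"


section \<open>Minimal injective resolutions\<close>

definition injective_resolution ::
  "'p::order set \<Rightarrow> ('p, 'k::field) sheaf \<Rightarrow> (nat \<Rightarrow> ('p, 'k) sheaf) \<Rightarrow>
   ('p, 'k) nat_map \<Rightarrow> (nat \<Rightarrow> ('p, 'k) nat_map) \<Rightarrow> bool" where
  "injective_resolution P F I \<epsilon> d \<longleftrightarrow>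
     is_sheaf P F \<and>
     (\<forall>j. injective_sheaf P (I j)) \<and>
     inj_trans P F (I 0) \<epsilon> \<and>
     (\<forall>j. nat_trans P (I j) (I (Suc j)) (d j)) \<and>
     (\<forall>\<pi>\<in>P. im_at F \<epsilon> \<pi> = ker_at (I 0) (d 0) \<pi>) \<and>
     (\<forall>j. \<forall>\<pi>\<in>P. im_at (I j) (d j) \<pi> = ker_at (I (Suc j)) (d (Suc j)) \<pi>)"

definition minimal_injective_resolution ::
  "'p::order set \<Rightarrow> ('p, 'k::field) sheaf \<Rightarrow> (nat \<Rightarrow> ('p, 'k) sheaf) \<Rightarrow>
   ('p, 'k) nat_map \<Rightarrow> (nat \<Rightarrow> ('p, 'k) nat_map) \<Rightarrow> bool" where
  "minimal_injective_resolution P F I \<epsilon> d \<longleftrightarrow>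
     injective_resolution P F I \<epsilon> d \<and>
     (\<forall>j J \<eta> e. injective_resolution P F J \<eta> e \<longrightarrow> num_summands P (I j) \<le> num_summands P (J j))"

text \<open>The terms of the minimal injective resolution, which exists and is unique up to isomorphism
  for every sheaf on a finite poset.\<close>

definition min_inj_res :: "'p::order set \<Rightarrow> ('p, 'k::field) sheaf \<Rightarrow> nat \<Rightarrow> ('p, 'k) sheaf" where
  "min_inj_res P F = (SOME I. \<exists>\<epsilon> d. minimal_injective_resolution P F I \<epsilon> d)"


section \<open>Star complexity\<close>

definition star :: "'p::order set \<Rightarrow> 'p \<Rightarrow> 'p set" where
  "star P \<sigma> = {\<tau> \<in> P. \<sigma> \<le> \<tau>}"

text \<open>The numbers \<open>m\<^sup>j(\<pi>)\<close> for the constant sheaf, \<open>m\<^sup>j(St \<sigma>)\<close> and \<open>SC\<^sup>j(\<sigma>)\<close>.  The coefficient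
  field is passed as a type argument, since it does not occur in the other arguments.\<close>

definition const_mult :: "'k::field itself \<Rightarrow> 'p::order set \<Rightarrow> nat \<Rightarrow> 'p \<Rightarrow> nat" where
  "const_mult _ P j \<pi> = multiplicity_indec P (min_inj_res P (const_sheaf :: ('p, 'k) sheaf) j) \<pi>"

definition star_mult :: "'k::field itself \<Rightarrow> 'p::order set \<Rightarrow> nat \<Rightarrow> 'p \<Rightarrow> nat" where
  "star_mult k P j \<sigma> = (\<Sum>\<pi>\<in>star P \<sigma>. const_mult k P j \<pi>)"

definition star_complexity :: "'k::field itself \<Rightarrow> 'p::order set \<Rightarrow> nat \<Rightarrow> 'p \<Rightarrow> real" where
  "star_complexity k P j \<sigma> = real (star_mult k P j \<sigma>) / real (card (star P \<sigma>))"


section \<open>Simplicial complexes\<close>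

text \<open>Abstract simplicial complexes, without the empty simplex.  As sets of sets they are posets
  under inclusion, which is the face relation.\<close>

definition finite_simplicial_complex :: "'v set set \<Rightarrow> bool" where
  "finite_simplicial_complex K \<longleftrightarrow> finite K \<and>
     (\<forall>\<sigma>\<in>K. finite \<sigma> \<and> \<sigma> \<noteq> {}) \<and>
     (\<forall>\<sigma>\<in>K. \<forall>\<tau>. \<tau> \<subseteq> \<sigma> \<and> \<tau> \<noteq> {} \<longrightarrow> \<tau> \<in> K)"

definition simplex_dim :: "'v set \<Rightarrow> nat" where
  "simplex_dim \<sigma> = card \<sigma> - 1"

definition complex_dim :: "'v set set \<Rightarrow> nat" where
  "complex_dim K = Max (simplex_dim ` K)"

definition skeleton :: "nat \<Rightarrow> 'v set set \<Rightarrow> 'v set set" where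
  "skeleton k K = {\<tau> \<in> K. simplex_dim \<tau> \<le> k}"

definition full_simplex :: "nat \<Rightarrow> nat set set" where
  "full_simplex n = {\<tau>. \<tau> \<subseteq> {0..n} \<and> \<tau> \<noteq> {}}"

end

theory Submission imports Defs begin

text \<open>
  The multiplicity of \<open>[\<pi>]\<close> in an injective sheaf \<open>I\<close> is the dimension of the socle of \<open>I\<close> at \<open>\<pi>\<close>,
  the vectors of \<open>I(\<pi>)\<close> that vanish at every larger element.  A resolution built from injective hulls
  has the property that its differentials vanish on socles (\<open>exists_socle_resolution\<close>).  Such a
  resolution embeds into every other injective resolution of the same sheaf (\<open>dim_socle_le\<close>), so it
  is minimal and every minimal resolution has the same multiplicities.  The multiplicity \<open>m\<^sup>j(\<pi>)\<close> is
  therefore the dimension of the \<open>j\<close>-th cohomology of the complex of socles, that is, of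
  \<open>Ext\<^sup>j(S\<^sub>\<pi>, k)\<close> with \<open>S\<^sub>\<pi>\<close> the simple sheaf at \<open>\<pi>\<close>.

  On a simplicial complex this cohomology can be computed one vertex at a time.  For a set \<open>W\<close> of
  vertices outside \<open>\<pi>\<close> let \<open>S(\<pi>, W)\<close> be the constant sheaf supported on the simplices that contain
  \<open>\<pi>\<close> and avoid \<open>W\<close>; if \<open>W\<close> consists of all other vertices it is \<open>S\<^sub>\<pi>\<close>, and if \<open>W\<close> is empty it is
  projective.  For a further vertex \<open>w\<close> there is a short exact sequence
  \<open>0 \<rightarrow> S(\<pi> + w, W) \<rightarrow> S(\<pi>, W) \<rightarrow> S(\<pi>, W + w) \<rightarrow> 0\<close>, and mapping it into an injective
  resolution gives a short exact sequence of complexes.  Its long exact sequence compares the three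
  cohomology dimensions (\<open>ext_dim_insert\<close>), and these comparisons are proved by counting dimensions,
  without connecting homomorphisms or orientations.

  Induction on \<open>W\<close> bounds \<open>m\<^sup>j(\<pi>)\<close> by the number of cofaces of \<open>\<pi>\<close> of codimension \<open>j\<close>
  (\<open>ext_dim_le_card_cofaces\<close>).  Summing over the star of \<open>\<sigma>\<close> and exchanging the roles of \<open>\<pi>\<close> and of
  its coface \<open>\<tau>\<close>, each \<open>\<tau>\<close> in the star is counted at most \<open>(dim \<tau> - dim \<sigma>) choose j\<close> times, which
  is at most \<open>k choose j\<close>.

  In the \<open>k\<close>-skeleton of a simplex the same induction gives vanishing below the top degree, and with
  it Pascal's recursion for a lower bound in the top degree \<open>j = k - dim \<pi>\<close>
  (\<open>ext_dim_skeleton\<close>).  The \<open>n choose (k - j)\<close> simplices of dimension \<open>k - j\<close> through the vertex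
  alone then contribute at least \<open>(n choose (k - j)) * ((n - 1 - (k - j)) choose j)\<close> to the star,
  while the star has \<open>\<Sum>i\<le>k. n choose i\<close> elements; the quotient tends to \<open>k choose j\<close>, so the star
  complexity is squeezed to this limit.
\<close>

section \<open>Finite-dimensional subspaces of the coordinate space\<close>

interpretation coord_pair: vector_space_pair
    "cscale :: 'k::field \<Rightarrow> 'k vect \<Rightarrow> 'k vect" "cscale :: 'k \<Rightarrow> 'k vect \<Rightarrow> 'k vect"
  by unfold_locales

abbreviation vect_linear :: "('k::field vect \<Rightarrow> 'k vect) \<Rightarrow> bool" where
  "vect_linear \<equiv> Vector_Spaces.linear cscale cscale"

lemma cscale_nth: "cscale c x i = c * x i"
  by (simp add: cscale_def)

text \<open>Vectors are functions, and the pointwise rules as default simplification rules turn an equation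
  between vectors such as \<open>g (x + y) = g x + g y\<close> into one between lambda abstractions, where the
  linear algebra rules no longer match.  They are used only on request.\<close>

lemmas vect_nth = cscale_nth plus_fun_apply zero_fun_apply minus_apply

declare plus_fun_apply [simp del] zero_fun_apply [simp del] minus_apply [simp del]

lemma fd_spaceD: "fd_space V \<Longrightarrow> coord.subspace V"
  by (simp add: fd_space_def)

lemma fd_basis:
  assumes "fd_space V"
  obtains B where "finite B" "coord.independent B" "coord.span B = V" "card B = coord.dim V"
proof -
  obtain C where C: "finite C" "V = coord.span C" using assms by (auto simp: fd_space_def)
  obtain B where B: "B \<subseteq> C" "coord.independent B" "C \<subseteq> coord.span B"
    using coord.maximal_independent_subset by metis
  have s: "coord.span B = V"
    using B C coord.span_mono coord.span_minimal coord.subspace_span by (metis subset_antisym)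
  show ?thesis
    by (rule that[OF _ B(2) s]) (use B C s in \<open>auto intro: finite_subset simp: coord.dim_eq_card\<close>)
qed

lemma fd_finite_independent:
  assumes "fd_space V" "coord.independent B" "B \<subseteq> V"
  shows "finite B \<and> card B \<le> coord.dim V"
proof -
  obtain C where C: "finite C" "coord.span C = V" "card C = coord.dim V" using fd_basis[OF assms(1)] by metis
  show ?thesis using coord.independent_span_bound[OF C(1) assms(2)] C assms(3) by auto
qed

lemma fd_space_span: "finite B \<Longrightarrow> fd_space (coord.span B)"
  by (auto simp: fd_space_def)

lemma fd_subspace:
  assumes "fd_space V" "coord.subspace U" "U \<subseteq> V"
  shows "fd_space U"
proof -
  obtain B where B: "B \<subseteq> U" "coord.independent B" "U \<subseteq> coord.span B"
    using coord.maximal_independent_subset by metis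
  have "finite B" using fd_finite_independent[OF assms(1) B(2)] B(1) assms(3) by auto
  moreover have "U = coord.span B"
    using B assms(2) coord.span_minimal by (metis subset_antisym)
  ultimately show ?thesis using fd_space_span by simp
qed

lemma fd_dim_mono:
  assumes "fd_space V" "U \<subseteq> V"
  shows "coord.dim U \<le> coord.dim V"
proof -
  obtain C where C: "finite C" "coord.span C = V" "card C = coord.dim V" using fd_basis[OF assms(1)] by metis
  show ?thesis using coord.dim_le_card[of U C] C assms by auto
qed

lemma fd_dim_eq:
  assumes V: "fd_space V" and U: "coord.subspace U" "U \<subseteq> V" and le: "coord.dim V \<le> coord.dim U"
  shows "U = V"
proof (rule ccontr)
  assume "U \<noteq> V"
  then obtain x where x: "x \<in> V" "x \<notin> U" using U by auto
  obtain B where B: "finite B" "coord.independent B" "coord.span B = U" "card B = coord.dim U"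
    using fd_basis[OF fd_subspace[OF V U]] by metis
  have i: "coord.independent (insert x B)" using B x by (simp add: coord.independent_insertI)
  have "B \<subseteq> U" using B(3) coord.span_superset by auto
  then have "insert x B \<subseteq> V" using U x by auto
  from fd_finite_independent[OF V i this] have "card (insert x B) \<le> coord.dim V" by auto
  moreover have "x \<notin> B" using x \<open>B \<subseteq> U\<close> by auto
  ultimately show False using B le by auto
qed

lemma linear_mapD:
  assumes "linear_map V W f"
  shows "x \<in> V \<Longrightarrow> f x \<in> W" "x \<in> V \<Longrightarrow> y \<in> V \<Longrightarrow> f (x + y) = f x + f y"
    "x \<in> V \<Longrightarrow> f (cscale c x) = cscale c (f x)"
  using assms by (auto simp: linear_map_def)

text \<open>Maps between stalks are linear only on the stalk.  Replacing them by globally linear maps makes the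
  theory of linear maps on a vector space applicable.\<close>

lemma linear_map_extends:
  assumes f: "linear_map V W f" and V: "coord.subspace V"
  obtains g where "vect_linear g" "\<And>x. x \<in> V \<Longrightarrow> g x = f x"
proof -
  obtain B where B: "B \<subseteq> V" "coord.independent B" "V \<subseteq> coord.span B"
    using coord.maximal_independent_subset by metis
  obtain g where g: "vect_linear g" "\<forall>x\<in>B. g x = f x"
    using coord_pair.linear_independent_extend[OF B(2)] by blast
  have "x \<in> coord.span B \<Longrightarrow> x \<in> V \<and> g x = f x" for x
  proof (induction rule: coord.span_induct_alt)
    case base
    have "cscale 0 0 = (0::'a vect)" by simp
    then have "f 0 = 0"
      using linear_mapD(3)[OF f coord.subspace_0[OF V], of 0] by simp
    then show ?case using g coord_pair.linear_0[OF g(1)] coord.subspace_0[OF V] by simp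
  next
    case (step c x y)
    have "x \<in> V" using step B by auto
    then show ?case using step g linear_mapD[OF f] V
      by (simp add: coord_pair.linear_add[OF g(1)] coord_pair.linear_scale[OF g(1)]
          coord.subspace_scale coord.subspace_add)
  qed
  then show ?thesis using that g B by blast
qed

lemma linear_map_zero: "linear_map V W f \<Longrightarrow> coord.subspace V \<Longrightarrow> f 0 = 0"
  by (metis linear_map_extends coord.subspace_0 coord_pair.linear_0)

lemma linear_map_diff:
  "linear_map V W f \<Longrightarrow> coord.subspace V \<Longrightarrow> x \<in> V \<Longrightarrow> y \<in> V \<Longrightarrow> f (x - y) = f x - f y"
  by (metis linear_map_extends coord.subspace_diff coord_pair.linear_diff)

lemma linear_map_sum:
  assumes "linear_map V W f" "coord.subspace V" "\<And>i. i \<in> S \<Longrightarrow> x i \<in> V"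
  shows "f (\<Sum>i\<in>S. x i) = (\<Sum>i\<in>S. f (x i))"
proof -
  obtain g where g: "vect_linear g" "\<And>x. x \<in> V \<Longrightarrow> g x = f x" using linear_map_extends assms by metis
  have "(\<Sum>i\<in>S. x i) \<in> V" using assms coord.subspace_sum by metis
  then have "f (\<Sum>i\<in>S. x i) = g (\<Sum>i\<in>S. x i)" using g by simp
  also have "\<dots> = (\<Sum>i\<in>S. f (x i))" using g assms
    by (simp add: coord_pair.linear_sum[OF g(1)])
  finally show ?thesis .
qed

lemma linear_map_of_linear: "vect_linear g \<Longrightarrow> (\<And>x. x \<in> V \<Longrightarrow> g x \<in> W) \<Longrightarrow> linear_map V W g"
  by (simp add: linear_map_def coord_pair.linear_add coord_pair.linear_scale)

lemma linear_map_subset: "linear_map V W f \<Longrightarrow> U \<subseteq> V \<Longrightarrow> (\<And>x. x \<in> U \<Longrightarrow> f x \<in> W') \<Longrightarrow> linear_map U W' f"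
  by (simp add: linear_map_def subset_iff)

lemma linear_map_comp: "linear_map U V f \<Longrightarrow> linear_map V W g \<Longrightarrow> linear_map U W (\<lambda>x. g (f x))"
  by (auto simp: linear_map_def)

lemma subspace_linear_kernel:
  "linear_map V W f \<Longrightarrow> coord.subspace V \<Longrightarrow> coord.subspace {x \<in> V. f x = 0}"
  using linear_map_zero[of V W f]
  by (auto simp: coord.subspace_def linear_map_def)

lemma subspace_linear_image:
  assumes "linear_map V W f" "coord.subspace V"
  shows "coord.subspace (f ` V)"
proof -
  obtain g where g: "vect_linear g" "\<And>x. x \<in> V \<Longrightarrow> g x = f x" using linear_map_extends assms by metis
  have "f ` V = g ` V" using g by auto
  then show ?thesis using coord_pair.linear_subspace_image[OF g(1) assms(2)] by simp
qed

lemma fd_image: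
  assumes "linear_map V W f" "fd_space V"
  shows "fd_space (f ` V)"
proof -
  obtain g where g: "vect_linear g" "\<And>x. x \<in> V \<Longrightarrow> g x = f x"
    using linear_map_extends assms fd_spaceD by metis
  obtain B where B: "finite B" "coord.span B = V" using fd_basis[OF assms(2)] by metis
  have "f ` V = g ` coord.span B" using g B by auto
  also have "\<dots> = coord.span (g ` B)" using coord_pair.linear_span_image[OF g(1)] by simp
  finally show ?thesis using fd_space_span[of "g ` B"] B(1) by simp
qed

lemma linear_map_inj_iff:
  assumes "linear_map V W f" "coord.subspace V"
  shows "inj_on f V \<longleftrightarrow> (\<forall>x\<in>V. f x = 0 \<longrightarrow> x = 0)"
proof
  assume "inj_on f V"
  then show "\<forall>x\<in>V. f x = 0 \<longrightarrow> x = 0"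
    using linear_map_zero[OF assms] coord.subspace_0[OF assms(2)] by (metis inj_onD)
next
  assume a: "\<forall>x\<in>V. f x = 0 \<longrightarrow> x = 0"
  show "inj_on f V"
  proof (rule inj_onI)
    fix x y assume "x \<in> V" "y \<in> V" "f x = f y"
    then have "x - y = 0" using a linear_map_diff[OF assms, of x y] coord.subspace_diff[OF assms(2), of x y] by auto
    then show "x = y" by simp
  qed
qed

text \<open>The coordinate space is infinite-dimensional, so the count is done on bases: a basis of the
  kernel extends to a basis of \<open>V\<close>, and the added vectors map to a basis of the image.\<close>

lemma rank_nullity:
  assumes f: "linear_map V W f" and V: "fd_space V"
  shows "coord.dim V = coord.dim {x\<in>V. f x = 0} + coord.dim (f ` V)"
proof -
  let ?N = "{x\<in>V. f x = 0}"
  note sV = fd_spaceD[OF V]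
  obtain g where g: "vect_linear g" "\<And>x. x \<in> V \<Longrightarrow> g x = f x" using linear_map_extends[OF f sV] by metis
  have sN: "coord.subspace ?N" using subspace_linear_kernel[OF f sV] .
  obtain A where A: "finite A" "coord.independent A" "coord.span A = ?N" "card A = coord.dim ?N"
    using fd_basis[OF fd_subspace[OF V sN]] by blast
  have AV: "A \<subseteq> V" using A(3) coord.span_superset[of A] by auto
  obtain B where B: "A \<subseteq> B" "B \<subseteq> V" "coord.independent B" "V \<subseteq> coord.span B"
    using coord.maximal_independent_subset_extend[OF AV A(2)] by blast
  have fB: "finite B" using fd_finite_independent[OF V B(3,2)] by auto
  have dV: "coord.dim V = card B" using coord.basis_card_eq_dim[OF B(2,4,3)] by simp
  have sB: "coord.span B = V" using B coord.span_minimal[OF B(2) sV] by auto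
  let ?C = "B - A"
  have CV: "coord.span ?C \<subseteq> V" using sB coord.span_mono[of ?C B] by auto
  have ker: "x = 0" if x: "x \<in> coord.span ?C" "f x = 0" for x
  proof -
    have "x \<in> coord.span A" using A(3) x CV by auto
    moreover obtain h where h: "vect_linear h" "\<forall>b\<in>B. h b = (if b \<in> A then b else 0)"
      using coord_pair.linear_independent_extend[OF B(3), of "\<lambda>b. if b \<in> A then b else 0"] by blast
    ultimately have "h x = x"
      using coord_pair.linear_eq_on[OF h(1) coord.linear_id, of x A] B(1) h(2) by (auto simp: subset_iff)
    moreover have "h x = 0"
      using coord_pair.linear_eq_0_on_span[OF h(1) _ x(1)] h(2) by auto
    ultimately show ?thesis by simp
  qed
  have lC: "linear_map (coord.span ?C) UNIV f" using linear_map_subset[OF f CV] by auto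
  have "inj_on f (coord.span ?C)" using linear_map_inj_iff[OF lC] ker by simp
  then have ig: "inj_on g (coord.span ?C)" using g(2) CV by (metis (no_types, lifting) inj_on_cong subsetD)
  have iC: "coord.independent ?C" using B(3) coord.independent_mono by blast
  have igC: "coord.independent (g ` ?C)" using coord_pair.linear_independent_injective_image[OF g(1) iC ig] .
  have "f ` V = g ` coord.span B" using g sB by auto
  also have "\<dots> = coord.span (g ` B)" using coord_pair.linear_span_image[OF g(1)] by simp
  also have "\<dots> = coord.span (g ` ?C)"
  proof -
    have "g a = 0" if "a \<in> A" for a using that A(3) g(2) coord.span_superset[of A] by auto
    then have "g ` B \<subseteq> insert 0 (g ` ?C)" by auto
    then have "coord.span (g ` B) \<subseteq> coord.span (g ` ?C)"
      using coord.span_mono[of "g ` B" "insert 0 (g ` ?C)"] by simp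
    then show ?thesis using coord.span_mono[of "g ` ?C" "g ` B"] by auto
  qed
  finally have "coord.dim (f ` V) = card (g ` ?C)" using coord.dim_span_eq_card_independent[OF igC] by simp
  also have "\<dots> = card ?C" using ig coord.span_superset by (meson card_image inj_on_subset)
  finally show ?thesis using dV A(4) card_mono[OF fB B(1)] by (simp add: card_Diff_subset[OF A(1) B(1)])
qed

lemma dim_inj_image:
  assumes "linear_map V W f" "fd_space V" "inj_on f V"
  shows "coord.dim (f ` V) = coord.dim V"
proof -
  note sV = fd_spaceD[OF assms(2)]
  have "{x\<in>V. f x = 0} = {0}"
    using assms(3) linear_map_inj_iff[OF assms(1) sV] linear_map_zero[OF assms(1) sV] coord.subspace_0[OF sV]
    by auto
  moreover have "coord.dim {0::'a vect} = 0"
    using coord.dim_le_card[of "{0::'a vect}" "{}"] by simp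
  ultimately show ?thesis using rank_nullity[OF assms(1,2)] by simp
qed

lemma inj_endo_surj:
  assumes "linear_map V V f" "fd_space V" "inj_on f V"
  shows "f ` V = V"
proof (rule fd_dim_eq[OF assms(2)])
  show "coord.subspace (f ` V)" using subspace_linear_image[OF assms(1)] fd_spaceD[OF assms(2)] .
  show "f ` V \<subseteq> V" using linear_mapD(1)[OF assms(1)] by auto
  show "coord.dim V \<le> coord.dim (f ` V)" using dim_inj_image[OF assms] by simp
qed

text \<open>Every vector space is an injective object; all injectivity of sheaves comes from this.\<close>

lemma linear_extend_along_injection:
  assumes i: "linear_map U V i" "inj_on i U" and f: "linear_map U W f" and U: "coord.subspace U"
  obtains g where "vect_linear g" "\<And>x. x \<in> U \<Longrightarrow> g (i x) = f x"
proof -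
  obtain i' where i': "vect_linear i'" "\<And>x. x \<in> U \<Longrightarrow> i' x = i x" using linear_map_extends[OF i(1) U] by metis
  obtain f' where f': "vect_linear f'" "\<And>x. x \<in> U \<Longrightarrow> f' x = f x" using linear_map_extends[OF f U] by metis
  have "inj_on i' U" using i(2) i'(2) by (metis inj_on_cong)
  then obtain p where p: "vect_linear p" "\<forall>v\<in>U. p (i' v) = v"
    using coord_pair.linear_exists_left_inverse_on[OF i'(1) U] by blast
  show ?thesis
    by (rule that[of "f' \<circ> p"]) (use p i' f' Vector_Spaces.linear_compose[OF p(1) f'(1)] in auto)
qed

text \<open>The quotient by \<open>U\<close>, realized inside the coordinate space as the image of \<open>id - p\<close> for a
  projection \<open>p\<close> onto \<open>U\<close>.\<close>

lemma linear_with_kernel: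
  assumes U: "coord.subspace U"
  obtains g :: "'k::field vect \<Rightarrow> 'k vect" where "vect_linear g" "\<And>x. g x = 0 \<longleftrightarrow> x \<in> U"
proof -
  have "inj_on id U" by simp
  then obtain p :: "'k vect \<Rightarrow> 'k vect" where p: "range p \<subseteq> U" "vect_linear p" "\<forall>v\<in>U. p (id v) = v"
    using coord_pair.linear_exists_left_inverse_on[OF coord.linear_id U] by blast
  have "vect_linear (\<lambda>x. x - p x)"
    using coord_pair.linear_compose_sub[OF coord.linear_ident p(2)] .
  moreover have "x - p x = 0 \<longleftrightarrow> x \<in> U" for x
    using p(1,3) by (metis eq_iff_diff_eq_0 id_apply rangeI subsetD)
  ultimately show ?thesis using that by blast
qed

lemma dim_span_family:
  fixes v :: "nat \<Rightarrow> 'k::field vect"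
  assumes "\<And>c. (\<Sum>i<n. cscale (c i) (v i)) = 0 \<Longrightarrow> \<forall>i<n. c i = 0"
  shows "coord.dim (coord.span (v ` {..<n})) = n"
proof -
  have inj: "inj_on v {..<n}"
  proof (rule inj_onI, rule ccontr)
    fix i j assume ij: "i \<in> {..<n}" "j \<in> {..<n}" "v i = v j" "i \<noteq> j"
    let ?c = "\<lambda>l. if l = i then 1 else if l = j then -1 else (0::'k)"
    have "(\<Sum>l<n. cscale (?c l) (v l)) = (\<Sum>l\<in>{i,j}. cscale (?c l) (v l))"
      by (rule sum.mono_neutral_right) (use ij in auto)
    also have "\<dots> = 0" using ij by simp
    finally have "?c i = 0" using assms[of ?c] ij by blast
    then show False by simp
  qed
  have "coord.independent (v ` {..<n})"
  proof (rule coord.independent_if_scalars_zero)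
    fix f x assume s: "(\<Sum>x\<in>v ` {..<n}. cscale (f x) x) = 0" and x: "x \<in> v ` {..<n}"
    have "(\<Sum>i<n. cscale (f (v i)) (v i)) = 0" using s inj by (simp add: sum.reindex)
    from assms[OF this] show "f x = 0" using x by auto
  qed auto
  then show ?thesis using inj by (simp add: coord.dim_eq_card_independent card_image)
qed

definition unit_vect :: "nat \<Rightarrow> 'k::field vect" where
  "unit_vect n = (\<lambda>i. if i = n then 1 else 0)"

lemma line_span: "line = coord.span {unit_vect 0 :: 'k::field vect}"
proof
  show "line \<subseteq> coord.span {unit_vect 0 :: 'k::field vect}"
  proof
    fix x :: "'k vect" assume "x \<in> line"
    then have "x = cscale (x 0) (unit_vect 0)" by (auto simp: line_def unit_vect_def fun_eq_iff vect_nth)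
    then show "x \<in> coord.span {unit_vect 0}" by (metis coord.span_base coord.span_scale singletonI)
  qed
  show "coord.span {unit_vect 0} \<subseteq> (line :: 'k vect set)"
    by (rule coord.span_minimal) (auto simp: line_def unit_vect_def coord.subspace_def vect_nth)
qed

lemma fd_line: "fd_space line"
  unfolding line_span by (rule fd_space_span) simp

lemma fd_zero: "fd_space {0}"
  using fd_space_span[of "{}"] by simp

lemma unit_line [simp]: "unit_vect 0 \<in> line"
  by (simp add: line_def unit_vect_def)

lemma line_eq: "x \<in> line \<Longrightarrow> x = cscale (x 0) (unit_vect 0)"
  by (auto simp: line_def unit_vect_def fun_eq_iff vect_nth)

lemma dim_line: "coord.dim (line :: 'k::field vect set) = 1"
proof -
  have "(unit_vect 0 :: 'k vect) \<noteq> 0" by (metis unit_vect_def zero_fun_apply zero_neq_one)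
  then show ?thesis unfolding line_span using coord.dim_span_eq_card_independent[of "{unit_vect 0 :: 'k vect}"] by simp
qed

section \<open>Sheaves, socles, kernels and cokernels\<close>

lemma is_sheafD:
  assumes "is_sheaf P F"
  shows "\<pi> \<in> P \<Longrightarrow> fd_space (stalk F \<pi>)"
    "\<pi> \<in> P \<Longrightarrow> coord.subspace (stalk F \<pi>)"
    "\<tau> \<in> P \<Longrightarrow> \<gamma> \<in> P \<Longrightarrow> \<tau> \<le> \<gamma> \<Longrightarrow> linear_map (stalk F \<tau>) (stalk F \<gamma>) (smap F \<tau> \<gamma>)"
    "\<tau> \<in> P \<Longrightarrow> \<gamma> \<in> P \<Longrightarrow> \<tau> \<le> \<gamma> \<Longrightarrow> x \<in> stalk F \<tau> \<Longrightarrow> smap F \<tau> \<gamma> x \<in> stalk F \<gamma>"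
    "\<tau> \<in> P \<Longrightarrow> x \<in> stalk F \<tau> \<Longrightarrow> smap F \<tau> \<tau> x = x"
    "\<sigma> \<in> P \<Longrightarrow> \<tau> \<in> P \<Longrightarrow> \<gamma> \<in> P \<Longrightarrow> \<sigma> \<le> \<tau> \<Longrightarrow> \<tau> \<le> \<gamma> \<Longrightarrow> x \<in> stalk F \<sigma> \<Longrightarrow>
       smap F \<tau> \<gamma> (smap F \<sigma> \<tau> x) = smap F \<sigma> \<gamma> x"
    "\<tau> \<in> P \<Longrightarrow> \<gamma> \<in> P \<Longrightarrow> \<tau> \<le> \<gamma> \<Longrightarrow> smap F \<tau> \<gamma> 0 = 0"
proof -
  show *: "\<tau> \<in> P \<Longrightarrow> \<gamma> \<in> P \<Longrightarrow> \<tau> \<le> \<gamma> \<Longrightarrow> linear_map (stalk F \<tau>) (stalk F \<gamma>) (smap F \<tau> \<gamma>)" for \<tau> \<gamma>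
    using assms by (auto simp: is_sheaf_def)
  show **: "\<pi> \<in> P \<Longrightarrow> coord.subspace (stalk F \<pi>)" for \<pi>
    using assms by (auto simp: is_sheaf_def fd_space_def)
  show "\<tau> \<in> P \<Longrightarrow> \<gamma> \<in> P \<Longrightarrow> \<tau> \<le> \<gamma> \<Longrightarrow> x \<in> stalk F \<tau> \<Longrightarrow> smap F \<tau> \<gamma> x \<in> stalk F \<gamma>"
    using *[of \<tau> \<gamma>] linear_mapD(1) by blast
  show "\<tau> \<in> P \<Longrightarrow> \<gamma> \<in> P \<Longrightarrow> \<tau> \<le> \<gamma> \<Longrightarrow> smap F \<tau> \<gamma> 0 = 0"
    using linear_map_zero[OF * **] by blast
qed (use assms in \<open>auto simp: is_sheaf_def\<close>)

lemma nat_transD: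
  assumes "nat_trans P F G f"
  shows "\<pi> \<in> P \<Longrightarrow> linear_map (stalk F \<pi>) (stalk G \<pi>) (f \<pi>)"
    "\<pi> \<in> P \<Longrightarrow> x \<in> stalk F \<pi> \<Longrightarrow> f \<pi> x \<in> stalk G \<pi>"
    "\<tau> \<in> P \<Longrightarrow> \<gamma> \<in> P \<Longrightarrow> \<tau> \<le> \<gamma> \<Longrightarrow> x \<in> stalk F \<tau> \<Longrightarrow> f \<gamma> (smap F \<tau> \<gamma> x) = smap G \<tau> \<gamma> (f \<tau> x)"
proof -
  show "\<pi> \<in> P \<Longrightarrow> linear_map (stalk F \<pi>) (stalk G \<pi>) (f \<pi>)"
    "\<tau> \<in> P \<Longrightarrow> \<gamma> \<in> P \<Longrightarrow> \<tau> \<le> \<gamma> \<Longrightarrow> x \<in> stalk F \<tau> \<Longrightarrow> f \<gamma> (smap F \<tau> \<gamma> x) = smap G \<tau> \<gamma> (f \<tau> x)"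
    using assms by (auto simp: nat_trans_def)
  then show "\<pi> \<in> P \<Longrightarrow> x \<in> stalk F \<pi> \<Longrightarrow> f \<pi> x \<in> stalk G \<pi>"
    using linear_mapD(1) by blast
qed

lemma nat_trans_comp:
  assumes "nat_trans P F G f" "nat_trans P G H g"
  shows "nat_trans P F H (\<lambda>\<pi> x. g \<pi> (f \<pi> x))"
  unfolding nat_trans_def
proof (intro conjI ballI impI)
  show "linear_map (stalk F \<pi>) (stalk H \<pi>) (\<lambda>x. g \<pi> (f \<pi> x))" if "\<pi> \<in> P" for \<pi>
    using linear_map_comp[OF nat_transD(1)[OF assms(1) that] nat_transD(1)[OF assms(2) that]] .
  show "g \<gamma> (f \<gamma> (smap F \<tau> \<gamma> x)) = smap H \<tau> \<gamma> (g \<tau> (f \<tau> x))"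
    if t: "\<tau> \<in> P" "\<gamma> \<in> P" "\<tau> \<le> \<gamma>" "x \<in> stalk F \<tau>" for \<tau> \<gamma> x
    using nat_transD(3)[OF assms(1) t] nat_transD(3)[OF assms(2) t(1-3)] nat_transD(2)[OF assms(1) t(1,4)] by simp
qed

lemma inj_transD: "inj_trans P F G f \<Longrightarrow> nat_trans P F G f"
  "inj_trans P F G f \<Longrightarrow> \<pi> \<in> P \<Longrightarrow> inj_on (f \<pi>) (stalk F \<pi>)"
  by (auto simp: inj_trans_def)

text \<open>These vectors form \<open>Hom(S\<^sub>\<pi>, F)\<close>, where \<open>S\<^sub>\<pi>\<close> is the simple sheaf at \<open>\<pi>\<close>.\<close>

definition socle :: "'p::order set \<Rightarrow> ('p, 'k::field) sheaf \<Rightarrow> 'p \<Rightarrow> 'k vect set" where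
  "socle P F \<pi> = {x \<in> stalk F \<pi>. \<forall>\<gamma>\<in>P. \<pi> < \<gamma> \<longrightarrow> smap F \<pi> \<gamma> x = 0}"

lemma subspace_socle:
  assumes "is_sheaf P F" "\<pi> \<in> P"
  shows "coord.subspace (socle P F \<pi>)"
  using is_sheafD[OF assms(1)] assms(2)
  by (auto simp: socle_def coord.subspace_def linear_map_def)

lemma fd_socle: "is_sheaf P F \<Longrightarrow> \<pi> \<in> P \<Longrightarrow> fd_space (socle P F \<pi>)"
  by (rule fd_subspace[OF is_sheafD(1) subspace_socle]) (auto simp: socle_def)

lemma nat_trans_socle:
  assumes "nat_trans P F G f" "is_sheaf P F" "is_sheaf P G" "\<pi> \<in> P" "x \<in> socle P F \<pi>"
  shows "f \<pi> x \<in> socle P G \<pi>"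
proof -
  have "smap G \<pi> \<gamma> (f \<pi> x) = 0" if "\<gamma> \<in> P" "\<pi> < \<gamma>" for \<gamma>
  proof -
    have "smap G \<pi> \<gamma> (f \<pi> x) = f \<gamma> (smap F \<pi> \<gamma> x)"
      using nat_transD(3)[OF assms(1,4) that(1), of x] that assms(5) by (simp add: socle_def)
    also have "\<dots> = f \<gamma> 0" using that assms(5) by (simp add: socle_def)
    also have "\<dots> = 0"
      using linear_map_zero[OF nat_transD(1)[OF assms(1)] is_sheafD(2)[OF assms(2)]] that by blast
    finally show ?thesis .
  qed
  then show ?thesis using assms nat_transD(2) by (fastforce simp: socle_def)
qed

text \<open>The socle meets every nonzero subsheaf: a nonzero vector, moved upwards as long as it stays
  nonzero, ends in a socle by finiteness of \<open>P\<close>.  So a kernel that misses the socles is zero.\<close>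

lemma inj_trans_if_inj_on_socle:
  assumes P: "finite P" and G: "is_sheaf P G" and H: "is_sheaf P H" and f: "nat_trans P G H f"
    and inj: "\<And>\<pi> x. \<pi> \<in> P \<Longrightarrow> x \<in> socle P G \<pi> \<Longrightarrow> f \<pi> x = 0 \<Longrightarrow> x = 0"
  shows "inj_trans P G H f"
proof -
  have "x = 0" if g: "\<gamma> \<in> P" "x \<in> stalk G \<gamma>" "f \<gamma> x = 0" for \<gamma> x
  proof (rule ccontr)
    assume "x \<noteq> 0"
    let ?A = "{\<pi>\<in>P. \<gamma> \<le> \<pi> \<and> smap G \<gamma> \<pi> x \<noteq> 0}"
    have "\<gamma> \<in> ?A" using g \<open>x \<noteq> 0\<close> is_sheafD(5)[OF G] by simp
    then have "finite ?A" "?A \<noteq> {}" using P by auto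
    then obtain \<pi> where \<pi>: "\<pi> \<in> ?A" and max: "\<And>\<tau>. \<tau> \<in> ?A \<Longrightarrow> \<pi> \<le> \<tau> \<Longrightarrow> \<pi> = \<tau>"
      using finite_has_maximal[of ?A] by blast
    let ?y = "smap G \<gamma> \<pi> x"
    have "?y \<in> socle P G \<pi>"
    proof -
      have "smap G \<pi> \<tau> ?y = 0" if "\<tau> \<in> P" "\<pi> < \<tau>" for \<tau>
      proof -
        have "smap G \<pi> \<tau> ?y = smap G \<gamma> \<tau> x" using is_sheafD(6)[OF G g(1) _ that(1)] \<pi> that g by auto
        moreover have "\<tau> \<notin> ?A" using max[of \<tau>] that(2) unfolding less_le by blast
        moreover have "\<gamma> \<le> \<tau>" using \<pi> that(2) by auto
        ultimately show ?thesis using that(1) by auto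
      qed
      then show ?thesis using is_sheafD(4)[OF G g(1)] \<pi> g by (auto simp: socle_def)
    qed
    moreover have "f \<pi> ?y = smap H \<gamma> \<pi> (f \<gamma> x)" using nat_transD(3)[OF f g(1)] \<pi> g by auto
    then have "f \<pi> ?y = 0" using g \<pi> is_sheafD(7)[OF H g(1)] by auto
    ultimately have "?y = 0" using inj \<pi> by blast
    then show False using \<pi> by simp
  qed
  then have "inj_on (f \<gamma>) (stalk G \<gamma>)" if "\<gamma> \<in> P" for \<gamma>
    unfolding linear_map_inj_iff[OF nat_transD(1)[OF f that] is_sheafD(2)[OF G that]] using that by simp
  then show ?thesis unfolding inj_trans_def using f by simp
qed

definition kernel_sheaf :: "('p, 'k::field) sheaf \<Rightarrow> ('p, 'k) nat_map \<Rightarrow> ('p, 'k) sheaf" where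
  "kernel_sheaf G f = \<lparr>stalk = ker_at G f, smap = smap G\<rparr>"

lemma kernel_sheaf_sel [simp]: "stalk (kernel_sheaf G f) = ker_at G f" "smap (kernel_sheaf G f) = smap G"
  by (auto simp: kernel_sheaf_def)

lemma ker_at_subset: "ker_at G f \<pi> \<subseteq> stalk G \<pi>"
  by (auto simp: ker_at_def)

lemma is_sheaf_kernel:
  assumes G: "is_sheaf P G" and H: "is_sheaf P H" and f: "nat_trans P G H f"
  shows "is_sheaf P (kernel_sheaf G f)"
proof -
  have sub: "coord.subspace (ker_at G f \<pi>)" if "\<pi> \<in> P" for \<pi>
    using subspace_linear_kernel[OF nat_transD(1)[OF f that] is_sheafD(2)[OF G that]] by (simp add: ker_at_def)
  have stable: "smap G \<tau> \<gamma> x \<in> ker_at G f \<gamma>"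
    if "\<tau> \<in> P" "\<gamma> \<in> P" "\<tau> \<le> \<gamma>" "x \<in> ker_at G f \<tau>" for \<tau> \<gamma> x
    using that nat_transD(3)[OF f that(1-3), of x] is_sheafD(4)[OF G that(1-3)] is_sheafD(7)[OF H that(1-3)]
    by (auto simp: ker_at_def)
  show ?thesis
    unfolding is_sheaf_def kernel_sheaf_sel
  proof (intro conjI ballI impI; (elim conjE)?)
    show "fd_space (ker_at G f \<pi>)" if "\<pi> \<in> P" for \<pi>
      using fd_subspace[OF is_sheafD(1)[OF G that] sub[OF that] ker_at_subset] .
    show "linear_map (ker_at G f \<tau>) (ker_at G f \<gamma>) (smap G \<tau> \<gamma>)" if "\<tau> \<in> P" "\<gamma> \<in> P" "\<tau> \<le> \<gamma>" for \<tau> \<gamma>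
      using linear_map_subset[OF is_sheafD(3)[OF G that] ker_at_subset] stable[OF that] .
  qed (use is_sheafD(5,6)[OF G] in \<open>auto simp: ker_at_def\<close>)
qed

lemma inj_trans_kernel_inclusion: "is_sheaf P G \<Longrightarrow> inj_trans P (kernel_sheaf G f) G (\<lambda>\<pi> x. x)"
  by (auto simp: inj_trans_def nat_trans_def linear_map_def ker_at_def)

text \<open>The quotient of \<open>E\<close> by a subsheaf \<open>M\<close>, with \<open>q\<close> the projection.  The sheaf maps of the quotient are
  computed on representatives, which is independent of the choice because \<open>M\<close> is stable.\<close>

lemma exists_cokernel:
  fixes E :: "('p::order, 'k::field) sheaf"
  assumes E: "is_sheaf P E" and M: "\<And>\<pi>. \<pi> \<in> P \<Longrightarrow> coord.subspace (M \<pi>)"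
    "\<And>\<pi>. \<pi> \<in> P \<Longrightarrow> M \<pi> \<subseteq> stalk E \<pi>"
    and stable: "\<And>\<tau> \<gamma> x. \<tau> \<in> P \<Longrightarrow> \<gamma> \<in> P \<Longrightarrow> \<tau> \<le> \<gamma> \<Longrightarrow> x \<in> M \<tau> \<Longrightarrow> smap E \<tau> \<gamma> x \<in> M \<gamma>"
  obtains Q :: "('p, 'k) sheaf" and q where "is_sheaf P Q" "nat_trans P E Q q"
    "\<And>\<pi>. \<pi> \<in> P \<Longrightarrow> im_at E q \<pi> = stalk Q \<pi>" "\<And>\<pi>. \<pi> \<in> P \<Longrightarrow> ker_at E q \<pi> = M \<pi>"
proof -
  have "\<forall>\<pi>\<in>P. \<exists>g :: 'k vect \<Rightarrow> 'k vect. vect_linear g \<and> (\<forall>x. g x = 0 \<longleftrightarrow> x \<in> M \<pi>)"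
    using linear_with_kernel[OF M(1)] by metis
  then obtain q :: "('p, 'k) nat_map" where q: "\<And>\<pi>. \<pi> \<in> P \<Longrightarrow> vect_linear (q \<pi>)"
    "\<And>\<pi> x. \<pi> \<in> P \<Longrightarrow> q \<pi> x = 0 \<longleftrightarrow> x \<in> M \<pi>"
    by metis
  define Q :: "('p, 'k) sheaf" where
    "Q = \<lparr>stalk = im_at E q, smap = (\<lambda>\<tau> \<gamma> y. q \<gamma> (smap E \<tau> \<gamma> (inv_into (stalk E \<tau>) (q \<tau>) y)))\<rparr>"
  have sel: "stalk Q = im_at E q"
    "\<And>\<tau> \<gamma> y. smap Q \<tau> \<gamma> y = q \<gamma> (smap E \<tau> \<gamma> (inv_into (stalk E \<tau>) (q \<tau>) y))"
    by (auto simp: Q_def)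
  have smap_q: "smap Q \<tau> \<gamma> (q \<tau> x) = q \<gamma> (smap E \<tau> \<gamma> x)"
    if t: "\<tau> \<in> P" "\<gamma> \<in> P" "\<tau> \<le> \<gamma>" and x: "x \<in> stalk E \<tau>" for \<tau> \<gamma> x
  proof -
    let ?x = "inv_into (stalk E \<tau>) (q \<tau>) (q \<tau> x)"
    have x': "?x \<in> stalk E \<tau>" "q \<tau> ?x = q \<tau> x"
      using inv_into_into[of "q \<tau> x" "q \<tau>" "stalk E \<tau>"] f_inv_into_f[of "q \<tau> x" "q \<tau>" "stalk E \<tau>"] x by auto
    have "q \<tau> (?x - x) = 0" using x' coord_pair.linear_diff[OF q(1)[OF t(1)]] by simp
    then have "q \<gamma> (smap E \<tau> \<gamma> (?x - x)) = 0" using q(2) stable[OF t] t by blast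
    moreover have "smap E \<tau> \<gamma> (?x - x) = smap E \<tau> \<gamma> ?x - smap E \<tau> \<gamma> x"
      using linear_map_diff[OF is_sheafD(3)[OF E t] is_sheafD(2)[OF E t(1)] x'(1) x] .
    ultimately show ?thesis using coord_pair.linear_diff[OF q(1)[OF t(2)]] by (simp add: sel)
  qed
  have lq: "linear_map (stalk E \<pi>) (stalk Q \<pi>) (q \<pi>)" if "\<pi> \<in> P" for \<pi>
    by (rule linear_map_of_linear[OF q(1)[OF that]]) (auto simp: sel im_at_def)
  have "is_sheaf P Q"
    unfolding is_sheaf_def
  proof (intro conjI ballI impI; (elim conjE)?)
    show "fd_space (stalk Q \<pi>)" if "\<pi> \<in> P" for \<pi>
      using fd_image[OF lq[OF that] is_sheafD(1)[OF E that]] by (simp add: sel im_at_def)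
    show "linear_map (stalk Q \<tau>) (stalk Q \<gamma>) (smap Q \<tau> \<gamma>)" if t: "\<tau> \<in> P" "\<gamma> \<in> P" "\<tau> \<le> \<gamma>" for \<tau> \<gamma>
      unfolding linear_map_def
    proof (intro conjI ballI allI)
      fix y assume "y \<in> stalk Q \<tau>"
      then obtain x where x: "x \<in> stalk E \<tau>" "y = q \<tau> x" by (auto simp: sel im_at_def)
      then show "smap Q \<tau> \<gamma> y \<in> stalk Q \<gamma>"
        using smap_q[OF t x(1)] linear_mapD(1)[OF lq[OF t(2)]] is_sheafD(4)[OF E t x(1)] by simp
      show "smap Q \<tau> \<gamma> (cscale c y) = cscale c (smap Q \<tau> \<gamma> y)" for c
        using smap_q[OF t, of "cscale c x"] smap_q[OF t x(1)] coord_pair.linear_scale[OF q(1)] t x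
          linear_mapD(3)[OF is_sheafD(3)[OF E t] x(1)] coord.subspace_scale[OF is_sheafD(2)[OF E t(1)] x(1)]
        by simp
      fix y' assume "y' \<in> stalk Q \<tau>"
      then obtain x' where x': "x' \<in> stalk E \<tau>" "y' = q \<tau> x'" by (auto simp: sel im_at_def)
      show "smap Q \<tau> \<gamma> (y + y') = smap Q \<tau> \<gamma> y + smap Q \<tau> \<gamma> y'"
        using smap_q[OF t, of "x + x'"] smap_q[OF t x(1)] smap_q[OF t x'(1)] coord_pair.linear_add[OF q(1)] t x x'
          linear_mapD(2)[OF is_sheafD(3)[OF E t] x(1) x'(1)]
          coord.subspace_add[OF is_sheafD(2)[OF E t(1)] x(1) x'(1)]
        by simp
    qed
    show "smap Q \<tau> \<tau> y = y" if "\<tau> \<in> P" "y \<in> stalk Q \<tau>" for \<tau> y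
      using that smap_q[OF that(1) that(1)] is_sheafD(5)[OF E that(1)] by (auto simp: sel(1) im_at_def)
    show "smap Q \<tau> \<gamma> (smap Q \<sigma> \<tau> y) = smap Q \<sigma> \<gamma> y"
      if t: "\<sigma> \<in> P" "\<tau> \<in> P" "\<gamma> \<in> P" "y \<in> stalk Q \<sigma>" "\<sigma> \<le> \<tau>" "\<tau> \<le> \<gamma>" for \<sigma> \<tau> \<gamma> y
    proof -
      obtain x where x: "x \<in> stalk E \<sigma>" "y = q \<sigma> x" using t by (auto simp: sel im_at_def)
      then show ?thesis
        using smap_q[OF t(1,2,5) x(1)] smap_q[OF t(2,3,6) is_sheafD(4)[OF E t(1,2,5) x(1)]]
          smap_q[OF t(1,3) order_trans[OF t(5,6)] x(1)] is_sheafD(6)[OF E t(1-3,5,6) x(1)]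
        by simp
    qed
  qed
  moreover have "nat_trans P E Q q"
    unfolding nat_trans_def using lq smap_q by auto
  ultimately show ?thesis
    by (rule that) (use q(2) M(2) in \<open>auto simp: sel ker_at_def\<close>)
qed

section \<open>Injective hulls\<close>

text \<open>The direct sum of the sheaves \<open>[lab n]\<close> for \<open>n < N\<close>: the coordinate \<open>n\<close> carries the summand
  \<open>[lab n]\<close>, and is masked out at the elements that are not below \<open>lab n\<close>.\<close>

definition label_sheaf :: "nat \<Rightarrow> (nat \<Rightarrow> 'p::order) \<Rightarrow> ('p, 'k::field) sheaf" where
  "label_sheaf N lab =
     \<lparr>stalk = (\<lambda>\<gamma>. {x. \<forall>n. \<not> (n < N \<and> \<gamma> \<le> lab n) \<longrightarrow> x n = 0}),
      smap = (\<lambda>\<gamma> \<tau> x n. if \<tau> \<le> lab n then x n else 0)\<rparr>"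

lemma label_stalk: "x \<in> stalk (label_sheaf N lab) \<gamma> \<longleftrightarrow> (\<forall>n. \<not> (n < N \<and> \<gamma> \<le> lab n) \<longrightarrow> x n = 0)"
  by (simp add: label_sheaf_def)

lemma label_smap: "smap (label_sheaf N lab) \<gamma> \<tau> x = (\<lambda>n. if \<tau> \<le> lab n then x n else 0)"
  by (simp add: label_sheaf_def)

lemma sum_unit_vect_nth: "finite A \<Longrightarrow> (\<Sum>n\<in>A. cscale (c n) (unit_vect n)) m = (if m \<in> A then c m else 0)"
proof (induction A rule: finite_induct)
  case (insert a A)
  then show ?case by (auto simp: vect_nth unit_vect_def)
qed (simp add: vect_nth)

lemma fd_label_stalk: "fd_space (stalk (label_sheaf N lab :: ('p::order, 'k::field) sheaf) \<gamma>)"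
proof (rule fd_subspace)
  show "fd_space (coord.span (unit_vect ` {..<N}))" by (rule fd_space_span) simp
  show "coord.subspace (stalk (label_sheaf N lab :: ('p, 'k) sheaf) \<gamma>)"
    by (auto simp: coord.subspace_def label_stalk vect_nth)
  show "stalk (label_sheaf N lab :: ('p, 'k) sheaf) \<gamma> \<subseteq> coord.span (unit_vect ` {..<N})"
  proof
    fix x :: "'k vect" assume "x \<in> stalk (label_sheaf N lab :: ('p, 'k) sheaf) \<gamma>"
    then have "x = (\<Sum>n<N. cscale (x n) (unit_vect n))"
      by (auto simp: fun_eq_iff sum_unit_vect_nth label_stalk)
    also have "\<dots> \<in> coord.span (unit_vect ` {..<N})"
      by (intro coord.span_sum coord.span_scale coord.span_base) auto
    finally show "x \<in> coord.span (unit_vect ` {..<N})" .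
  qed
qed

lemma is_sheaf_label: "is_sheaf P (label_sheaf N lab :: ('p::order, 'k::field) sheaf)"
  unfolding is_sheaf_def
proof (intro conjI ballI impI; (elim conjE)?)
  show "linear_map (stalk (label_sheaf N lab :: ('p, 'k) sheaf) \<tau>) (stalk (label_sheaf N lab) \<gamma>) (smap (label_sheaf N lab) \<tau> \<gamma>)"
    if "\<tau> \<le> \<gamma>" for \<tau> \<gamma>
    by (auto simp: linear_map_def label_stalk label_smap vect_nth)
qed (auto simp: fd_label_stalk label_smap label_stalk fun_eq_iff dest: order_trans)

text \<open>A map into \<open>[\<pi>]\<close> is the same as a linear functional on the stalk at \<open>\<pi>\<close>, so a family of functionals
  on the stalks at the labels determines a map into the direct sum.  The functional at \<open>lab n\<close> is
  the \<open>n\<close>-th coordinate of \<open>\<psi> n\<close>.\<close>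

lemma nat_trans_to_label:
  assumes B: "is_sheaf P B" and lab: "\<And>n. n < N \<Longrightarrow> lab n \<in> P" and lin: "\<And>n. n < N \<Longrightarrow> vect_linear (\<psi> n)"
  shows "nat_trans P B (label_sheaf N lab)
    (\<lambda>\<gamma> y n. if n < N \<and> \<gamma> \<le> lab n then \<psi> n (smap B \<gamma> (lab n) y) n else 0)"
  unfolding nat_trans_def
proof (intro conjI ballI impI)
  fix \<gamma> assume g: "\<gamma> \<in> P"
  show "linear_map (stalk B \<gamma>) (stalk (label_sheaf N lab) \<gamma>)
     (\<lambda>y n. if n < N \<and> \<gamma> \<le> lab n then \<psi> n (smap B \<gamma> (lab n) y) n else 0)"
    using linear_mapD(2,3)[OF is_sheafD(3)[OF B g lab]] coord_pair.linear_add[OF lin] coord_pair.linear_scale[OF lin]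
    unfolding linear_map_def label_stalk by (auto simp: vect_nth intro!: ext)
next
  fix \<tau> \<gamma> y assume t: "\<tau> \<in> P" "\<gamma> \<in> P" "\<tau> \<le> \<gamma>" and y: "y \<in> stalk B \<tau>"
  show "(\<lambda>n. if n < N \<and> \<gamma> \<le> lab n then \<psi> n (smap B \<gamma> (lab n) (smap B \<tau> \<gamma> y)) n else 0) =
    smap (label_sheaf N lab) \<tau> \<gamma> (\<lambda>n. if n < N \<and> \<tau> \<le> lab n then \<psi> n (smap B \<tau> (lab n) y) n else 0)"
    using is_sheafD(6)[OF B t(1,2) lab t(3) _ y] order_trans[OF t(3)]
    unfolding label_smap by (intro ext) auto
qed

lemma injective_label_sheaf:
  assumes lab: "\<And>n. n < N \<Longrightarrow> lab n \<in> P"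
  shows "injective_sheaf P (label_sheaf N lab :: ('p::order, 'k::field) sheaf)"
  unfolding injective_sheaf_def
proof (intro conjI allI impI is_sheaf_label, elim conjE)
  fix A B :: "('p, 'k) sheaf" and i f
  assume A: "is_sheaf P A" and B: "is_sheaf P B" and i: "inj_trans P A B i"
    and f: "nat_trans P A (label_sheaf N lab) f"
  have "\<exists>g. vect_linear g \<and> (\<forall>x\<in>stalk A (lab n). g (i (lab n) x) = f (lab n) x)" if "n < N" for n
    using linear_extend_along_injection[OF nat_transD(1)[OF inj_transD(1)[OF i] lab[OF that]]
        inj_transD(2)[OF i lab[OF that]] nat_transD(1)[OF f lab[OF that]] is_sheafD(2)[OF A lab[OF that]]]
    by metis
  then obtain \<psi> where \<psi>: "\<And>n. n < N \<Longrightarrow> vect_linear (\<psi> n)"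
    "\<And>n x. n < N \<Longrightarrow> x \<in> stalk A (lab n) \<Longrightarrow> \<psi> n (i (lab n) x) = f (lab n) x"
    by metis
  let ?g = "\<lambda>\<gamma> y n. if n < N \<and> \<gamma> \<le> lab n then \<psi> n (smap B \<gamma> (lab n) y) n else 0"
  have "?g \<gamma> (i \<gamma> x) = f \<gamma> x" if g: "\<gamma> \<in> P" and x: "x \<in> stalk A \<gamma>" for \<gamma> x
  proof
    fix n
    show "?g \<gamma> (i \<gamma> x) n = f \<gamma> x n"
    proof (cases "n < N \<and> \<gamma> \<le> lab n")
      case True
      then have n: "n < N" "lab n \<in> P" "\<gamma> \<le> lab n" using lab by auto
      have "smap B \<gamma> (lab n) (i \<gamma> x) = i (lab n) (smap A \<gamma> (lab n) x)"
        using nat_transD(3)[OF inj_transD(1)[OF i] g n(2,3) x] by simp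
      then have "?g \<gamma> (i \<gamma> x) n = f (lab n) (smap A \<gamma> (lab n) x) n"
        using n \<psi>(2)[OF n(1) is_sheafD(4)[OF A g n(2,3) x]] by simp
      also have "\<dots> = f \<gamma> x n" using nat_transD(3)[OF f g n(2,3) x] by (simp add: label_smap)
      finally show ?thesis .
    qed (use nat_transD(2)[OF f g x] in \<open>auto simp: label_stalk\<close>)
  qed
  then show "\<exists>g. nat_trans P B (label_sheaf N lab) g \<and> (\<forall>\<pi>\<in>P. \<forall>x\<in>stalk A \<pi>. g \<pi> (i \<pi> x) = f \<pi> x)"
    using nat_trans_to_label[where N = N and lab = lab and \<psi> = \<psi>, OF B lab \<psi>(1)] by blast
qed

lemma socle_label:
  assumes lab: "\<And>n. n < N \<Longrightarrow> lab n \<in> P" and x: "x \<in> socle P (label_sheaf N lab) \<pi>"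
  shows "x = (\<Sum>n | n < N \<and> lab n = \<pi>. cscale (x n) (unit_vect n))"
proof
  fix n
  have "x n = 0" if n: "\<not> (n < N \<and> lab n = \<pi>)"
  proof (cases "n < N \<and> \<pi> < lab n")
    case True
    then have "smap (label_sheaf N lab) \<pi> (lab n) x = 0" using x lab by (auto simp: socle_def)
    then have "smap (label_sheaf N lab) \<pi> (lab n) x n = 0" by (simp add: vect_nth)
    then show ?thesis by (simp add: label_smap)
  next
    case False
    then show ?thesis using x n by (auto simp: socle_def label_stalk order.strict_iff_order)
  qed
  then show "x n = (\<Sum>n | n < N \<and> lab n = \<pi>. cscale (x n) (unit_vect n)) n"
    by (auto simp: sum_unit_vect_nth)
qed

text \<open>The hull has one summand \<open>[\<pi>]\<close> for each basis vector of the socle at \<open>\<pi>\<close>.  The functionals dual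
  to these bases define the map; it identifies the socles of both sheaves, and is hence injective.\<close>

lemma exists_hull:
  fixes G :: "('p::order, 'k::field) sheaf"
  assumes P: "finite P" and G: "is_sheaf P G"
  obtains N lab and i where "\<And>n. n < N \<Longrightarrow> lab n \<in> P"
    "inj_trans P G (label_sheaf N lab) i"
    "\<And>\<pi>. \<pi> \<in> P \<Longrightarrow> socle P (label_sheaf N lab) \<pi> \<subseteq> im_at G i \<pi>"
proof -
  have "\<forall>\<pi>\<in>P. \<exists>B. finite B \<and> coord.independent B \<and> coord.span B = socle P G \<pi>"
    using fd_basis[OF fd_socle[OF G]] by metis
  then obtain B where B: "\<And>\<pi>. \<pi> \<in> P \<Longrightarrow> finite (B \<pi>)" "\<And>\<pi>. \<pi> \<in> P \<Longrightarrow> coord.independent (B \<pi>)"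
     "\<And>\<pi>. \<pi> \<in> P \<Longrightarrow> coord.span (B \<pi>) = socle P G \<pi>"
    by metis
  let ?T = "SIGMA \<pi>:P. B \<pi>"
  define N where "N = card ?T"
  have "finite ?T" using P B(1) by simp
  then obtain h where h: "bij_betw h {..<N} ?T"
    unfolding N_def using ex_bij_betw_nat_finite by (metis atLeast0LessThan)
  define lab where "lab n = fst (h n)" for n
  define b where "b n = snd (h n)" for n
  have hT: "h n \<in> ?T" if "n < N" for n using h that bij_betwE by blast
  have lab: "lab n \<in> P" and b: "b n \<in> B (lab n)" if "n < N" for n
    using hT[OF that] by (auto simp: lab_def b_def)
  have h_inj: "n = m" if "n < N" "m < N" "lab n = lab m" "b n = b m" for n m
    using h that by (auto simp: lab_def b_def bij_betw_def inj_on_def prod_eq_iff)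
  have h_surj: "\<exists>n<N. lab n = \<pi> \<and> b n = x" if "\<pi> \<in> P" "x \<in> B \<pi>" for \<pi> x
  proof -
    have "(\<pi>, x) \<in> h ` {..<N}" using h that by (auto simp: bij_betw_def)
    then obtain n where "n < N" "h n = (\<pi>, x)" by auto
    then show ?thesis by (auto simp: lab_def b_def)
  qed
  have "\<exists>p. vect_linear p \<and> (\<forall>x\<in>B \<pi>. p x = unit_vect (THE n. n < N \<and> lab n = \<pi> \<and> b n = x))"
    if "\<pi> \<in> P" for \<pi>
    using coord_pair.linear_independent_extend[OF B(2)[OF that],
        of "\<lambda>x. unit_vect (THE n. n < N \<and> lab n = \<pi> \<and> b n = x)"] by blast
  then have "\<exists>p. \<forall>\<pi>\<in>P. vect_linear (p \<pi>) \<and> (\<forall>x\<in>B \<pi>. p \<pi> x = unit_vect (THE n. n < N \<and> lab n = \<pi> \<and> b n = x))"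
    by (intro bchoice) blast
  then obtain p where p: "\<And>\<pi>. \<pi> \<in> P \<Longrightarrow> vect_linear (p \<pi>)"
    and "\<And>\<pi> x. \<pi> \<in> P \<Longrightarrow> x \<in> B \<pi> \<Longrightarrow> p \<pi> x = unit_vect (THE n. n < N \<and> lab n = \<pi> \<and> b n = x)"
    by blast
  moreover have "(THE m. m < N \<and> lab m = lab n \<and> b m = b n) = n" if "n < N" for n
    using that h_inj by (intro the_equality) auto
  ultimately have pb: "p (lab n) (b n) = unit_vect n" if "n < N" for n
    using that lab b by simp
  \<comment> \<open>The functional of the coordinate n is dual to the basis vector b n of the socle at lab n.\<close>
  define i where "i \<gamma> y = (\<lambda>n. if n < N \<and> \<gamma> \<le> lab n then p (lab n) (smap G \<gamma> (lab n) y) n else 0)" for \<gamma> y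
  have i: "nat_trans P G (label_sheaf N lab) i"
    unfolding i_def by (rule nat_trans_to_label[where \<psi> = "\<lambda>n. p (lab n)"]) (use G p lab in auto)
  have b_soc: "b n \<in> socle P G (lab n)" if "n < N" for n
    using B(3)[OF lab[OF that]] b[OF that] coord.span_superset by blast
  \<comment> \<open>Coordinates with a label strictly above lab n vanish since b n is a socle vector.\<close>
  have ib: "i (lab n) (b n) = unit_vect n" if n: "n < N" for n
  proof
    fix m
    show "i (lab n) (b n) m = (unit_vect n :: 'k vect) m"
    proof (cases "m < N \<and> lab n \<le> lab m")
      case True
      show ?thesis
      proof (cases "lab n = lab m")
        case True
        then have "i (lab n) (b n) m = p (lab n) (smap G (lab n) (lab n) (b n)) m"
          using \<open>m < N \<and> lab n \<le> lab m\<close> by (simp add: i_def)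
        then show ?thesis using is_sheafD(5)[OF G lab[OF n], of "b n"] b_soc[OF n] pb[OF n] by (simp add: socle_def)
      next
        case False
        then have "smap G (lab n) (lab m) (b n) = 0"
          using b_soc[OF n] \<open>m < N \<and> lab n \<le> lab m\<close> lab by (auto simp: socle_def)
        then show ?thesis using False \<open>m < N \<and> lab n \<le> lab m\<close> p lab coord_pair.linear_0[OF p]
          by (auto simp: i_def unit_vect_def vect_nth)
      qed
    qed (use n in \<open>auto simp: i_def unit_vect_def\<close>)
  qed
  have in_soc: "(\<Sum>n | n < N \<and> lab n = \<pi>. cscale (c n) (b n)) \<in> socle P G \<pi>" if "\<pi> \<in> P" for \<pi> c
    using b_soc by (intro coord.subspace_sum[OF subspace_socle[OF G that]] coord.subspace_scale[OF subspace_socle[OF G that]]) auto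
  have i_sum: "i \<pi> (\<Sum>n | n < N \<and> lab n = \<pi>. cscale (c n) (b n)) = (\<Sum>n | n < N \<and> lab n = \<pi>. cscale (c n) (unit_vect n))"
    if "\<pi> \<in> P" for \<pi> c
  proof -
    have st: "n < N \<Longrightarrow> lab n = \<pi> \<Longrightarrow> b n \<in> stalk G \<pi>" for n using b_soc by (auto simp: socle_def)
    note l = nat_transD(1)[OF i that] and s = is_sheafD(2)[OF G that]
    have "i \<pi> (\<Sum>n | n < N \<and> lab n = \<pi>. cscale (c n) (b n)) = (\<Sum>n | n < N \<and> lab n = \<pi>. i \<pi> (cscale (c n) (b n)))"
      by (rule linear_map_sum[OF l s]) (use st coord.subspace_scale[OF s] in auto)
    also have "\<dots> = (\<Sum>n | n < N \<and> lab n = \<pi>. cscale (c n) (unit_vect n))"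
      using ib linear_mapD(3)[OF l st] by (intro sum.cong) auto
    finally show ?thesis .
  qed
  have surj: "\<exists>c. x = (\<Sum>n | n < N \<and> lab n = \<pi>. cscale (c n) (b n))" if "\<pi> \<in> P" "x \<in> socle P G \<pi>" for \<pi> x
  proof -
    have Beq: "B \<pi> = b ` {n. n < N \<and> lab n = \<pi>}" using h_surj[OF that(1)] b by auto
    have injb: "inj_on b {n. n < N \<and> lab n = \<pi>}" using h_inj by (auto intro!: inj_onI)
    have "x \<in> coord.span (B \<pi>)" using that B(3) by simp
    then have "x \<in> range (\<lambda>u. \<Sum>v\<in>B \<pi>. cscale (u v) v)"
      using coord.span_finite[OF B(1)[OF that(1)]] by simp
    then obtain u where "x = (\<Sum>v\<in>B \<pi>. cscale (u v) v)" by auto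
    also have "\<dots> = (\<Sum>n | n < N \<and> lab n = \<pi>. cscale (u (b n)) (b n))"
      unfolding Beq by (simp add: sum.reindex[OF injb])
    finally show ?thesis by (rule exI[of _ "\<lambda>n. u (b n)"])
  qed
  have inj: "inj_trans P G (label_sheaf N lab) i"
  proof (rule inj_trans_if_inj_on_socle[OF P G is_sheaf_label i])
    fix \<pi> x assume \<pi>: "\<pi> \<in> P" "x \<in> socle P G \<pi>" "i \<pi> x = 0"
    obtain c where c: "x = (\<Sum>n | n < N \<and> lab n = \<pi>. cscale (c n) (b n))" using surj[OF \<pi>(1,2)] by blast
    have "(\<Sum>n | n < N \<and> lab n = \<pi>. cscale (c n) (unit_vect n)) = (0 :: 'k vect)"
      using i_sum[OF \<pi>(1), of c] c \<pi>(3) by simp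
    then have z: "(\<Sum>n | n < N \<and> lab n = \<pi>. cscale (c n) (unit_vect n)) m = (0 :: 'k vect) m" for m by simp
    have "c m = 0" if "m < N" "lab m = \<pi>" for m
      using z[of m] that by (simp add: sum_unit_vect_nth vect_nth)
    then show "x = 0" unfolding c by (intro sum.neutral) auto
  qed
  have "socle P (label_sheaf N lab) \<pi> \<subseteq> im_at G i \<pi>" if "\<pi> \<in> P" for \<pi>
  proof
    fix x :: "'k vect" assume x: "x \<in> socle P (label_sheaf N lab) \<pi>"
    have "x = (\<Sum>n | n < N \<and> lab n = \<pi>. cscale (x n) (unit_vect n))"
      by (rule socle_label[OF lab x])
    then have "x = i \<pi> (\<Sum>n | n < N \<and> lab n = \<pi>. cscale (x n) (b n))"
      by (rule trans[OF _ i_sum[OF that, symmetric]])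
    moreover have "(\<Sum>n | n < N \<and> lab n = \<pi>. cscale (x n) (b n)) \<in> stalk G \<pi>"
      using in_soc[OF that] by (simp add: socle_def)
    ultimately show "x \<in> im_at G i \<pi>" unfolding im_at_def by (rule image_eqI)
  qed
  then show ?thesis using that[OF lab inj] by blast
qed

section \<open>Multiplicities as socle dimensions\<close>

lemma indec_inj_stalk: "stalk (indec_inj \<pi>) \<gamma> = (if \<gamma> \<le> \<pi> then line else {0})"
  and indec_inj_smap: "smap (indec_inj \<pi>) \<gamma> \<tau> x = (if \<gamma> \<le> \<tau> \<and> \<tau> \<le> \<pi> then x else 0)"
  by (simp_all add: indec_inj_def)

text \<open>The coordinates below \<open>N\<close> with label \<open>\<pi>\<close> correspond to the copies of \<open>[\<pi>]\<close>.\<close>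

lemma indec_decomposition_if_label_iso:
  fixes I :: "('p::order, 'k::field) sheaf"
  assumes P: "finite P" and lab: "\<And>n. n < N \<Longrightarrow> lab n \<in> P"
    and r: "nat_trans P (label_sheaf N lab) I r"
    and bij: "\<And>\<gamma>. \<gamma> \<in> P \<Longrightarrow> bij_betw (r \<gamma>) (stalk (label_sheaf N lab) \<gamma>) (stalk I \<gamma>)"
  shows "indec_decomposition P I (\<lambda>\<pi>. card {n. n < N \<and> lab n = \<pi>})"
proof -
  let ?m = "\<lambda>\<pi>. card {n. n < N \<and> lab n = \<pi>}"
  let ?S = "SIGMA \<pi>:P. {..<?m \<pi>}"
  let ?E = "label_sheaf N lab :: ('p, 'k) sheaf"
  have "\<exists>e. bij_betw e {..<?m \<pi>} {n. n < N \<and> lab n = \<pi>}" for \<pi>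
    using ex_bij_betw_nat_finite[of "{n. n < N \<and> lab n = \<pi>}"] by (auto simp: atLeast0LessThan)
  then obtain e where e: "\<And>\<pi>. bij_betw (e \<pi>) {..<?m \<pi>} {n. n < N \<and> lab n = \<pi>}" by metis
  define enc where "enc s = e (fst s) (snd s)" for s
  have enc: "enc s < N \<and> lab (enc s) = fst s" if "s \<in> ?S" for s
    using that bij_betwE[OF e[of "fst s"]] by (auto simp: enc_def)
  have enc_inj: "inj_on enc ?S"
  proof (rule inj_onI)
    fix s t assume st: "s \<in> ?S" "t \<in> ?S" "enc s = enc t"
    then have f: "fst s = fst t" using enc by metis
    then have "snd s = snd t"
      using st bij_betw_imp_inj_on[OF e[of "fst s"]] by (auto simp: enc_def inj_on_def)
    with f show "s = t" by (simp add: prod_eq_iff)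
  qed
  have enc_surj: "n \<in> enc ` ?S" if "n < N" for n
  proof -
    have "n \<in> e (lab n) ` {..<?m (lab n)}" using e[of "lab n"] that by (auto simp: bij_betw_def)
    then obtain i where "i < ?m (lab n)" "n = e (lab n) i" by auto
    then have "(lab n, i) \<in> ?S" "n = enc (lab n, i)" using lab that by (auto simp: enc_def)
    then show ?thesis by blast
  qed
  have finS: "finite ?S" using P by simp
  have enc_bij: "bij_betw enc ?S {..<N}" using enc enc_inj enc_surj by (auto simp: bij_betw_def)
  let ?D = "\<lambda>(\<pi>, i :: nat). (indec_inj \<pi> :: ('p, 'k) sheaf)"
  define \<iota> where "\<iota> s \<gamma> x = r \<gamma> (cscale (x 0) (unit_vect (enc s)))" for s \<gamma> and x :: "'k vect"
  have D_stalk: "x \<in> stalk (?D s) \<gamma> \<Longrightarrow> cscale (x 0) (unit_vect (enc s)) \<in> stalk ?E \<gamma>" if "s \<in> ?S" for s \<gamma> x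
    using enc[OF that] that by (auto simp: indec_inj_stalk label_stalk unit_vect_def vect_nth split: if_splits)
  have "nat_trans P (?D s) I (\<iota> s)" if s: "s \<in> ?S" for s
    unfolding nat_trans_def
  proof (intro conjI ballI impI)
    fix \<gamma> assume g: "\<gamma> \<in> P"
    note l = nat_transD(1)[OF r g]
    show "linear_map (stalk (?D s) \<gamma>) (stalk I \<gamma>) (\<iota> s \<gamma>)"
      unfolding linear_map_def \<iota>_def
    proof (intro conjI ballI allI)
      fix x y c assume x: "x \<in> stalk (?D s) \<gamma>"
      show "r \<gamma> (cscale (x 0) (unit_vect (enc s))) \<in> stalk I \<gamma>" using linear_mapD(1)[OF l D_stalk[OF s x]] .
      show "r \<gamma> (cscale (cscale c x 0) (unit_vect (enc s))) = cscale c (r \<gamma> (cscale (x 0) (unit_vect (enc s))))"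
        using linear_mapD(3)[OF l D_stalk[OF s x], of c] by (simp add: vect_nth)
      assume y: "y \<in> stalk (?D s) \<gamma>"
      show "r \<gamma> (cscale ((x + y) 0) (unit_vect (enc s))) =
         r \<gamma> (cscale (x 0) (unit_vect (enc s))) + r \<gamma> (cscale (y 0) (unit_vect (enc s)))"
        using linear_mapD(2)[OF l D_stalk[OF s x] D_stalk[OF s y]] by (simp add: vect_nth coord.scale_left_distrib)
    qed
  next
    fix \<tau> \<gamma> x assume t: "\<tau> \<in> P" "\<gamma> \<in> P" "\<tau> \<le> \<gamma>" and x: "x \<in> stalk (?D s) \<tau>"
    have "smap ?E \<tau> \<gamma> (cscale (x 0) (unit_vect (enc s))) = cscale (smap (?D s) \<tau> \<gamma> x 0) (unit_vect (enc s))"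
      using enc[OF s] t by (auto simp: label_smap indec_inj_smap vect_nth unit_vect_def fun_eq_iff split: prod.splits)
    then show "\<iota> s \<gamma> (smap (?D s) \<tau> \<gamma> x) = smap I \<tau> \<gamma> (\<iota> s \<tau> x)"
      using nat_transD(3)[OF r t D_stalk[OF s x]] by (simp add: \<iota>_def)
  qed
  moreover have "bij_betw (\<lambda>x. \<Sum>s\<in>?S. \<iota> s \<gamma> (x s)) (PiE ?S (\<lambda>s. stalk (?D s) \<gamma>)) (stalk I \<gamma>)" if g: "\<gamma> \<in> P" for \<gamma>
  proof -
    let ?X = "PiE ?S (\<lambda>s. stalk (?D s) \<gamma>)"
    let ?F = "\<lambda>x :: 'p \<times> nat \<Rightarrow> 'k vect. \<Sum>s\<in>?S. cscale (x s 0) (unit_vect (enc s))"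
    let ?G = "\<lambda>y :: 'k vect. \<lambda>s\<in>?S. cscale (y (enc s)) (unit_vect 0)"
    have X_D: "cscale (x s 0) (unit_vect (enc s)) \<in> stalk ?E \<gamma>" if x: "x \<in> ?X" and s: "s \<in> ?S" for x s
    proof -
      have "x s \<in> stalk (?D s) \<gamma>" using x s by (rule PiE_mem)
      with s show ?thesis by (rule D_stalk)
    qed
    have sE: "coord.subspace (stalk ?E \<gamma>)" using is_sheafD(2)[OF is_sheaf_label g] .
    have F_in: "?F x \<in> stalk ?E \<gamma>" if x: "x \<in> ?X" for x
      by (intro coord.subspace_sum[OF sE] X_D[OF x])
    have F_nth: "?F x (enc s) = x s 0" if s: "s \<in> ?S" for x s
    proof -
      let ?g = "\<lambda>n. cscale (x (inv_into ?S enc n) 0) (unit_vect n)"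
      have "?F x = (\<Sum>s\<in>?S. ?g (enc s))"
        by (rule sum.cong) (simp_all only: inv_into_f_f[OF enc_inj])
      also have "\<dots> = (\<Sum>n<N. ?g n)" by (rule sum.reindex_bij_betw[OF enc_bij])
      finally have "?F x (enc s) = (\<Sum>n<N. ?g n) (enc s)" by (rule fun_cong)
      then show ?thesis using enc[OF s] s by (simp add: sum_unit_vect_nth inv_into_f_f[OF enc_inj])
    qed
    have "bij_betw ?F ?X (stalk ?E \<gamma>)"
    proof (rule bij_betw_byWitness[where f' = ?G])
      show "\<forall>x\<in>?X. ?G (?F x) = x"
      proof
        fix x assume x: "x \<in> ?X"
        show "?G (?F x) = x"
        proof
          fix s
          show "?G (?F x) s = x s"
          proof (cases "s \<in> ?S")
            case True
            then have "x s \<in> line"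
              using PiE_mem[OF x True] fd_spaceD[OF fd_line] coord.subspace_0
              by (auto simp: indec_inj_stalk split: if_splits prod.splits)
            then show ?thesis using F_nth[OF True, of x] line_eq[of "x s", symmetric] True by simp
          next
            case False
            then show ?thesis using PiE_arb[OF x False] by simp
          qed
        qed
      qed
      show "\<forall>y\<in>stalk ?E \<gamma>. ?F (?G y) = y"
      proof
        fix y assume y: "y \<in> stalk ?E \<gamma>"
        have G_in: "?G y \<in> ?X"
          using y enc by (auto simp: indec_inj_stalk label_stalk line_def vect_nth unit_vect_def fun_eq_iff)
        show "?F (?G y) = y"
        proof
          fix n
          show "?F (?G y) n = y n"
          proof (cases "n < N")
            case True
            then obtain s where "s \<in> ?S" "n = enc s" using enc_surj[OF True] by blast
            then show ?thesis using F_nth[of s "?G y"] by (simp add: vect_nth unit_vect_def)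
          next
            case False
            then show ?thesis using F_in[OF G_in] y by (auto simp: label_stalk)
          qed
        qed
      qed
      show "?F ` ?X \<subseteq> stalk ?E \<gamma>" using F_in by blast
      show "?G ` stalk ?E \<gamma> \<subseteq> ?X"
        using enc by (auto simp: indec_inj_stalk label_stalk line_def vect_nth unit_vect_def fun_eq_iff)
    qed
    from bij_betw_trans[OF this bij[OF g]] have *: "bij_betw (r \<gamma> \<circ> ?F) ?X (stalk I \<gamma>)" .
    have "(\<Sum>s\<in>?S. \<iota> s \<gamma> (x s)) = (r \<gamma> \<circ> ?F) x" if "x \<in> ?X" for x
      unfolding \<iota>_def comp_def
      by (rule linear_map_sum[symmetric, OF nat_transD(1)[OF r g] sE]) (rule X_D[OF that])
    then show ?thesis by (rule bij_betw_cong[THEN iffD2, OF _ *])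
  qed
  ultimately show ?thesis
    unfolding indec_decomposition_def iso_direct_sum_def using finS by blast
qed

text \<open>An injective sheaf is a retract of its hull.  The retraction is injective since it is injective on
  the socle of the hull, which lies in the retract; so it is an isomorphism from a direct sum.\<close>

lemma injective_sheaf_has_decomposition:
  fixes I :: "('p::order, 'k::field) sheaf"
  assumes P: "finite P" and I: "injective_sheaf P I"
  shows "\<exists>m. indec_decomposition P I m"
proof -
  have sI: "is_sheaf P I" using I by (simp add: injective_sheaf_def)
  obtain N lab i where lab: "\<And>n. n < N \<Longrightarrow> lab n \<in> P" and i: "inj_trans P I (label_sheaf N lab) i"
    and soc: "\<And>\<pi>. \<pi> \<in> P \<Longrightarrow> socle P (label_sheaf N lab) \<pi> \<subseteq> im_at I i \<pi>"
    using exists_hull[OF P sI] by blast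
  have "nat_trans P I I (\<lambda>\<pi> x. x)" using sI by (auto simp: nat_trans_def linear_map_def)
  then obtain r where r: "nat_trans P (label_sheaf N lab) I r"
    and ri: "\<And>\<pi> x. \<pi> \<in> P \<Longrightarrow> x \<in> stalk I \<pi> \<Longrightarrow> r \<pi> (i \<pi> x) = x"
    using I i sI is_sheaf_label unfolding injective_sheaf_def by blast
  have "inj_trans P (label_sheaf N lab) I r"
  proof (rule inj_trans_if_inj_on_socle[OF P is_sheaf_label sI r])
    fix \<pi> x assume \<pi>: "\<pi> \<in> P" and x: "x \<in> socle P (label_sheaf N lab) \<pi>" "r \<pi> x = 0"
    then obtain y where y: "y \<in> stalk I \<pi>" "x = i \<pi> y" using soc by (auto simp: im_at_def)
    then have "y = 0" using ri[OF \<pi>] x by simp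
    then show "x = 0"
      using y linear_map_zero[OF nat_transD(1)[OF inj_transD(1)[OF i] \<pi>] is_sheafD(2)[OF sI \<pi>]] by simp
  qed
  then have "bij_betw (r \<gamma>) (stalk (label_sheaf N lab) \<gamma>) (stalk I \<gamma>)" if g: "\<gamma> \<in> P" for \<gamma>
    unfolding bij_betw_def
  proof (intro conjI equalityI)
    show "stalk I \<gamma> \<subseteq> r \<gamma> ` stalk (label_sheaf N lab) \<gamma>"
      using ri[OF g] nat_transD(2)[OF inj_transD(1)[OF i] g] by (metis image_eqI subsetI)
  qed (use g r inj_transD(2) nat_transD(2) in blast)+
  then show ?thesis using indec_decomposition_if_label_iso[OF P lab r] by blast
qed

text \<open>The socle of \<open>[\<pi>']\<close> is one-dimensional at \<open>\<pi>'\<close> and zero elsewhere, and forming socles commutes with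
  direct sums.  So the multiplicities do not depend on the decomposition.\<close>

lemma decomposition_multiplicity:
  fixes I :: "('p::order, 'k::field) sheaf"
  assumes P: "finite P" and I: "is_sheaf P I" and m: "indec_decomposition P I m" and \<pi>: "\<pi> \<in> P"
  shows "m \<pi> = coord.dim (socle P I \<pi>)"
proof -
  let ?S = "SIGMA \<pi>:P. {..<m \<pi>}"
  let ?D = "\<lambda>(\<pi>, i :: nat). (indec_inj \<pi> :: ('p, 'k) sheaf)"
  obtain \<iota> where nt: "\<And>s. s \<in> ?S \<Longrightarrow> nat_trans P (?D s) I (\<iota> s)"
    and bij: "\<And>\<gamma>. \<gamma> \<in> P \<Longrightarrow> bij_betw (\<lambda>x. \<Sum>s\<in>?S. \<iota> s \<gamma> (x s)) (PiE ?S (\<lambda>s. stalk (?D s) \<gamma>)) (stalk I \<gamma>)"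
    using m unfolding indec_decomposition_def iso_direct_sum_def by blast
  have D_sub: "coord.subspace (stalk (?D s) \<gamma>)" for s \<gamma>
    using fd_spaceD[OF fd_line] fd_spaceD[OF fd_zero] by (auto simp: indec_inj_stalk split: prod.splits)
  have i0: "\<iota> s \<gamma> 0 = 0" if "s \<in> ?S" "\<gamma> \<in> P" for s \<gamma>
    using linear_map_zero[OF nat_transD(1)[OF nt[OF that(1)] that(2)] D_sub] .
  \<comment> \<open>Injectivity of the direct sum map, stated for vectors that map to zero.\<close>
  have zero: "x s = 0" if x: "x \<in> PiE ?S (\<lambda>s. stalk (?D s) \<gamma>)" "(\<Sum>s\<in>?S. \<iota> s \<gamma> (x s)) = 0" and g: "\<gamma> \<in> P" and s: "s \<in> ?S" for x \<gamma> s
  proof -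
    let ?z = "\<lambda>s\<in>?S. (0 :: 'k vect)"
    have "?z \<in> PiE ?S (\<lambda>s. stalk (?D s) \<gamma>)" using coord.subspace_0[OF D_sub] by auto
    moreover have "(\<Sum>s\<in>?S. \<iota> s \<gamma> (?z s)) = 0" using i0 g by (intro sum.neutral) auto
    ultimately have "x = ?z" using bij_betw_imp_inj_on[OF bij[OF g]] x by (simp add: inj_on_def)
    then show ?thesis using s by simp
  qed
  define v where "v i = \<iota> (\<pi>, i) \<pi> (unit_vect 0)" for i
  have sp: "(\<pi>, i) \<in> ?S" if "i < m \<pi>" for i using \<pi> that by simp
  have st: "unit_vect 0 \<in> stalk (?D (\<pi>, i)) \<pi>" for i by (simp add: indec_inj_stalk)
  have scale: "\<iota> (\<pi>, i) \<pi> (cscale c (unit_vect 0)) = cscale c (v i)" if "i < m \<pi>" for i c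
    using linear_mapD(3)[OF nat_transD(1)[OF nt[OF sp[OF that]] \<pi>] st] by (simp add: v_def)
  have sum_eq: "(\<Sum>s\<in>?S. \<iota> s \<pi> (x s)) = (\<Sum>i<m \<pi>. cscale (x (\<pi>, i) 0) (v i))"
    if x: "x \<in> PiE ?S (\<lambda>s. stalk (?D s) \<pi>)" "\<And>s. s \<in> ?S \<Longrightarrow> fst s \<noteq> \<pi> \<Longrightarrow> x s = 0" for x
  proof -
    have "(\<Sum>s\<in>?S. \<iota> s \<pi> (x s)) = (\<Sum>s\<in>Pair \<pi> ` {..<m \<pi>}. \<iota> s \<pi> (x s))"
    proof (rule sum.mono_neutral_right)
      show "\<forall>s\<in>?S - Pair \<pi> ` {..<m \<pi>}. \<iota> s \<pi> (x s) = 0"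
      proof
        fix s assume s: "s \<in> ?S - Pair \<pi> ` {..<m \<pi>}"
        then have "fst s \<noteq> \<pi>" by auto
        then show "\<iota> s \<pi> (x s) = 0" using x(2)[of s] i0[OF _ \<pi>, of s] s by simp
      qed
    qed (use P \<pi> in auto)
    also have "\<dots> = (\<Sum>i<m \<pi>. \<iota> (\<pi>, i) \<pi> (x (\<pi>, i)))"
      by (simp add: sum.reindex inj_on_def)
    also have "\<dots> = (\<Sum>i<m \<pi>. cscale (x (\<pi>, i) 0) (v i))"
    proof (rule sum.cong)
      fix i assume i: "i \<in> {..<m \<pi>}"
      then have "x (\<pi>, i) \<in> line" using PiE_mem[OF x(1) sp] by (simp add: indec_inj_stalk)
      then show "\<iota> (\<pi>, i) \<pi> (x (\<pi>, i)) = cscale (x (\<pi>, i) 0) (v i)" using scale i line_eq by (metis lessThan_iff)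
    qed simp
    finally show ?thesis .
  qed
  have v_soc: "v i \<in> socle P I \<pi>" if i: "i < m \<pi>" for i
  proof -
    have "smap I \<pi> \<gamma> (v i) = 0" if "\<gamma> \<in> P" "\<pi> < \<gamma>" for \<gamma>
    proof -
      have "smap I \<pi> \<gamma> (v i) = \<iota> (\<pi>, i) \<gamma> (smap (?D (\<pi>, i)) \<pi> \<gamma> (unit_vect 0))"
        using nat_transD(3)[OF nt[OF sp[OF i]] \<pi> that(1) _ st] that(2) by (simp add: v_def)
      also have "smap (?D (\<pi>, i)) \<pi> \<gamma> (unit_vect 0) = 0" using that(2) by (auto simp: indec_inj_smap)
      finally show ?thesis using i0[OF sp[OF i] that(1)] by simp
    qed
    then show ?thesis using nat_transD(2)[OF nt[OF sp[OF i]] \<pi> st] by (simp add: socle_def v_def)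
  qed
  have "socle P I \<pi> \<subseteq> coord.span (v ` {..<m \<pi>})"
  proof
    fix y assume y: "y \<in> socle P I \<pi>"
    then have "y \<in> stalk I \<pi>" by (simp add: socle_def)
    then obtain x where x: "x \<in> PiE ?S (\<lambda>s. stalk (?D s) \<pi>)" "y = (\<Sum>s\<in>?S. \<iota> s \<pi> (x s))"
      using bij_betw_imp_surj_on[OF bij[OF \<pi>]] by (metis (mono_tags, lifting) imageE)
    have "x s = 0" if s: "s \<in> ?S" "fst s \<noteq> \<pi>" for s
    proof (cases "\<pi> < fst s")
      case True
      \<comment> \<open>A summand with a label strictly above \<open>\<pi>\<close> is detected by the stalk at its own label, where the
        image of the socle vector y is zero.\<close>
      let ?\<gamma> = "fst s"
      have g: "?\<gamma> \<in> P" "\<pi> \<le> ?\<gamma>" using s True by auto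
      let ?x = "\<lambda>t\<in>?S. smap (?D t) \<pi> ?\<gamma> (x t)"
      have "?x \<in> PiE ?S (\<lambda>s. stalk (?D s) ?\<gamma>)"
      proof (rule restrict_PiE_iff[THEN iffD2], rule ballI)
        fix t assume "t \<in> ?S"
        then have "x t \<in> stalk (?D t) \<pi>" by (rule PiE_mem[OF x(1)])
        then show "smap (?D t) \<pi> ?\<gamma> (x t) \<in> stalk (?D t) ?\<gamma>"
          using g(2) coord.subspace_0[OF fd_spaceD[OF fd_line]]
          by (auto simp: indec_inj_stalk indec_inj_smap split: prod.splits if_splits dest: order_trans)
      qed
      moreover have "(\<Sum>t\<in>?S. \<iota> t ?\<gamma> (?x t)) = smap I \<pi> ?\<gamma> y"
      proof -
        have in_D: "x t \<in> stalk (?D t) \<pi>" if "t \<in> ?S" for t using x(1) that by (rule PiE_mem)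
        have in_I: "\<iota> t \<pi> (x t) \<in> stalk I \<pi>" if "t \<in> ?S" for t
          using nat_transD(2)[OF nt[OF that] \<pi> in_D[OF that]] .
        have "smap I \<pi> ?\<gamma> y = (\<Sum>t\<in>?S. smap I \<pi> ?\<gamma> (\<iota> t \<pi> (x t)))"
          unfolding x(2)
          by (rule linear_map_sum[OF is_sheafD(3)[OF I \<pi> g] is_sheafD(2)[OF I \<pi>]])
            (rule in_I)
        also have "\<dots> = (\<Sum>t\<in>?S. \<iota> t ?\<gamma> (?x t))"
          by (rule sum.cong) (simp_all only: nat_transD(3)[OF nt \<pi> g in_D] restrict_apply' simp_thms)
        finally show ?thesis by simp
      qed
      then have "(\<Sum>t\<in>?S. \<iota> t ?\<gamma> (?x t)) = 0" using y True g by (simp add: socle_def)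
      ultimately have "?x s = 0" using zero g(1) s(1) by blast
      then show ?thesis using s g by (auto simp: indec_inj_smap split: prod.splits)
    next
      case False
      then have "\<not> \<pi> \<le> fst s" using s by auto
      then show ?thesis using PiE_mem[OF x(1) s(1)] by (auto simp: indec_inj_stalk split: prod.splits)
    qed
    from sum_eq[OF x(1) this] x(2) have "y = (\<Sum>i<m \<pi>. cscale (x (\<pi>, i) 0) (v i))" by simp
    also have "\<dots> \<in> coord.span (v ` {..<m \<pi>})"
      by (intro coord.span_sum coord.span_scale coord.span_base) auto
    finally show "y \<in> coord.span (v ` {..<m \<pi>})" .
  qed
  then have "coord.span (v ` {..<m \<pi>}) = socle P I \<pi>"
    using coord.span_minimal[OF _ subspace_socle[OF I \<pi>], of "v ` {..<m \<pi>}"] v_soc by auto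
  moreover have "coord.dim (coord.span (v ` {..<m \<pi>})) = m \<pi>"
  proof (rule dim_span_family)
    fix c assume c: "(\<Sum>i<m \<pi>. cscale (c i) (v i)) = 0"
    let ?x = "\<lambda>s\<in>?S. if fst s = \<pi> then cscale (c (snd s)) (unit_vect 0) else 0"
    have x: "?x \<in> PiE ?S (\<lambda>s. stalk (?D s) \<pi>)"
      by (auto simp: indec_inj_stalk line_def unit_vect_def vect_nth)
    have "(\<Sum>s\<in>?S. \<iota> s \<pi> (?x s)) = (\<Sum>i<m \<pi>. cscale (?x (\<pi>, i) 0) (v i))"
      by (rule sum_eq[OF x]) auto
    also have "\<dots> = (\<Sum>i<m \<pi>. cscale (c i) (v i))"
      by (rule sum.cong) (use sp in \<open>auto simp: vect_nth unit_vect_def\<close>)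
    finally have *: "(\<Sum>s\<in>?S. \<iota> s \<pi> (?x s)) = 0" using c by simp
    show "\<forall>i<m \<pi>. c i = 0"
    proof (intro allI impI)
      fix i assume i: "i < m \<pi>"
      have "?x (\<pi>, i) 0 = (0 :: 'k vect) 0" using zero[OF x * \<pi> sp[OF i]] by simp
      then show "c i = 0" using sp[OF i] by (simp add: vect_nth unit_vect_def)
    qed
  qed
  ultimately show ?thesis by simp
qed

lemma multiplicity_indec_eq_dim_socle:
  assumes "finite P" "injective_sheaf P I" "\<pi> \<in> P"
  shows "multiplicity_indec P I \<pi> = coord.dim (socle P I \<pi>)"
proof -
  have sI: "is_sheaf P I" using assms(2) by (simp add: injective_sheaf_def)
  obtain m where "indec_decomposition P I m" using injective_sheaf_has_decomposition[OF assms(1,2)] by blast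
  then show ?thesis
    unfolding multiplicity_indec_def using decomposition_multiplicity[OF assms(1) sI _ assms(3)]
    by (intro the_equality) blast+
qed

lemma num_summands_eq:
  assumes "finite P" "injective_sheaf P I"
  shows "num_summands P I = (\<Sum>\<pi>\<in>P. coord.dim (socle P I \<pi>))"
  unfolding num_summands_def using multiplicity_indec_eq_dim_socle[OF assms] by (intro sum.cong) auto

section \<open>Minimal resolutions and their socles\<close>

lemma is_sheaf_const: "is_sheaf P const_sheaf"
  unfolding is_sheaf_def const_sheaf_def by (simp add: fd_line linear_map_def)

text \<open>The condition on the socles says that each term is an injective hull of the preceding cokernel;
  these turn out to be the minimal resolutions.\<close>

definition socle_resolution :: "'p::order set \<Rightarrow> ('p, 'k::field) sheaf \<Rightarrow> (nat \<Rightarrow> ('p, 'k) sheaf) \<Rightarrow>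
   ('p, 'k) nat_map \<Rightarrow> (nat \<Rightarrow> ('p, 'k) nat_map) \<Rightarrow> bool" where
  "socle_resolution P F J \<eta> e \<longleftrightarrow> injective_resolution P F J \<eta> e \<and>
     (\<forall>j. \<forall>\<pi>\<in>P. socle P (J j) \<pi> \<subseteq> ker_at (J j) (e j) \<pi>)"

lemma exists_hull_with_cokernel:
  fixes G :: "('p::order, 'k::field) sheaf"
  assumes P: "finite P" and G: "is_sheaf P G"
  shows "\<exists>E i Q q. injective_sheaf P E \<and> inj_trans P G E i \<and> is_sheaf P (Q :: ('p, 'k) sheaf) \<and> nat_trans P E Q q \<and>
     (\<forall>\<pi>\<in>P. im_at E q \<pi> = stalk Q \<pi> \<and> ker_at E q \<pi> = im_at G i \<pi> \<and> socle P E \<pi> \<subseteq> im_at G i \<pi>)"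
proof -
  obtain N lab i where lab: "\<And>n. n < N \<Longrightarrow> lab n \<in> P" and i: "inj_trans P G (label_sheaf N lab) i"
    and soc: "\<And>\<pi>. \<pi> \<in> P \<Longrightarrow> socle P (label_sheaf N lab) \<pi> \<subseteq> im_at G i \<pi>"
    using exists_hull[OF P G] by blast
  let ?E = "label_sheaf N lab :: ('p, 'k) sheaf"
  note i' = inj_transD(1)[OF i]
  obtain Q :: "('p, 'k) sheaf" and q where Q: "is_sheaf P Q" "nat_trans P ?E Q q"
    "\<And>\<pi>. \<pi> \<in> P \<Longrightarrow> im_at ?E q \<pi> = stalk Q \<pi>" "\<And>\<pi>. \<pi> \<in> P \<Longrightarrow> ker_at ?E q \<pi> = im_at G i \<pi>"
  proof (rule exists_cokernel[OF is_sheaf_label[of P N lab, where ?'k = 'k], of "im_at G i"])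
    show "coord.subspace (im_at G i \<pi>)" if "\<pi> \<in> P" for \<pi>
      unfolding im_at_def using subspace_linear_image[OF nat_transD(1)[OF i' that] is_sheafD(2)[OF G that]] .
    show "im_at G i \<pi> \<subseteq> stalk ?E \<pi>" if "\<pi> \<in> P" for \<pi>
      unfolding im_at_def using nat_transD(2)[OF i' that] by auto
    show "smap ?E \<tau> \<gamma> x \<in> im_at G i \<gamma>" if t: "\<tau> \<in> P" "\<gamma> \<in> P" "\<tau> \<le> \<gamma>" "x \<in> im_at G i \<tau>" for \<tau> \<gamma> x
    proof -
      obtain y where y: "y \<in> stalk G \<tau>" "x = i \<tau> y" using t by (auto simp: im_at_def)
      then have "smap ?E \<tau> \<gamma> x = i \<gamma> (smap G \<tau> \<gamma> y)" using nat_transD(3)[OF i' t(1-3) y(1)] by simp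
      then show ?thesis unfolding im_at_def using is_sheafD(4)[OF G t(1-3) y(1)] by (rule image_eqI)
    qed
  qed auto
  then show ?thesis using injective_label_sheaf[where N = N and lab = lab, OF lab] i soc by blast
qed

lemma exists_socle_resolution:
  fixes F :: "('p::order, 'k::field) sheaf"
  assumes P: "finite P" and F: "is_sheaf P F"
  obtains J \<eta> e where "socle_resolution P F J \<eta> e"
proof -
  have "\<forall>G :: ('p, 'k) sheaf. \<exists>E i Q q. is_sheaf P G \<longrightarrow> injective_sheaf P E \<and> inj_trans P G E i \<and> is_sheaf P (Q :: ('p, 'k) sheaf) \<and> nat_trans P E Q q \<and>
     (\<forall>\<pi>\<in>P. im_at E q \<pi> = stalk Q \<pi> \<and> ker_at E q \<pi> = im_at G i \<pi> \<and> socle P E \<pi> \<subseteq> im_at G i \<pi>)"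
    using exists_hull_with_cokernel[OF P] by blast
  then obtain E i Q q where step: "\<And>G :: ('p, 'k) sheaf. is_sheaf P G \<Longrightarrow> injective_sheaf P (E G) \<and> inj_trans P G (E G) (i G) \<and>
     is_sheaf P (Q G) \<and> nat_trans P (E G) (Q G) (q G) \<and>
     (\<forall>\<pi>\<in>P. im_at (E G) (q G) \<pi> = stalk (Q G) \<pi> \<and> ker_at (E G) (q G) \<pi> = im_at G (i G) \<pi> \<and> socle P (E G) \<pi> \<subseteq> im_at G (i G) \<pi>)"
    unfolding choice_iff by blast
  define G where "G j = (Q ^^ j) F" for j
  have G: "is_sheaf P (G j)" for j
    by (induction j) (use F step in \<open>auto simp: G_def\<close>)
  have G_Suc: "Q (G j) = G (Suc j)" for j by (simp add: G_def)
  note st = step[OF G, unfolded G_Suc]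
  define J where "J j = E (G j)" for j
  define e where "e j = (\<lambda>\<pi> x. i (G (Suc j)) \<pi> (q (G j) \<pi> x))" for j
  have inj: "inj_trans P (G j) (J j) (i (G j))" for j using st by (simp add: J_def)
  have q: "nat_trans P (J j) (G (Suc j)) (q (G j))" for j using st by (simp add: J_def)
  have i0: "i (G j) \<pi> x = 0 \<longleftrightarrow> x = 0" if "\<pi> \<in> P" "x \<in> stalk (G j) \<pi>" for j \<pi> x
    using linear_map_inj_iff[OF nat_transD(1)[OF inj_transD(1)[OF inj] that(1)] is_sheafD(2)[OF G that(1)]]
      inj_transD(2)[OF inj that(1)] that(2)
      linear_map_zero[OF nat_transD(1)[OF inj_transD(1)[OF inj] that(1)] is_sheafD(2)[OF G that(1)]] by auto
  have e: "nat_trans P (J j) (J (Suc j)) (e j)" for j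
    unfolding e_def using nat_trans_comp[OF q inj_transD(1)[OF inj]] .
  have ker: "ker_at (J j) (e j) \<pi> = im_at (G j) (i (G j)) \<pi>" if "\<pi> \<in> P" for j \<pi>
  proof -
    have "ker_at (J j) (e j) \<pi> = ker_at (J j) (q (G j)) \<pi>"
      unfolding ker_at_def e_def using i0[OF that nat_transD(2)[OF q that]] by auto
    then show ?thesis using st that by (simp add: J_def)
  qed
  have im: "im_at (J j) (e j) \<pi> = im_at (G (Suc j)) (i (G (Suc j))) \<pi>" if "\<pi> \<in> P" for j \<pi>
  proof -
    have "im_at (J j) (q (G j)) \<pi> = stalk (G (Suc j)) \<pi>" using st that by (simp add: J_def)
    then show ?thesis by (simp add: im_at_def e_def image_image[symmetric])
  qed
  have "socle_resolution P F J (i F) e"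
    unfolding socle_resolution_def injective_resolution_def
  proof (intro conjI allI ballI)
    show "injective_sheaf P (J j)" for j using st by (simp add: J_def)
    show "inj_trans P F (J 0) (i F)" using inj[of 0] by (simp add: G_def)
    show "im_at F (i F) \<pi> = ker_at (J 0) (e 0) \<pi>" if "\<pi> \<in> P" for \<pi>
      using ker[OF that, of 0] by (simp add: G_def)
    show "socle P (J j) \<pi> \<subseteq> ker_at (J j) (e j) \<pi>" if "\<pi> \<in> P" for j \<pi>
      using st ker[OF that, of j] that by (simp add: J_def)
  qed (use F e im ker in auto)
  then show ?thesis by (rule that)
qed

text \<open>The universal property of a pointwise surjection \<open>p\<close>: a map that kills the kernel of \<open>p\<close> factors
  through \<open>p\<close>.\<close>

lemma nat_trans_descends:
  assumes A: "is_sheaf P A" and A': "is_sheaf P A'" and p: "nat_trans P A A' p"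
    and surj: "\<And>\<pi>. \<pi> \<in> P \<Longrightarrow> im_at A p \<pi> = stalk A' \<pi>"
    and g: "nat_trans P A B g"
    and ker: "\<And>\<pi> x. \<pi> \<in> P \<Longrightarrow> x \<in> stalk A \<pi> \<Longrightarrow> p \<pi> x = 0 \<Longrightarrow> g \<pi> x = 0"
  obtains f where "nat_trans P A' B f" "\<And>\<pi> x. \<pi> \<in> P \<Longrightarrow> x \<in> stalk A \<pi> \<Longrightarrow> f \<pi> (p \<pi> x) = g \<pi> x"
proof -
  define f where "f \<pi> y = g \<pi> (inv_into (stalk A \<pi>) (p \<pi>) y)" for \<pi> y
  have fp: "f \<pi> (p \<pi> x) = g \<pi> x" if \<pi>: "\<pi> \<in> P" and x: "x \<in> stalk A \<pi>" for \<pi> x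
  proof -
    let ?x = "inv_into (stalk A \<pi>) (p \<pi>) (p \<pi> x)"
    have x': "?x \<in> stalk A \<pi>" "p \<pi> ?x = p \<pi> x"
      using inv_into_into[of "p \<pi> x" "p \<pi>" "stalk A \<pi>"] f_inv_into_f[of "p \<pi> x" "p \<pi>" "stalk A \<pi>"] x by auto
    note s = is_sheafD(2)[OF A \<pi>]
    have "p \<pi> (?x - x) = 0" using linear_map_diff[OF nat_transD(1)[OF p \<pi>] s x'(1) x] x' by simp
    then have "g \<pi> (?x - x) = 0" using ker[OF \<pi> coord.subspace_diff[OF s x'(1) x]] by simp
    then show ?thesis using linear_map_diff[OF nat_transD(1)[OF g \<pi>] s x'(1) x] by (simp add: f_def)
  qed
  have lift: "\<exists>x\<in>stalk A \<pi>. y = p \<pi> x" if "\<pi> \<in> P" "y \<in> stalk A' \<pi>" for \<pi> y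
    using surj[OF that(1)] that(2) by (auto simp: im_at_def)
  have "nat_trans P A' B f"
    unfolding nat_trans_def
  proof (intro conjI ballI impI)
    fix \<pi> assume \<pi>: "\<pi> \<in> P"
    note s = is_sheafD(2)[OF A \<pi>] and lp = nat_transD(1)[OF p \<pi>] and lg = nat_transD(1)[OF g \<pi>]
    show "linear_map (stalk A' \<pi>) (stalk B \<pi>) (f \<pi>)"
      unfolding linear_map_def
    proof (intro conjI ballI allI)
      fix y assume "y \<in> stalk A' \<pi>"
      then obtain x where x: "x \<in> stalk A \<pi>" "y = p \<pi> x" using lift \<pi> by blast
      show "f \<pi> y \<in> stalk B \<pi>" using x fp[OF \<pi> x(1)] linear_mapD(1)[OF lg x(1)] by simp
      show "f \<pi> (cscale c y) = cscale c (f \<pi> y)" for c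
        using x fp[OF \<pi> x(1)] fp[OF \<pi> coord.subspace_scale[OF s x(1)], of c]
          linear_mapD(3)[OF lg x(1)] linear_mapD(3)[OF lp x(1)] by simp
      fix y' assume "y' \<in> stalk A' \<pi>"
      then obtain x' where x': "x' \<in> stalk A \<pi>" "y' = p \<pi> x'" using lift \<pi> by blast
      show "f \<pi> (y + y') = f \<pi> y + f \<pi> y'"
        using x x' fp[OF \<pi> x(1)] fp[OF \<pi> x'(1)] fp[OF \<pi> coord.subspace_add[OF s x(1) x'(1)]]
          linear_mapD(2)[OF lg x(1) x'(1)] linear_mapD(2)[OF lp x(1) x'(1)] by simp
    qed
  next
    fix \<tau> \<gamma> y assume t: "\<tau> \<in> P" "\<gamma> \<in> P" "\<tau> \<le> \<gamma>" and "y \<in> stalk A' \<tau>"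
    then obtain x where x: "x \<in> stalk A \<tau>" "y = p \<tau> x" using lift by blast
    have "f \<gamma> (smap A' \<tau> \<gamma> y) = f \<gamma> (p \<gamma> (smap A \<tau> \<gamma> x))" using nat_transD(3)[OF p t x(1)] x by simp
    also have "\<dots> = g \<gamma> (smap A \<tau> \<gamma> x)" using fp[OF t(2) is_sheafD(4)[OF A t x(1)]] .
    also have "\<dots> = smap B \<tau> \<gamma> (f \<tau> y)" using nat_transD(3)[OF g t x(1)] fp[OF t(1) x(1)] x by simp
    finally show "f \<gamma> (smap A' \<tau> \<gamma> y) = smap B \<tau> \<gamma> (f \<tau> y)" .
  qed
  then show ?thesis using that fp by blast
qed

lemma nat_trans_to_kernel:
  assumes "nat_trans P A B g" "\<And>\<pi> x. \<pi> \<in> P \<Longrightarrow> x \<in> stalk A \<pi> \<Longrightarrow> d \<pi> (g \<pi> x) = 0"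
  shows "nat_trans P A (kernel_sheaf B d) g"
  using assms by (simp add: nat_trans_def linear_map_def ker_at_def)

lemma injective_extends_kernel:
  assumes I: "injective_sheaf P I" and J: "is_sheaf P J" and J': "is_sheaf P J'" and e: "nat_trans P J J' e"
    and u: "nat_trans P (kernel_sheaf J e) I u"
  obtains f where "nat_trans P J I f" "\<And>\<pi> x. \<pi> \<in> P \<Longrightarrow> x \<in> ker_at J e \<pi> \<Longrightarrow> f \<pi> x = u \<pi> x"
proof -
  have "\<exists>g. nat_trans P J I g \<and> (\<forall>\<pi>\<in>P. \<forall>x\<in>stalk (kernel_sheaf J e) \<pi>. g \<pi> x = u \<pi> x)"
    using I is_sheaf_kernel[OF J J' e] J inj_trans_kernel_inclusion[OF J] u
    unfolding injective_sheaf_def by blast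
  then show ?thesis using that by auto
qed

lemma injective_resolutionD:
  assumes "injective_resolution P F I \<epsilon> d"
  shows "is_sheaf P F" "injective_sheaf P (I j)" "is_sheaf P (I j)" "inj_trans P F (I 0) \<epsilon>"
    "nat_trans P (I j) (I (Suc j)) (d j)"
    "\<pi> \<in> P \<Longrightarrow> im_at F \<epsilon> \<pi> = ker_at (I 0) (d 0) \<pi>"
    "\<pi> \<in> P \<Longrightarrow> im_at (I j) (d j) \<pi> = ker_at (I (Suc j)) (d (Suc j)) \<pi>"
    "nat_trans P F (kernel_sheaf (I 0) (d 0)) \<epsilon>"
    "nat_trans P (I j) (kernel_sheaf (I (Suc j)) (d (Suc j))) (d j)"
    "is_sheaf P (kernel_sheaf (I j) (d j))"
proof -
  show *: "is_sheaf P F" "\<And>j. injective_sheaf P (I j)" "inj_trans P F (I 0) \<epsilon>"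
    "\<And>j. nat_trans P (I j) (I (Suc j)) (d j)"
    "\<And>\<pi>. \<pi> \<in> P \<Longrightarrow> im_at F \<epsilon> \<pi> = ker_at (I 0) (d 0) \<pi>"
    "\<And>j \<pi>. \<pi> \<in> P \<Longrightarrow> im_at (I j) (d j) \<pi> = ker_at (I (Suc j)) (d (Suc j)) \<pi>"
    using assms by (auto simp: injective_resolution_def)
  then show **: "is_sheaf P (I j)" for j by (simp add: injective_sheaf_def)
  show "nat_trans P F (kernel_sheaf (I 0) (d 0)) \<epsilon>"
    using inj_transD(1)[OF *(3)] *(5) by (intro nat_trans_to_kernel) (auto simp: im_at_def ker_at_def)
  show "nat_trans P (I j) (kernel_sheaf (I (Suc j)) (d (Suc j))) (d j)"
  proof (rule nat_trans_to_kernel[OF *(4)])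
    fix \<pi> x assume x: "\<pi> \<in> P" "x \<in> stalk (I j) \<pi>"
    then have "d j \<pi> x \<in> im_at (I j) (d j) \<pi>" by (simp add: im_at_def)
    then show "d (Suc j) \<pi> (d j \<pi> x) = 0" unfolding *(6)[OF x(1)] by (simp add: ker_at_def)
  qed
  show "is_sheaf P (kernel_sheaf (I j) (d j))" using is_sheaf_kernel[OF ** ** *(4)] .
qed

text \<open>Extending \<open>u\<close> and \<open>v\<close> to maps \<open>f\<close> and \<open>g\<close> of the injective terms and passing to the quotients
  yields the next pair.  The composite \<open>g f\<close> is injective because it is injective on the kernel,
  which contains the socles.  The injective endomorphism \<open>v u\<close> of a finite-dimensional kernel is onto,
  so \<open>g f\<close> maps no vector outside the kernel into it; this is injectivity on the quotient.\<close>

lemma resolution_comparison_step: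
  assumes P: "finite P"
    and J: "socle_resolution P F J \<eta> e" and I: "injective_resolution P F I \<epsilon> d"
    and u: "nat_trans P (kernel_sheaf (J j) (e j)) (kernel_sheaf (I j) (d j)) u"
    and v: "nat_trans P (kernel_sheaf (I j) (d j)) (kernel_sheaf (J j) (e j)) v"
    and vu: "\<forall>\<pi>\<in>P. \<forall>x\<in>ker_at (J j) (e j) \<pi>. v \<pi> (u \<pi> x) = 0 \<longrightarrow> x = 0"
  obtains f u' v' where "inj_trans P (J j) (I j) f"
    "nat_trans P (kernel_sheaf (J (Suc j)) (e (Suc j))) (kernel_sheaf (I (Suc j)) (d (Suc j))) u'"
    "nat_trans P (kernel_sheaf (I (Suc j)) (d (Suc j))) (kernel_sheaf (J (Suc j)) (e (Suc j))) v'"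
    "\<forall>\<pi>\<in>P. \<forall>x\<in>ker_at (J (Suc j)) (e (Suc j)) \<pi>. v' \<pi> (u' \<pi> x) = 0 \<longrightarrow> x = 0"
proof -
  have J': "injective_resolution P F J \<eta> e"
    and soc: "\<And>j \<pi>. \<pi> \<in> P \<Longrightarrow> socle P (J j) \<pi> \<subseteq> ker_at (J j) (e j) \<pi>"
    using J by (auto simp: socle_resolution_def)
  note JD = injective_resolutionD[OF J'] and ID = injective_resolutionD[OF I]
  have uI: "nat_trans P (kernel_sheaf (J j) (e j)) (I j) u"
    using nat_trans_comp[OF u inj_transD(1)[OF inj_trans_kernel_inclusion[OF ID(3)]]] .
  have vJ: "nat_trans P (kernel_sheaf (I j) (d j)) (J j) v"
    using nat_trans_comp[OF v inj_transD(1)[OF inj_trans_kernel_inclusion[OF JD(3)]]] .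
  obtain f where f: "nat_trans P (J j) (I j) f" and fu: "\<And>\<pi> x. \<pi> \<in> P \<Longrightarrow> x \<in> ker_at (J j) (e j) \<pi> \<Longrightarrow> f \<pi> x = u \<pi> x"
    using injective_extends_kernel[OF ID(2) JD(3) JD(3) JD(5) uI] by blast
  obtain g where g: "nat_trans P (I j) (J j) g" and gv: "\<And>\<pi> x. \<pi> \<in> P \<Longrightarrow> x \<in> ker_at (I j) (d j) \<pi> \<Longrightarrow> g \<pi> x = v \<pi> x"
    using injective_extends_kernel[OF JD(2) ID(3) ID(3) ID(5) vJ] by blast
  have u_ker: "u \<pi> x \<in> ker_at (I j) (d j) \<pi>" if "\<pi> \<in> P" "x \<in> ker_at (J j) (e j) \<pi>" for \<pi> x
    using nat_transD(2)[OF u that(1)] that(2) by simp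
  have v_ker: "v \<pi> x \<in> ker_at (J j) (e j) \<pi>" if "\<pi> \<in> P" "x \<in> ker_at (I j) (d j) \<pi>" for \<pi> x
    using nat_transD(2)[OF v that(1)] that(2) by simp
  have gf: "g \<pi> (f \<pi> x) = v \<pi> (u \<pi> x)" if "\<pi> \<in> P" "x \<in> ker_at (J j) (e j) \<pi>" for \<pi> x
    using fu[OF that] gv[OF that(1) u_ker[OF that]] by simp
  \<comment> \<open>On socles, which lie in the kernel, the composite agrees with the injective \<open>v u\<close>.\<close>
  have gf_inj: "inj_trans P (J j) (J j) (\<lambda>\<pi> x. g \<pi> (f \<pi> x))"
  proof (rule inj_trans_if_inj_on_socle[OF P JD(3) JD(3) nat_trans_comp[OF f g]])
    fix \<pi> x assume x: "\<pi> \<in> P" "x \<in> socle P (J j) \<pi>" "g \<pi> (f \<pi> x) = 0"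
    then have "x \<in> ker_at (J j) (e j) \<pi>" using soc by blast
    then show "x = 0" using vu gf x by simp
  qed
  have "inj_on (f \<pi>) (stalk (J j) \<pi>)" if "\<pi> \<in> P" for \<pi>
    using inj_transD(2)[OF gf_inj that] by (auto simp: inj_on_def)
  then have f_inj: "inj_trans P (J j) (I j) f" using f by (simp add: inj_trans_def)
  obtain u' where u': "nat_trans P (kernel_sheaf (J (Suc j)) (e (Suc j))) (kernel_sheaf (I (Suc j)) (d (Suc j))) u'"
    and u'e: "\<And>\<pi> x. \<pi> \<in> P \<Longrightarrow> x \<in> stalk (J j) \<pi> \<Longrightarrow> u' \<pi> (e j \<pi> x) = d j \<pi> (f \<pi> x)"
  proof (rule nat_trans_descends[OF JD(3) JD(10) JD(9) _ nat_trans_comp[OF f ID(9)]])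
    show "d j \<pi> (f \<pi> x) = 0" if "\<pi> \<in> P" "x \<in> stalk (J j) \<pi>" "e j \<pi> x = 0" for \<pi> x
      using that fu[of \<pi> x] u_ker[of \<pi> x] by (simp add: ker_at_def)
  qed (use JD(7) in auto)
  obtain v' where v': "nat_trans P (kernel_sheaf (I (Suc j)) (d (Suc j))) (kernel_sheaf (J (Suc j)) (e (Suc j))) v'"
    and v'd: "\<And>\<pi> x. \<pi> \<in> P \<Longrightarrow> x \<in> stalk (I j) \<pi> \<Longrightarrow> v' \<pi> (d j \<pi> x) = e j \<pi> (g \<pi> x)"
  proof (rule nat_trans_descends[OF ID(3) ID(10) ID(9) _ nat_trans_comp[OF g JD(9)]])
    show "e j \<pi> (g \<pi> x) = 0" if "\<pi> \<in> P" "x \<in> stalk (I j) \<pi>" "d j \<pi> x = 0" for \<pi> x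
      using that gv[of \<pi> x] v_ker[of \<pi> x] by (simp add: ker_at_def)
  qed (use ID(7) in auto)
  have "y = 0" if \<pi>: "\<pi> \<in> P" and y: "y \<in> ker_at (J (Suc j)) (e (Suc j)) \<pi>" "v' \<pi> (u' \<pi> y) = 0" for \<pi> y
  proof -
    let ?K = "ker_at (J j) (e j) \<pi>"
    obtain x where x: "x \<in> stalk (J j) \<pi>" "y = e j \<pi> x" using y(1) JD(7)[OF \<pi>, of j] by (auto simp: im_at_def)
    have "e j \<pi> (g \<pi> (f \<pi> x)) = 0"
      using y(2) x u'e[OF \<pi> x(1)] v'd[OF \<pi> nat_transD(2)[OF f \<pi> x(1)]] by simp
    then have "g \<pi> (f \<pi> x) \<in> ?K"
      using nat_transD(2)[OF g \<pi> nat_transD(2)[OF f \<pi> x(1)]] by (simp add: ker_at_def)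
    moreover have "(\<lambda>x. v \<pi> (u \<pi> x)) ` ?K = ?K"
    proof (rule inj_endo_surj)
      have l: "linear_map (stalk (kernel_sheaf (J j) (e j)) \<pi>) (stalk (kernel_sheaf (J j) (e j)) \<pi>) (\<lambda>x. v \<pi> (u \<pi> x))"
        using nat_transD(1)[OF nat_trans_comp[OF u v] \<pi>] .
      then show "linear_map ?K ?K (\<lambda>x. v \<pi> (u \<pi> x))" by simp
      show fd: "fd_space ?K" using is_sheafD(1)[OF JD(10) \<pi>] by simp
      show "inj_on (\<lambda>x. v \<pi> (u \<pi> x)) ?K"
        using l vu \<pi> fd_spaceD[OF fd] by (subst linear_map_inj_iff) auto
    qed
    ultimately obtain z where z: "z \<in> ?K" "g \<pi> (f \<pi> x) = v \<pi> (u \<pi> z)" by (metis imageE)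
    then have "g \<pi> (f \<pi> x) = g \<pi> (f \<pi> z)" "z \<in> stalk (J j) \<pi>" using gf[OF \<pi>] by (auto simp: ker_at_def)
    then have "x = z" using inj_transD(2)[OF gf_inj \<pi>] x(1) by (auto simp: inj_on_def)
    then show ?thesis using z x by (simp add: ker_at_def)
  qed
  then show ?thesis using that[OF f_inj u' v'] by blast
qed

text \<open>Starting from the identity of \<open>F\<close>, the comparison provides in each degree an injective map \<open>J\<^sup>j \<rightarrow> I\<^sup>j\<close>,
  which is injective on socles.\<close>

lemma dim_socle_le:
  assumes P: "finite P"
    and J: "socle_resolution P F J \<eta> e" and I: "injective_resolution P F I \<epsilon> d" and \<pi>: "\<pi> \<in> P"
  shows "coord.dim (socle P (J j) \<pi>) \<le> coord.dim (socle P (I j) \<pi>)"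
proof -
  have J': "injective_resolution P F J \<eta> e" using J by (simp add: socle_resolution_def)
  note JD = injective_resolutionD[OF J'] and ID = injective_resolutionD[OF I]
  have "\<exists>u v. nat_trans P (kernel_sheaf (J j) (e j)) (kernel_sheaf (I j) (d j)) u \<and>
     nat_trans P (kernel_sheaf (I j) (d j)) (kernel_sheaf (J j) (e j)) v \<and>
     (\<forall>\<pi>\<in>P. \<forall>x\<in>ker_at (J j) (e j) \<pi>. v \<pi> (u \<pi> x) = 0 \<longrightarrow> x = 0)"
  proof (induction j)
    case 0
    have inj0: "x = 0" if "\<pi> \<in> P" "x \<in> stalk F \<pi>" "f \<pi> x = 0" "inj_trans P F G f" for f G \<pi> x
      using linear_map_inj_iff[OF nat_transD(1)[OF inj_transD(1)[OF that(4)] that(1)] is_sheafD(2)[OF JD(1) that(1)]]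
        inj_transD(2)[OF that(4,1)] that by blast
    obtain u where u: "nat_trans P (kernel_sheaf (J 0) (e 0)) (kernel_sheaf (I 0) (d 0)) u"
      "\<And>\<pi> x. \<pi> \<in> P \<Longrightarrow> x \<in> stalk F \<pi> \<Longrightarrow> u \<pi> (\<eta> \<pi> x) = \<epsilon> \<pi> x"
    proof (rule nat_trans_descends[OF JD(1) JD(10) JD(8) _ ID(8)])
      show "\<epsilon> \<pi> x = 0" if "\<pi> \<in> P" "x \<in> stalk F \<pi>" "\<eta> \<pi> x = 0" for \<pi> x
        using inj0[OF that JD(4)] linear_map_zero[OF nat_transD(1)[OF ID(8) that(1)] is_sheafD(2)[OF JD(1) that(1)]] by simp
    qed (use JD(6) in auto)
    obtain v where v: "nat_trans P (kernel_sheaf (I 0) (d 0)) (kernel_sheaf (J 0) (e 0)) v"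
      "\<And>\<pi> x. \<pi> \<in> P \<Longrightarrow> x \<in> stalk F \<pi> \<Longrightarrow> v \<pi> (\<epsilon> \<pi> x) = \<eta> \<pi> x"
    proof (rule nat_trans_descends[OF ID(1) ID(10) ID(8) _ JD(8)])
      show "\<eta> \<pi> x = 0" if "\<pi> \<in> P" "x \<in> stalk F \<pi>" "\<epsilon> \<pi> x = 0" for \<pi> x
        using inj0[OF that ID(4)] linear_map_zero[OF nat_transD(1)[OF JD(8) that(1)] is_sheafD(2)[OF JD(1) that(1)]] by simp
    qed (use ID(6) in auto)
    have "v \<pi> (u \<pi> y) = y" if \<pi>: "\<pi> \<in> P" and y: "y \<in> ker_at (J 0) (e 0) \<pi>" for \<pi> y
    proof -
      obtain x where "x \<in> stalk F \<pi>" "y = \<eta> \<pi> x" using y JD(6)[OF \<pi>] by (auto simp: im_at_def)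
      then show ?thesis using u(2)[OF \<pi>] v(2)[OF \<pi>] by simp
    qed
    then show ?case using u(1) v(1) by metis
  next
    case (Suc j)
    then obtain u v where *: "nat_trans P (kernel_sheaf (J j) (e j)) (kernel_sheaf (I j) (d j)) u"
      "nat_trans P (kernel_sheaf (I j) (d j)) (kernel_sheaf (J j) (e j)) v"
      "\<forall>\<pi>\<in>P. \<forall>x\<in>ker_at (J j) (e j) \<pi>. v \<pi> (u \<pi> x) = 0 \<longrightarrow> x = 0"
      by blast
    show ?case by (rule resolution_comparison_step[OF P J I *]) (intro exI conjI; assumption)
  qed
  then obtain u v where *: "nat_trans P (kernel_sheaf (J j) (e j)) (kernel_sheaf (I j) (d j)) u"
    "nat_trans P (kernel_sheaf (I j) (d j)) (kernel_sheaf (J j) (e j)) v"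
    "\<forall>\<pi>\<in>P. \<forall>x\<in>ker_at (J j) (e j) \<pi>. v \<pi> (u \<pi> x) = 0 \<longrightarrow> x = 0"
    by blast
  obtain f where f: "inj_trans P (J j) (I j) f" by (rule resolution_comparison_step[OF P J I *])
  have sub: "socle P (J j) \<pi> \<subseteq> stalk (J j) \<pi>" by (auto simp: socle_def)
  have "linear_map (socle P (J j) \<pi>) (stalk (I j) \<pi>) (f \<pi>)"
    using linear_map_subset[OF nat_transD(1)[OF inj_transD(1)[OF f] \<pi>] sub] nat_transD(2)[OF inj_transD(1)[OF f] \<pi>] sub by blast
  then have "coord.dim (socle P (J j) \<pi>) = coord.dim (f \<pi> ` socle P (J j) \<pi>)"
    using dim_inj_image[OF _ fd_socle[OF JD(3) \<pi>]] inj_on_subset[OF inj_transD(2)[OF f \<pi>] sub] by metis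
  also have "\<dots> \<le> coord.dim (socle P (I j) \<pi>)"
    by (rule fd_dim_mono[OF fd_socle[OF ID(3) \<pi>]])
      (use nat_trans_socle[OF inj_transD(1)[OF f] JD(3) ID(3) \<pi>] in blast)
  finally show ?thesis .
qed

text \<open>A minimal resolution has at most as many summands in total as \<open>J\<close>, and at least as many of each
  kind; so it has the same number of each kind.\<close>

lemma dim_socle_min_inj_res:
  fixes F :: "('p::order, 'k::field) sheaf"
  assumes P: "finite P" and J: "socle_resolution P F J \<eta> e" and \<pi>: "\<pi> \<in> P"
  shows "multiplicity_indec P (min_inj_res P F j) \<pi> = coord.dim (socle P (J j) \<pi>)"
proof -
  have J': "injective_resolution P F J \<eta> e" using J by (simp add: socle_resolution_def)
  have num_le: "num_summands P (J j) \<le> num_summands P (I j)"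
    if "injective_resolution P F I \<epsilon> d" for I \<epsilon> d j
    unfolding num_summands_eq[OF P injective_resolutionD(2)[OF J']] num_summands_eq[OF P injective_resolutionD(2)[OF that]]
    by (rule sum_mono) (rule dim_socle_le[OF P J that])
  then have "minimal_injective_resolution P F J \<eta> e"
    using J' by (auto simp: minimal_injective_resolution_def)
  then have "\<exists>I \<epsilon> d. minimal_injective_resolution P F I \<epsilon> d" by blast
  then obtain \<epsilon> d where min: "minimal_injective_resolution P F (min_inj_res P F) \<epsilon> d"
    unfolding min_inj_res_def using someI_ex[of "\<lambda>I. \<exists>\<epsilon> d. minimal_injective_resolution P F I \<epsilon> d"] by blast
  let ?I = "min_inj_res P F"
  have I: "injective_resolution P F ?I \<epsilon> d" using min by (simp add: minimal_injective_resolution_def)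
  have "num_summands P (?I j) \<le> num_summands P (J j)"
    using min J' by (auto simp: minimal_injective_resolution_def)
  then have le: "(\<Sum>\<pi>\<in>P. coord.dim (socle P (?I j) \<pi>)) \<le> (\<Sum>\<pi>\<in>P. coord.dim (socle P (J j) \<pi>))"
    unfolding num_summands_eq[OF P injective_resolutionD(2)[OF J']] num_summands_eq[OF P injective_resolutionD(2)[OF I]] .
  have "coord.dim (socle P (?I j) \<pi>) \<le> coord.dim (socle P (J j) \<pi>)"
  proof (rule ccontr)
    assume "\<not> ?thesis"
    then have "(\<Sum>\<pi>\<in>P. coord.dim (socle P (J j) \<pi>)) < (\<Sum>\<pi>\<in>P. coord.dim (socle P (?I j) \<pi>))"
      using P \<pi> dim_socle_le[OF P J I] by (intro sum_strict_mono_ex1) (auto simp: not_le)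
    then show False using le by simp
  qed
  then show ?thesis
    using dim_socle_le[OF P J I \<pi>, of j] multiplicity_indec_eq_dim_socle[OF P injective_resolutionD(2)[OF I] \<pi>] by simp
qed

section \<open>Dimension counts in a short exact sequence of complexes\<close>

definition cocycles :: "(nat \<Rightarrow> 'k::field vect set) \<Rightarrow> (nat \<Rightarrow> 'k vect \<Rightarrow> 'k vect) \<Rightarrow> nat \<Rightarrow> 'k vect set" where
  "cocycles X d j = {x \<in> X j. d j x = 0}"

definition coboundaries :: "(nat \<Rightarrow> 'k::field vect set) \<Rightarrow> (nat \<Rightarrow> 'k vect \<Rightarrow> 'k vect) \<Rightarrow> nat \<Rightarrow> 'k vect set" where
  "coboundaries X d j = (case j of 0 \<Rightarrow> {0} | Suc i \<Rightarrow> d i ` X i)"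

definition cohomology_dim :: "(nat \<Rightarrow> 'k::field vect set) \<Rightarrow> (nat \<Rightarrow> 'k vect \<Rightarrow> 'k vect) \<Rightarrow> nat \<Rightarrow> int" where
  "cohomology_dim X d j = int (coord.dim (cocycles X d j)) - int (coord.dim (coboundaries X d j))"

locale cochain_complex =
  fixes X :: "nat \<Rightarrow> 'k::field vect set" and d :: "nat \<Rightarrow> 'k vect \<Rightarrow> 'k vect"
  assumes fd: "fd_space (X j)"
    and d: "linear_map (X j) (X (Suc j)) (d j)"
    and dd: "x \<in> X j \<Longrightarrow> d (Suc j) (d j x) = 0"
begin

lemma subspace_cocycles: "coord.subspace (cocycles X d j)"
  unfolding cocycles_def using subspace_linear_kernel[OF d fd_spaceD[OF fd]] .

lemma fd_cocycles: "fd_space (cocycles X d j)"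
  by (rule fd_subspace[OF fd subspace_cocycles]) (auto simp: cocycles_def)

lemma dim_coboundaries_Suc:
  "int (coord.dim (coboundaries X d (Suc j))) = int (coord.dim (X j)) - int (coord.dim (cocycles X d j))"
  using rank_nullity[OF d fd, of j] by (simp add: coboundaries_def cocycles_def)

lemma dim_coboundaries_0: "coord.dim (coboundaries X d 0) = 0"
  using coord.dim_le_card[of "{0 :: 'k vect}" "{}"] by (simp add: coboundaries_def)

lemma coboundaries_subset: "coboundaries X d j \<subseteq> cocycles X d j"
  using coord.subspace_0[OF subspace_cocycles] linear_mapD(1)[OF d] dd
  by (auto simp: coboundaries_def cocycles_def split: nat.splits)

lemma subspace_coboundaries: "coord.subspace (coboundaries X d j)"
  using subspace_linear_image[OF d fd_spaceD[OF fd]] fd_spaceD[OF fd_zero]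
  by (auto simp: coboundaries_def split: nat.splits)

lemma cohomology_dim_0: "cohomology_dim X d 0 = int (coord.dim (cocycles X d 0))"
  by (simp add: cohomology_dim_def dim_coboundaries_0)

lemma cohomology_dim_nonneg: "0 \<le> cohomology_dim X d j"
  using fd_dim_mono[OF fd_cocycles coboundaries_subset] by (simp add: cohomology_dim_def)

end

text \<open>The quotient \<open>f V / f U\<close> is a quotient of \<open>V / U\<close>.\<close>

lemma dim_image_le_dim_subspace_image:
  assumes f: "linear_map V W f" and V: "fd_space V" and U: "coord.subspace U" "U \<subseteq> V"
  shows "int (coord.dim (f ` V)) \<le> int (coord.dim (f ` U)) + int (coord.dim V) - int (coord.dim U)"
proof -
  have fU: "linear_map U W f" using linear_map_subset[OF f U(2)] linear_mapD(1)[OF f] U(2) by blast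
  have "coord.dim {x \<in> U. f x = 0} \<le> coord.dim {x \<in> V. f x = 0}"
    by (rule fd_dim_mono[OF fd_subspace[OF V subspace_linear_kernel[OF f fd_spaceD[OF V]]]]) (use U in auto)
  then show ?thesis using rank_nullity[OF f V] rank_nullity[OF fU fd_subspace[OF V U]] by linarith
qed

text \<open>A short exact sequence of complexes \<open>0 \<rightarrow> A \<rightarrow> B \<rightarrow> C \<rightarrow> 0\<close>, given by the surjection \<open>\<rho>\<close>.  Its long
  exact cohomology sequence is used only through the dimensions below, which all depend on the single
  unknown \<open>cocycle_rank\<close>, the dimension of the image of the cocycles of \<open>B\<close> in \<open>C\<close>.\<close>

locale surjective_cochain_map = B: cochain_complex B dB + C: cochain_complex C dC
  for B C :: "nat \<Rightarrow> 'k::field vect set" and dB dC +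
  fixes \<rho> :: "nat \<Rightarrow> 'k vect \<Rightarrow> 'k vect"
  assumes \<rho>: "linear_map (B j) (C j) (\<rho> j)"
    and surj: "\<rho> j ` B j = C j"
    and comm: "x \<in> B j \<Longrightarrow> \<rho> (Suc j) (dB j x) = dC j (\<rho> j x)"
begin

definition A :: "nat \<Rightarrow> 'k vect set" where
  "A j = {x \<in> B j. \<rho> j x = 0}"

definition cocycle_rank :: "nat \<Rightarrow> int" where
  "cocycle_rank j = int (coord.dim (\<rho> j ` cocycles B dB j))"

sublocale A: cochain_complex A dB
proof
  show "fd_space (A j)" for j
    unfolding A_def by (rule fd_subspace[OF B.fd subspace_linear_kernel[OF \<rho> fd_spaceD[OF B.fd]]]) auto
  have "dB j x \<in> A (Suc j)" if "x \<in> A j" for j x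
    using that comm[of x j] linear_mapD(1)[OF B.d] linear_map_zero[OF C.d fd_spaceD[OF C.fd]]
    by (auto simp: A_def)
  then show "linear_map (A j) (A (Suc j)) (dB j)" for j
    using linear_map_subset[OF B.d, of "A j" j "A (Suc j)"] by (auto simp: A_def)
  show "dB (Suc j) (dB j x) = 0" if "x \<in> A j" for j x using that B.dd by (simp add: A_def)
qed

lemma dim_A: "int (coord.dim (A j)) = int (coord.dim (B j)) - int (coord.dim (C j))"
  using rank_nullity[OF \<rho> B.fd, of j] by (simp add: A_def surj)

lemma linear_\<rho>_cocycles: "linear_map (cocycles B dB j) (C j) (\<rho> j)"
  using linear_map_subset[OF \<rho>, of "cocycles B dB j" j] linear_mapD(1)[OF \<rho>] by (auto simp: cocycles_def)

lemma dim_cocycles_A: "int (coord.dim (cocycles A dB j)) = int (coord.dim (cocycles B dB j)) - cocycle_rank j"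
proof -
  have "cocycles A dB j = {x \<in> cocycles B dB j. \<rho> j x = 0}" by (auto simp: cocycles_def A_def)
  then show ?thesis using rank_nullity[OF linear_\<rho>_cocycles B.fd_cocycles, of j] by (simp add: cocycle_rank_def)
qed

lemma image_cocycles: "\<rho> j ` cocycles B dB j \<subseteq> cocycles C dC j"
proof
  fix y assume "y \<in> \<rho> j ` cocycles B dB j"
  then obtain x where x: "x \<in> B j" "dB j x = 0" "y = \<rho> j x" by (auto simp: cocycles_def)
  then show "y \<in> cocycles C dC j"
    using comm[OF x(1)] linear_mapD(1)[OF \<rho> x(1)] linear_map_zero[OF \<rho> fd_spaceD[OF B.fd], of "Suc j"]
    by (simp add: cocycles_def)
qed

lemma image_coboundaries: "\<rho> j ` coboundaries B dB j = coboundaries C dC j"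
proof (cases j)
  case 0
  then show ?thesis using linear_map_zero[OF \<rho> fd_spaceD[OF B.fd]] by (simp add: coboundaries_def)
next
  case (Suc i)
  have "\<rho> j ` dB i ` B i = dC i ` \<rho> i ` B i" using comm[of _ i] Suc by (force simp: image_image)
  then show ?thesis using Suc surj by (simp add: coboundaries_def)
qed

lemma cocycle_rank_le: "cocycle_rank j \<le> int (coord.dim (cocycles C dC j))"
  unfolding cocycle_rank_def using fd_dim_mono[OF C.fd_cocycles image_cocycles] by simp

lemma cocycle_rank_ge: "int (coord.dim (coboundaries C dC j)) \<le> cocycle_rank j"
proof -
  have "coboundaries C dC j \<subseteq> \<rho> j ` cocycles B dB j"
    using image_coboundaries[of j] B.coboundaries_subset[of j] by blast
  then show ?thesis unfolding cocycle_rank_def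
    using fd_dim_mono[OF fd_image[OF linear_\<rho>_cocycles B.fd_cocycles]] by simp
qed

lemma cocycle_rank_le_cohomology: "cocycle_rank j \<le> int (coord.dim (coboundaries C dC j)) + cohomology_dim B dB j"
  unfolding cocycle_rank_def cohomology_dim_def image_coboundaries[symmetric]
  using dim_image_le_dim_subspace_image[OF linear_\<rho>_cocycles B.fd_cocycles B.subspace_coboundaries B.coboundaries_subset, of j]
  by linarith

lemma cohomology_dim_A_Suc:
  "cohomology_dim A dB (Suc j) = cohomology_dim B dB (Suc j) + int (coord.dim (C j)) - cocycle_rank (Suc j) - cocycle_rank j"
  using dim_cocycles_A[of j] dim_cocycles_A[of "Suc j"] dim_A[of j]
  by (simp add: cohomology_dim_def A.dim_coboundaries_Suc B.dim_coboundaries_Suc)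

lemma cohomology_dim_A_0_le: "cohomology_dim A dB 0 \<le> cohomology_dim B dB 0"
  using dim_cocycles_A[of 0] by (simp add: A.cohomology_dim_0 B.cohomology_dim_0 cocycle_rank_def)

text \<open>Exactness of \<open>H\<^sup>j(C) \<rightarrow> H\<^sup>j\<^sup>+\<^sup>1(A) \<rightarrow> H\<^sup>j\<^sup>+\<^sup>1(B)\<close>, as an inequality of dimensions.\<close>

lemma cohomology_dim_A_Suc_le:
  "cohomology_dim A dB (Suc j) \<le> cohomology_dim B dB (Suc j) + cohomology_dim C dC j"
  using cohomology_dim_A_Suc[of j] cocycle_rank_ge[of j] cocycle_rank_ge[of "Suc j"] C.dim_coboundaries_Suc[of j]
  by (simp add: cohomology_dim_def[of C])

text \<open>In the long exact sequence, \<open>H\<^sup>j\<^sup>+\<^sup>1(A)\<close> contains the cokernel of \<open>H\<^sup>j(B) \<rightarrow> H\<^sup>j(C)\<close>, and the quotient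
  by it is the kernel of \<open>H\<^sup>j\<^sup>+\<^sup>1(B) \<rightarrow> H\<^sup>j\<^sup>+\<^sup>1(C)\<close>.\<close>

lemma cohomology_dim_A_Suc_ge:
  "cohomology_dim B dB (Suc j) + cohomology_dim C dC j - cohomology_dim C dC (Suc j) - cohomology_dim B dB j
     \<le> cohomology_dim A dB (Suc j)"
  using cohomology_dim_A_Suc[of j] cocycle_rank_le[of "Suc j"] cocycle_rank_le_cohomology[of j] C.dim_coboundaries_Suc[of j]
  by (simp add: cohomology_dim_def[of C])

text \<open>If \<open>H\<^sup>0(B) \<rightarrow> H\<^sup>0(C)\<close> is onto, the connecting map into \<open>H\<^sup>1(A)\<close> is zero.\<close>

lemma cohomology_dim_A_1_le:
  assumes "cocycles C dC 0 \<subseteq> \<rho> 0 ` cocycles B dB 0"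
  shows "cohomology_dim A dB (Suc 0) \<le> cohomology_dim B dB (Suc 0)"
proof -
  have "\<rho> 0 ` cocycles B dB 0 = cocycles C dC 0" using assms image_cocycles by auto
  then have "cocycle_rank 0 = int (coord.dim (cocycles C dC 0))" by (simp add: cocycle_rank_def)
  then show ?thesis using cohomology_dim_A_Suc[of 0] cocycle_rank_ge[of "Suc 0"] C.dim_coboundaries_Suc[of 0] by simp
qed

end

section \<open>Sections avoiding a set of vertices\<close>

text \<open>The constant sheaf on \<open>Z\<close>, extended by zero.\<close>

definition zone_sheaf :: "'p::order set \<Rightarrow> ('p, 'k::field) sheaf" where
  "zone_sheaf Z = \<lparr>stalk = (\<lambda>\<gamma>. if \<gamma> \<in> Z then line else {0}),
     smap = (\<lambda>\<tau> \<gamma> x. if \<tau> \<in> Z \<and> \<gamma> \<in> Z then x else 0)\<rparr>"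

lemma zone_stalk: "stalk (zone_sheaf Z) \<gamma> = (if \<gamma> \<in> Z then line else {0})"
  and zone_smap: "smap (zone_sheaf Z) \<tau> \<gamma> x = (if \<tau> \<in> Z \<and> \<gamma> \<in> Z then x else 0)"
  by (simp_all add: zone_sheaf_def)

lemma is_sheaf_zone:
  assumes "\<And>\<sigma> \<tau> \<gamma>. \<sigma> \<in> Z \<Longrightarrow> \<gamma> \<in> Z \<Longrightarrow> \<tau> \<in> P \<Longrightarrow> \<sigma> \<le> \<tau> \<Longrightarrow> \<tau> \<le> \<gamma> \<Longrightarrow> \<tau> \<in> Z"
  shows "is_sheaf P (zone_sheaf Z)"
  unfolding is_sheaf_def
proof (intro conjI ballI impI; (elim conjE)?)
  show "linear_map (stalk (zone_sheaf Z) \<tau>) (stalk (zone_sheaf Z) \<gamma>) (smap (zone_sheaf Z) \<tau> \<gamma>)" for \<tau> \<gamma>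
    by (auto simp: zone_stalk zone_smap linear_map_def line_def vect_nth)
  show "smap (zone_sheaf Z) \<tau> \<gamma> (smap (zone_sheaf Z) \<sigma> \<tau> x) = smap (zone_sheaf Z) \<sigma> \<gamma> x"
    if "\<tau> \<in> P" "\<sigma> \<le> \<tau>" "\<tau> \<le> \<gamma>" for \<sigma> \<tau> \<gamma> x
    using assms[of \<sigma> \<gamma> \<tau>] that by (simp add: zone_smap)
qed (auto simp: zone_stalk zone_smap fd_line fd_zero)

locale simplicial_poset =
  fixes K :: "'v set set"
  assumes K: "finite_simplicial_complex K"
begin

lemma finite_K: "finite K" and face_closed: "\<sigma> \<in> K \<Longrightarrow> \<tau> \<subseteq> \<sigma> \<Longrightarrow> \<tau> \<noteq> {} \<Longrightarrow> \<tau> \<in> K"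
  and simplex_finite: "\<sigma> \<in> K \<Longrightarrow> finite \<sigma>" and simplex_nonempty: "\<sigma> \<in> K \<Longrightarrow> \<sigma> \<noteq> {}"
  using K unfolding finite_simplicial_complex_def by blast+

text \<open>These vectors form \<open>Hom(S(\<pi>, W), G)\<close>, where \<open>S(\<pi>, W)\<close> is the constant sheaf on the simplices that
  contain \<open>\<pi>\<close> and avoid \<open>W\<close>.\<close>

definition avoiding :: "('v set, 'k::field) sheaf \<Rightarrow> 'v set \<Rightarrow> 'v set \<Rightarrow> 'k vect set" where
  "avoiding G \<pi> W = {x \<in> stalk G \<pi>. \<forall>w\<in>W. insert w \<pi> \<in> K \<longrightarrow> smap G \<pi> (insert w \<pi>) x = 0}"

lemma avoiding_empty [simp]: "avoiding G \<pi> {} = stalk G \<pi>"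
  by (simp add: avoiding_def)

lemma subspace_avoiding:
  assumes G: "is_sheaf K G" and \<pi>: "\<pi> \<in> K"
  shows "coord.subspace (avoiding G \<pi> W)"
  using is_sheafD(2)[OF G \<pi>] is_sheafD(7)[OF G \<pi> _ subset_insertI] linear_mapD(2,3)[OF is_sheafD(3)[OF G \<pi> _ subset_insertI]]
  by (auto simp: avoiding_def coord.subspace_def)

lemma fd_avoiding: "is_sheaf K G \<Longrightarrow> \<pi> \<in> K \<Longrightarrow> fd_space (avoiding G \<pi> W)"
  by (rule fd_subspace[OF is_sheafD(1) subspace_avoiding]) (auto simp: avoiding_def)

lemma avoiding_insert:
  "insert w \<pi> \<in> K \<Longrightarrow> avoiding G \<pi> (insert w W) = {x \<in> avoiding G \<pi> W. smap G \<pi> (insert w \<pi>) x = 0}"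
  "insert w \<pi> \<notin> K \<Longrightarrow> avoiding G \<pi> (insert w W) = avoiding G \<pi> W"
  by (auto simp: avoiding_def)

lemma nat_trans_avoiding:
  assumes f: "nat_trans K G H f" and G: "is_sheaf K G" and \<pi>: "\<pi> \<in> K" and x: "x \<in> avoiding G \<pi> W"
  shows "f \<pi> x \<in> avoiding H \<pi> W"
proof -
  have xG: "x \<in> stalk G \<pi>" using x by (simp add: avoiding_def)
  have "smap H \<pi> (insert w \<pi>) (f \<pi> x) = 0" if w: "w \<in> W" "insert w \<pi> \<in> K" for w
  proof -
    have "smap H \<pi> (insert w \<pi>) (f \<pi> x) = f (insert w \<pi>) (smap G \<pi> (insert w \<pi>) x)"
      using nat_transD(3)[OF f \<pi> w(2) subset_insertI xG] by simp
    also have "\<dots> = 0"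
      using x w linear_map_zero[OF nat_transD(1)[OF f w(2)] is_sheafD(2)[OF G w(2)]] by (simp add: avoiding_def)
    finally show ?thesis .
  qed
  then show ?thesis using nat_transD(2)[OF f \<pi> xG] by (simp add: avoiding_def)
qed

lemma avoiding_all_vertices:
  assumes G: "is_sheaf K G" and \<pi>: "\<pi> \<in> K"
  shows "avoiding G \<pi> (\<Union>K - \<pi>) = socle K G \<pi>"
proof (intro equalityI subsetI)
  fix x assume x: "x \<in> avoiding G \<pi> (\<Union>K - \<pi>)"
  then have xG: "x \<in> stalk G \<pi>" by (simp add: avoiding_def)
  have "smap G \<pi> \<gamma> x = 0" if \<gamma>: "\<gamma> \<in> K" "\<pi> \<subset> \<gamma>" for \<gamma>
  proof -
    obtain w where w: "w \<in> \<gamma>" "w \<notin> \<pi>" using \<gamma>(2) by blast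
    have sub: "insert w \<pi> \<subseteq> \<gamma>" using w \<gamma> by blast
    then have in_K: "insert w \<pi> \<in> K" using face_closed[OF \<gamma>(1)] by blast
    have "smap G \<pi> \<gamma> x = smap G (insert w \<pi>) \<gamma> (smap G \<pi> (insert w \<pi>) x)"
      using is_sheafD(6)[OF G \<pi> in_K \<gamma>(1) subset_insertI sub xG] by simp
    also have "smap G \<pi> (insert w \<pi>) x = 0" using x w \<gamma>(1) in_K by (auto simp: avoiding_def)
    finally show ?thesis using is_sheafD(7)[OF G in_K \<gamma>(1) sub] by simp
  qed
  then show "x \<in> socle K G \<pi>" using xG by (simp add: socle_def)
next
  fix x assume x: "x \<in> socle K G \<pi>"
  have "\<pi> \<subset> insert w \<pi>" if "w \<in> \<Union>K - \<pi>" for w using that by blast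
  then show "x \<in> avoiding G \<pi> (\<Union>K - \<pi>)" using x by (auto simp: socle_def avoiding_def)
qed

lemma restriction_avoiding:
  assumes G: "is_sheaf K G" and \<pi>: "\<pi> \<in> K" "insert w \<pi> \<in> K" and x: "x \<in> avoiding G \<pi> W"
  shows "smap G \<pi> (insert w \<pi>) x \<in> avoiding G (insert w \<pi>) W"
proof -
  have xG: "x \<in> stalk G \<pi>" using x by (simp add: avoiding_def)
  have "smap G (insert w \<pi>) (insert v (insert w \<pi>)) (smap G \<pi> (insert w \<pi>) x) = 0"
    if v: "v \<in> W" "insert v (insert w \<pi>) \<in> K" for v
  proof -
    have in_K: "insert v \<pi> \<in> K" using face_closed[OF v(2)] by blast
    have s: "insert v \<pi> \<subseteq> insert v (insert w \<pi>)" by blast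
    have "smap G (insert w \<pi>) (insert v (insert w \<pi>)) (smap G \<pi> (insert w \<pi>) x) = smap G \<pi> (insert v (insert w \<pi>)) x"
      using is_sheafD(6)[OF G \<pi> v(2) subset_insertI subset_insertI xG] .
    also have "\<dots> = smap G (insert v \<pi>) (insert v (insert w \<pi>)) (smap G \<pi> (insert v \<pi>) x)"
      using is_sheafD(6)[OF G \<pi>(1) in_K v(2) subset_insertI s xG] by simp
    also have "smap G \<pi> (insert v \<pi>) x = 0" using x v in_K by (simp add: avoiding_def)
    finally show ?thesis using is_sheafD(7)[OF G in_K v(2) s] by simp
  qed
  then show ?thesis using is_sheafD(4)[OF G \<pi> subset_insertI xG] by (simp add: avoiding_def)
qed

text \<open>The inclusion \<open>S(\<pi> + w, W) \<rightarrow> S(\<pi>, W)\<close> of sheaves that are constant on a convex set is injective, so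
  the map \<open>S(\<pi> + w, W) \<rightarrow> I\<close> given by \<open>y\<close> extends to \<open>S(\<pi>, W)\<close>; its value on the generator at \<open>\<pi>\<close>
  is a preimage of \<open>y\<close>.\<close>

lemma restriction_avoiding_surjective:
  fixes I :: "('v set, 'k::field) sheaf"
  assumes I: "injective_sheaf K I" and \<pi>: "\<pi> \<in> K" "insert w \<pi> \<in> K"
    and disj: "W \<inter> insert w \<pi> = {}" and y: "y \<in> avoiding I (insert w \<pi>) W"
  shows "\<exists>x\<in>avoiding I \<pi> W. smap I \<pi> (insert w \<pi>) x = y"
proof -
  have sI: "is_sheaf K I" using I by (simp add: injective_sheaf_def)
  let ?\<rho> = "insert w \<pi>"
  define Z1 where "Z1 = {\<tau>\<in>K. ?\<rho> \<subseteq> \<tau> \<and> \<tau> \<inter> W = {}}"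
  define Z2 where "Z2 = {\<tau>\<in>K. \<pi> \<subseteq> \<tau> \<and> \<tau> \<inter> W = {}}"
  let ?A = "zone_sheaf Z1 :: ('v set, 'k) sheaf" and ?B = "zone_sheaf Z2 :: ('v set, 'k) sheaf"
  have A: "is_sheaf K ?A" by (rule is_sheaf_zone) (auto simp: Z1_def)
  have B: "is_sheaf K ?B" by (rule is_sheaf_zone) (auto simp: Z2_def)
  have Z12: "Z1 \<subseteq> Z2" by (auto simp: Z1_def Z2_def)
  have up: "\<gamma> \<in> Z1" if "\<tau> \<in> Z1" "\<gamma> \<in> Z2" "\<tau> \<subseteq> \<gamma>" for \<tau> \<gamma>
    using that by (auto simp: Z1_def Z2_def)
  have yI: "y \<in> stalk I ?\<rho>" using y by (simp add: avoiding_def)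
  have i: "inj_trans K ?A ?B (\<lambda>\<pi> x. x)"
    unfolding inj_trans_def nat_trans_def zone_stalk zone_smap
    using Z12 up by (auto simp: linear_map_def line_def vect_nth)
  define f where "f \<tau> x = (if \<tau> \<in> Z1 then cscale (x 0) (smap I ?\<rho> \<tau> y) else 0)" for \<tau> and x :: "'k vect"
  \<comment> \<open>A simplex outside Z1 contains a vertex of W, and y dies on the way as soon as that vertex is added.\<close>
  have leave: "smap I ?\<rho> \<gamma> y = 0" if \<gamma>: "\<gamma> \<in> K" "?\<rho> \<subseteq> \<gamma>" "\<gamma> \<notin> Z1" for \<gamma>
  proof -
    obtain v where v: "v \<in> W" "v \<in> \<gamma>" using \<gamma> by (auto simp: Z1_def)
    have s: "insert v ?\<rho> \<subseteq> \<gamma>" using v \<gamma> by blast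
    have in_K: "insert v ?\<rho> \<in> K" using face_closed[OF \<gamma>(1) s] by blast
    have "smap I ?\<rho> \<gamma> y = smap I (insert v ?\<rho>) \<gamma> (smap I ?\<rho> (insert v ?\<rho>) y)"
      using is_sheafD(6)[OF sI \<pi>(2) in_K \<gamma>(1) subset_insertI s yI] by simp
    also have "smap I ?\<rho> (insert v ?\<rho>) y = 0" using y v in_K by (simp add: avoiding_def)
    finally show ?thesis using is_sheafD(7)[OF sI in_K \<gamma>(1) s] by simp
  qed
  have f: "nat_trans K ?A I f"
    unfolding nat_trans_def
  proof (intro conjI ballI impI)
    fix \<tau> assume \<tau>: "\<tau> \<in> K"
    note s = is_sheafD(2)[OF sI \<tau>]
    have st: "smap I ?\<rho> \<tau> y \<in> stalk I \<tau>" if "\<tau> \<in> Z1"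
      using is_sheafD(4)[OF sI \<pi>(2) \<tau> _ yI] that by (simp add: Z1_def)
    show "linear_map (stalk ?A \<tau>) (stalk I \<tau>) (f \<tau>)"
      using coord.subspace_scale[OF s st] coord.subspace_0[OF s]
      by (auto simp: linear_map_def f_def zone_stalk vect_nth coord.scale_left_distrib)
  next
    fix \<tau> \<gamma> x assume t: "\<tau> \<in> K" "\<gamma> \<in> K" "\<tau> \<subseteq> \<gamma>" and x: "x \<in> stalk ?A \<tau>"
    show "f \<gamma> (smap ?A \<tau> \<gamma> x) = smap I \<tau> \<gamma> (f \<tau> x)"
    proof (cases "\<tau> \<in> Z1")
      case True
      then have \<rho>\<tau>: "?\<rho> \<subseteq> \<tau>" by (simp add: Z1_def)
      have \<tau>y: "smap I ?\<rho> \<tau> y \<in> stalk I \<tau>" using is_sheafD(4)[OF sI \<pi>(2) t(1) \<rho>\<tau> yI] .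
      have "smap I \<tau> \<gamma> (f \<tau> x) = cscale (x 0) (smap I \<tau> \<gamma> (smap I ?\<rho> \<tau> y))"
        using True linear_mapD(3)[OF is_sheafD(3)[OF sI t] \<tau>y] by (simp add: f_def)
      also have "smap I \<tau> \<gamma> (smap I ?\<rho> \<tau> y) = smap I ?\<rho> \<gamma> y" using is_sheafD(6)[OF sI \<pi>(2) t(1,2) \<rho>\<tau> t(3) yI] .
      finally have "smap I \<tau> \<gamma> (f \<tau> x) = cscale (x 0) (smap I ?\<rho> \<gamma> y)" .
      then show ?thesis
      proof (cases "\<gamma> \<in> Z1")
        case False
        have "smap I ?\<rho> \<gamma> y = 0" using leave[OF t(2) _ False] \<rho>\<tau> t(3) by blast
        then show ?thesis using False \<open>smap I \<tau> \<gamma> (f \<tau> x) = cscale (x 0) (smap I ?\<rho> \<gamma> y)\<close> by (simp add: f_def)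
      qed (use True in \<open>simp add: f_def zone_smap\<close>)
    next
      case False
      then have "x = 0" "f \<tau> x = 0" using x by (simp_all add: zone_stalk f_def)
      then show ?thesis using is_sheafD(7)[OF sI t] by (simp add: f_def zone_smap vect_nth)
    qed
  qed
  obtain g where g: "nat_trans K ?B I g" and gf: "\<And>\<tau> x. \<tau> \<in> K \<Longrightarrow> x \<in> stalk ?A \<tau> \<Longrightarrow> g \<tau> x = f \<tau> x"
    using I A B i f unfolding injective_sheaf_def by blast
  let ?u = "unit_vect 0 :: 'k vect"
  have \<pi>Z: "\<pi> \<in> Z2" "?\<rho> \<in> Z1" "?\<rho> \<in> Z2" using \<pi> disj by (auto simp: Z1_def Z2_def)
  have uB: "?u \<in> stalk ?B \<pi>" using \<pi>Z by (simp add: zone_stalk)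
  have g_res: "smap I \<pi> \<tau> (g \<pi> ?u) = g \<tau> (smap ?B \<pi> \<tau> ?u)" if "\<tau> \<in> K" "\<pi> \<subseteq> \<tau>" for \<tau>
    using nat_transD(3)[OF g \<pi>(1) that uB] by simp
  have "smap I \<pi> ?\<rho> (g \<pi> ?u) = g ?\<rho> ?u" using g_res[OF \<pi>(2) subset_insertI] \<pi>Z by (simp add: zone_smap)
  also have "\<dots> = f ?\<rho> ?u" using gf[OF \<pi>(2)] \<pi>Z by (simp add: zone_stalk)
  also have "\<dots> = y" using \<pi>Z is_sheafD(5)[OF sI \<pi>(2) yI] by (simp add: f_def unit_vect_def)
  finally have res: "smap I \<pi> ?\<rho> (g \<pi> ?u) = y" .
  have "smap I \<pi> (insert v \<pi>) (g \<pi> ?u) = 0" if v: "v \<in> W" "insert v \<pi> \<in> K" for v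
  proof -
    have "insert v \<pi> \<notin> Z2" using v by (auto simp: Z2_def)
    then have "smap I \<pi> (insert v \<pi>) (g \<pi> ?u) = g (insert v \<pi>) 0"
      using g_res[OF v(2) subset_insertI] by (simp add: zone_smap)
    also have "\<dots> = 0" using linear_map_zero[OF nat_transD(1)[OF g v(2)] is_sheafD(2)[OF B v(2)]] .
    finally show ?thesis .
  qed
  then have "g \<pi> ?u \<in> avoiding I \<pi> W" using nat_transD(2)[OF g \<pi>(1) uB] by (simp add: avoiding_def)
  then show ?thesis using res by blast
qed

end

section \<open>Cohomology of the constant sheaf of a simplicial complex\<close>

locale const_resolution = simplicial_poset K for K :: "'v set set" +
  fixes I :: "nat \<Rightarrow> ('v set, 'k::field) sheaf" and \<epsilon> :: "('v set, 'k) nat_map" and d :: "nat \<Rightarrow> ('v set, 'k) nat_map"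
  assumes res: "injective_resolution K const_sheaf I \<epsilon> d"
begin

text \<open>The dimension of \<open>Ext\<^sup>j(S(\<pi>, W), k)\<close>.\<close>

definition ext_dim :: "'v set \<Rightarrow> 'v set \<Rightarrow> nat \<Rightarrow> int" where
  "ext_dim \<pi> W j = cohomology_dim (\<lambda>j. avoiding (I j) \<pi> W) (\<lambda>j. d j \<pi>) j"

lemmas resD = injective_resolutionD[OF res]

lemma d_d:
  assumes "\<pi> \<in> K" "x \<in> stalk (I j) \<pi>"
  shows "d (Suc j) \<pi> (d j \<pi> x) = 0"
  using nat_transD(2)[OF resD(9) assms(1), of x j] assms(2) by (simp add: ker_at_def)

lemma cochain_complex_avoiding:
  assumes \<pi>: "\<pi> \<in> K"
  shows "cochain_complex (\<lambda>j. avoiding (I j) \<pi> W) (\<lambda>j. d j \<pi>)"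
proof
  have sub: "avoiding (I j) \<pi> W \<subseteq> stalk (I j) \<pi>" for j by (auto simp: avoiding_def)
  show "fd_space (avoiding (I j) \<pi> W)" for j using fd_avoiding[OF resD(3) \<pi>] .
  show "linear_map (avoiding (I j) \<pi> W) (avoiding (I (Suc j)) \<pi> W) (d j \<pi>)" for j
    using linear_map_subset[OF nat_transD(1)[OF resD(5) \<pi>] sub] nat_trans_avoiding[OF resD(5) resD(3) \<pi>] by blast
  show "d (Suc j) \<pi> (d j \<pi> x) = 0" if "x \<in> avoiding (I j) \<pi> W" for j x
    using d_d[OF \<pi>] that sub by blast
qed

text \<open>This is the sequence \<open>0 \<rightarrow> S(\<pi> + w, W) \<rightarrow> S(\<pi>, W) \<rightarrow> S(\<pi>, W + w) \<rightarrow> 0\<close> mapped into the resolution.\<close>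

lemma surjective_restriction:
  assumes \<pi>: "\<pi> \<in> K" "insert w \<pi> \<in> K" and disj: "W \<inter> insert w \<pi> = {}"
  shows "surjective_cochain_map (\<lambda>j. avoiding (I j) \<pi> W) (\<lambda>j. avoiding (I j) (insert w \<pi>) W)
    (\<lambda>j. d j \<pi>) (\<lambda>j. d j (insert w \<pi>)) (\<lambda>j. smap (I j) \<pi> (insert w \<pi>))"
proof (intro surjective_cochain_map.intro surjective_cochain_map_axioms.intro cochain_complex_avoiding \<pi>)
  have sub: "avoiding (I j) \<pi> W \<subseteq> stalk (I j) \<pi>" for j by (auto simp: avoiding_def)
  show "linear_map (avoiding (I j) \<pi> W) (avoiding (I j) (insert w \<pi>) W) (smap (I j) \<pi> (insert w \<pi>))" for j
    using linear_map_subset[OF is_sheafD(3)[OF resD(3) \<pi> subset_insertI] sub] restriction_avoiding[OF resD(3) \<pi>] by blast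
  show "smap (I j) \<pi> (insert w \<pi>) ` avoiding (I j) \<pi> W = avoiding (I j) (insert w \<pi>) W" for j
    using restriction_avoiding[OF resD(3) \<pi>] restriction_avoiding_surjective[OF resD(2) \<pi> disj] by fast
  show "smap (I (Suc j)) \<pi> (insert w \<pi>) (d j \<pi> x) = d j (insert w \<pi>) (smap (I j) \<pi> (insert w \<pi>) x)"
    if "x \<in> avoiding (I j) \<pi> W" for j x
    using nat_transD(3)[OF resD(5) \<pi> subset_insertI] that sub by (metis subsetD)
qed

lemma kernel_complex:
  assumes \<pi>: "\<pi> \<in> K" "insert w \<pi> \<in> K" and disj: "W \<inter> insert w \<pi> = {}"
  shows "ext_dim \<pi> (insert w W) j = cohomology_dim
    (surjective_cochain_map.A (\<lambda>j. avoiding (I j) \<pi> W) (\<lambda>j. smap (I j) \<pi> (insert w \<pi>))) (\<lambda>j. d j \<pi>) j"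
proof -
  interpret surjective_cochain_map "\<lambda>j. avoiding (I j) \<pi> W" "\<lambda>j. avoiding (I j) (insert w \<pi>) W"
    "\<lambda>j. d j \<pi>" "\<lambda>j. d j (insert w \<pi>)" "\<lambda>j. smap (I j) \<pi> (insert w \<pi>)"
    by (rule surjective_restriction[OF assms])
  have "A = (\<lambda>j. avoiding (I j) \<pi> (insert w W))"
    by (rule ext) (simp add: A_def avoiding_insert(1)[OF \<pi>(2)])
  then show ?thesis by (simp add: ext_dim_def)
qed

lemma ext_dim_insert:
  assumes \<pi>: "\<pi> \<in> K" "insert w \<pi> \<in> K" and disj: "W \<inter> insert w \<pi> = {}"
  shows "ext_dim \<pi> (insert w W) 0 \<le> ext_dim \<pi> W 0"
    "ext_dim \<pi> (insert w W) (Suc j) \<le> ext_dim \<pi> W (Suc j) + ext_dim (insert w \<pi>) W j"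
    "ext_dim \<pi> W (Suc j) + ext_dim (insert w \<pi>) W j - ext_dim (insert w \<pi>) W (Suc j) - ext_dim \<pi> W j
       \<le> ext_dim \<pi> (insert w W) (Suc j)"
proof -
  interpret surjective_cochain_map "\<lambda>j. avoiding (I j) \<pi> W" "\<lambda>j. avoiding (I j) (insert w \<pi>) W"
    "\<lambda>j. d j \<pi>" "\<lambda>j. d j (insert w \<pi>)" "\<lambda>j. smap (I j) \<pi> (insert w \<pi>)"
    by (rule surjective_restriction[OF assms])
  note k = kernel_complex[OF assms]
  show "ext_dim \<pi> (insert w W) 0 \<le> ext_dim \<pi> W 0"
    unfolding k using cohomology_dim_A_0_le by (simp add: ext_dim_def)
  show "ext_dim \<pi> (insert w W) (Suc j) \<le> ext_dim \<pi> W (Suc j) + ext_dim (insert w \<pi>) W j"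
    unfolding k using cohomology_dim_A_Suc_le[of j] by (simp add: ext_dim_def)
  show "ext_dim \<pi> W (Suc j) + ext_dim (insert w \<pi>) W j - ext_dim (insert w \<pi>) W (Suc j) - ext_dim \<pi> W j
       \<le> ext_dim \<pi> (insert w W) (Suc j)"
    unfolding k using cohomology_dim_A_Suc_ge[of j] by (simp add: ext_dim_def)
qed

lemma ext_dim_insert_nonface: "insert w \<pi> \<notin> K \<Longrightarrow> ext_dim \<pi> (insert w W) j = ext_dim \<pi> W j"
  by (simp add: ext_dim_def avoiding_insert(2))

lemma ext_dim_nonneg: "\<pi> \<in> K \<Longrightarrow> 0 \<le> ext_dim \<pi> W j"
  unfolding ext_dim_def by (rule cochain_complex.cohomology_dim_nonneg[OF cochain_complex_avoiding])

lemma ker_d0: "\<pi> \<in> K \<Longrightarrow> ker_at (I 0) (d 0) \<pi> = \<epsilon> \<pi> ` line"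
  using resD(6) by (simp add: im_at_def const_sheaf_def)

lemma \<epsilon>_restrict: "\<pi> \<in> K \<Longrightarrow> \<tau> \<in> K \<Longrightarrow> \<pi> \<subseteq> \<tau> \<Longrightarrow> x \<in> line \<Longrightarrow> smap (I 0) \<pi> \<tau> (\<epsilon> \<pi> x) = \<epsilon> \<tau> x"
  using nat_transD(3)[OF inj_transD(1)[OF resD(4)], of \<pi> \<tau> x] by (simp add: const_sheaf_def)

lemma \<epsilon>_linear: "\<pi> \<in> K \<Longrightarrow> linear_map line (stalk (I 0) \<pi>) (\<epsilon> \<pi>)"
  using nat_transD(1)[OF inj_transD(1)[OF resD(4)], of \<pi>] by (simp add: const_sheaf_def)

lemma \<epsilon>_inj: "\<pi> \<in> K \<Longrightarrow> inj_on (\<epsilon> \<pi>) line"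
  using inj_transD(2)[OF resD(4), of \<pi>] by (simp add: const_sheaf_def)

lemma \<epsilon>_eq_0: "\<pi> \<in> K \<Longrightarrow> x \<in> line \<Longrightarrow> \<epsilon> \<pi> x = 0 \<Longrightarrow> x = 0"
  using linear_map_inj_iff[OF \<epsilon>_linear fd_spaceD[OF fd_line]] \<epsilon>_inj by blast

text \<open>The stalks of the resolution at \<open>\<pi>\<close> form an exact sequence that starts with the line.\<close>

lemma ext_dim_empty:
  assumes \<pi>: "\<pi> \<in> K"
  shows "ext_dim \<pi> {} j = (if j = 0 then 1 else 0)"
proof (cases j)
  case 0
  have "coord.dim (cocycles (\<lambda>j. stalk (I j) \<pi>) (\<lambda>j. d j \<pi>) 0) = coord.dim (\<epsilon> \<pi> ` line)"
    using ker_d0[OF \<pi>] by (simp add: cocycles_def ker_at_def)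
  also have "\<dots> = 1" using dim_inj_image[OF \<epsilon>_linear[OF \<pi>] fd_line \<epsilon>_inj[OF \<pi>]] dim_line by simp
  finally show ?thesis
    using cochain_complex.cohomology_dim_0[OF cochain_complex_avoiding[OF \<pi>, of "{}"]] 0
    by (simp add: ext_dim_def)
next
  case (Suc i)
  then show ?thesis using resD(7)[OF \<pi>, of i]
    by (simp add: ext_dim_def cohomology_dim_def cocycles_def coboundaries_def ker_at_def im_at_def)
qed

text \<open>A coface of \<open>\<pi>\<close> is recorded by the set of its new vertices.\<close>

definition cofaces :: "'v set \<Rightarrow> 'v set \<Rightarrow> nat \<Rightarrow> 'v set set" where
  "cofaces \<pi> W j = {A. A \<subseteq> W \<and> card A = j \<and> \<pi> \<union> A \<in> K}"

lemma finite_cofaces: "finite W \<Longrightarrow> finite (cofaces \<pi> W j)"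
  by (rule finite_subset[of _ "Pow W"]) (auto simp: cofaces_def)

text \<open>A set of new vertices inside \<open>W + w\<close> either avoids \<open>w\<close> and is counted for \<open>(\<pi>, W)\<close>, or contains \<open>w\<close>
  and is counted, with one element less, for \<open>(\<pi> + w, W)\<close>.  So the number of cofaces obeys
  the recursion that bounds \<open>ext_dim\<close>.\<close>

lemma ext_dim_le_card_cofaces:
  assumes "finite W" "\<pi> \<in> K" "W \<inter> \<pi> = {}"
  shows "ext_dim \<pi> W j \<le> int (card (cofaces \<pi> W j))"
  using assms
proof (induction W arbitrary: \<pi> j rule: finite_induct)
  case empty
  have "cofaces \<pi> {} j = (if j = 0 then {{}} else {})" using empty by (auto simp: cofaces_def)
  then show ?case using ext_dim_empty[OF empty(1)] by simp
next
  case (insert w W)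
  have fin: "finite (cofaces \<pi> (insert w W) j)" for j using finite_cofaces insert.hyps(1) by simp
  have mono: "card (cofaces \<pi> W j) \<le> card (cofaces \<pi> (insert w W) j)" for j
    by (rule card_mono[OF fin]) (auto simp: cofaces_def)
  have IH: "ext_dim \<pi> W j \<le> int (card (cofaces \<pi> W j))" for j using insert by blast
  show ?case
  proof (cases "insert w \<pi> \<in> K")
    case False
    then show ?thesis using ext_dim_insert_nonface[OF False] IH[of j] mono[of j] by simp
  next
    case True
    have disj: "W \<inter> insert w \<pi> = {}" using insert by blast
    show ?thesis
    proof (cases j)
      case 0
      then show ?thesis using ext_dim_insert(1)[OF insert.prems(1) True disj] IH[of 0] mono[of 0] by simp
    next
      case (Suc i)
      have IH': "ext_dim (insert w \<pi>) W i \<le> int (card (cofaces (insert w \<pi>) W i))"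
        using insert.IH[OF True] disj by blast
      let ?X = "cofaces \<pi> W j" and ?Y = "insert w ` cofaces (insert w \<pi>) W i"
      have inj: "inj_on (insert w) (cofaces (insert w \<pi>) W i)"
        using insert.hyps(2) by (intro inj_onI) (auto simp: cofaces_def)
      have "card ?X + card (cofaces (insert w \<pi>) W i) = card ?X + card ?Y" using card_image[OF inj] by simp
      also have "\<dots> = card (?X \<union> ?Y)"
        using insert.hyps finite_cofaces by (intro card_Un_disjoint[symmetric]) (auto simp: cofaces_def)
      also have "\<dots> \<le> card (cofaces \<pi> (insert w W) j)"
      proof (rule card_mono[OF fin])
        have "insert w A \<in> cofaces \<pi> (insert w W) j" if A: "A \<in> cofaces (insert w \<pi>) W i" for A
        proof -
          have "finite A" "w \<notin> A" using A insert.hyps finite_subset by (auto simp: cofaces_def)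
          then show ?thesis using A Suc by (auto simp: cofaces_def)
        qed
        then show "?X \<union> ?Y \<subseteq> cofaces \<pi> (insert w W) j" by (auto simp: cofaces_def)
      qed
      finally show ?thesis
        using ext_dim_insert(2)[OF insert.prems(1) True disj, of i] IH[of j] IH' Suc by simp
    qed
  qed
qed

text \<open>The long exact sequence compares the stalk complexes at \<open>\<pi>\<close> and at \<open>\<pi> + w\<close>.  Both have only \<open>H\<^sup>0\<close>,
  and restriction identifies it, so all cohomology of the kernel vanishes.\<close>

lemma ext_dim_singleton_le_0:
  assumes \<pi>: "\<pi> \<in> K" "insert w \<pi> \<in> K"
  shows "ext_dim \<pi> {w} j \<le> 0"
proof -
  have disj: "{} \<inter> insert w \<pi> = {}" by simp
  interpret surjective_cochain_map "\<lambda>j. avoiding (I j) \<pi> {}" "\<lambda>j. avoiding (I j) (insert w \<pi>) {}"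
    "\<lambda>j. d j \<pi>" "\<lambda>j. d j (insert w \<pi>)" "\<lambda>j. smap (I j) \<pi> (insert w \<pi>)"
    by (rule surjective_restriction[OF \<pi> disj])
  note k = kernel_complex[OF \<pi> disj]
  consider "j = 0" | "j = 1" | i where "j = Suc (Suc i)" by (metis One_nat_def not0_implies_Suc)
  then show ?thesis
  proof cases
    case 1
    have "x = 0" if x: "x \<in> cocycles (\<lambda>j. avoiding (I j) \<pi> {w}) (\<lambda>j. d j \<pi>) 0" for x
    proof -
      have "x \<in> ker_at (I 0) (d 0) \<pi>" "smap (I 0) \<pi> (insert w \<pi>) x = 0"
        using x \<pi> by (auto simp: cocycles_def avoiding_def ker_at_def)
      then obtain y where y: "y \<in> line" "x = \<epsilon> \<pi> y" using ker_d0[OF \<pi>(1)] by auto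
      then have "\<epsilon> (insert w \<pi>) y = 0"
        using \<open>smap (I 0) \<pi> (insert w \<pi>) x = 0\<close> \<epsilon>_restrict[OF \<pi> subset_insertI y(1)] by simp
      then show ?thesis
        using y \<epsilon>_eq_0[OF \<pi>(2) y(1)] linear_map_zero[OF \<epsilon>_linear[OF \<pi>(1)] fd_spaceD[OF fd_line]] by simp
    qed
    then have "cocycles (\<lambda>j. avoiding (I j) \<pi> {w}) (\<lambda>j. d j \<pi>) 0 \<subseteq> coord.span {}" by auto
    from coord.dim_le_card[OF this] have "coord.dim (cocycles (\<lambda>j. avoiding (I j) \<pi> {w}) (\<lambda>j. d j \<pi>) 0) = 0"
      by simp
    then show ?thesis using 1 cochain_complex.cohomology_dim_0[OF cochain_complex_avoiding[OF \<pi>(1), of "{w}"]]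
      by (simp add: ext_dim_def)
  next
    case 2
    have "cocycles (\<lambda>j. avoiding (I j) (insert w \<pi>) {}) (\<lambda>j. d j (insert w \<pi>)) 0
      \<subseteq> smap (I 0) \<pi> (insert w \<pi>) ` cocycles (\<lambda>j. avoiding (I j) \<pi> {}) (\<lambda>j. d j \<pi>) 0"
    proof
      fix z assume "z \<in> cocycles (\<lambda>j. avoiding (I j) (insert w \<pi>) {}) (\<lambda>j. d j (insert w \<pi>)) 0"
      then have "z \<in> ker_at (I 0) (d 0) (insert w \<pi>)" by (simp add: cocycles_def ker_at_def)
      then obtain y where y: "y \<in> line" "z = \<epsilon> (insert w \<pi>) y" using ker_d0[OF \<pi>(2)] by auto
      have "\<epsilon> \<pi> y \<in> ker_at (I 0) (d 0) \<pi>" using ker_d0[OF \<pi>(1)] y by simp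
      then have "\<epsilon> \<pi> y \<in> cocycles (\<lambda>j. avoiding (I j) \<pi> {}) (\<lambda>j. d j \<pi>) 0" by (simp add: cocycles_def ker_at_def)
      moreover have "z = smap (I 0) \<pi> (insert w \<pi>) (\<epsilon> \<pi> y)" using \<epsilon>_restrict[OF \<pi> subset_insertI y(1)] y by simp
      ultimately show "z \<in> smap (I 0) \<pi> (insert w \<pi>) ` cocycles (\<lambda>j. avoiding (I j) \<pi> {}) (\<lambda>j. d j \<pi>) 0" by blast
    qed
    from cohomology_dim_A_1_le[OF this] show ?thesis
      using 2 k[of 1] ext_dim_empty[OF \<pi>(1), of 1] by (simp add: ext_dim_def)
  next
    case 3
    then show ?thesis
      using ext_dim_insert(2)[OF \<pi> disj, of "Suc i"] ext_dim_empty[OF \<pi>(1)] ext_dim_empty[OF \<pi>(2)] by simp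
  qed
qed

text \<open>The part of the link of \<open>\<pi>\<close> spanned by \<open>W\<close> is a skeleton of a simplex, so its reduced cohomology
  can only live in the top degree.  The vanishing in lower degrees removes the last error term of the lower bound in
  \<open>ext_dim_insert\<close>; the other one vanishes because there are no simplices above the
  dimension \<open>k\<close>.  The remaining inequality is Pascal's rule.\<close>

lemma ext_dim_skeleton:
  assumes skel: "\<And>\<tau>. \<tau> \<in> K \<longleftrightarrow> \<tau> \<subseteq> V \<and> \<tau> \<noteq> {} \<and> card \<tau> \<le> Suc k"
    and W: "finite W" "W \<noteq> {}" "\<pi> \<in> K" "W \<subseteq> V - \<pi>"
  shows "(i + card \<pi> \<le> k \<longrightarrow> ext_dim \<pi> W i \<le> 0) \<and>
    (i + card \<pi> = Suc k \<longrightarrow> int ((card W - 1) choose i) \<le> ext_dim \<pi> W i)"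
  using W
proof (induction W arbitrary: \<pi> i rule: finite_ne_induct)
  case (singleton w)
  then have w: "w \<notin> \<pi>" and fin: "finite \<pi>" using simplex_finite by auto
  have in_K: "insert w \<pi> \<in> K \<longleftrightarrow> card \<pi> \<le> k" using singleton w fin by (auto simp: skel)
  show ?case
  proof (cases "insert w \<pi> \<in> K")
    case True
    then show ?thesis
      using ext_dim_singleton_le_0[OF singleton(1) True] ext_dim_nonneg[OF singleton(1)] in_K by (cases i) auto
  next
    case False
    then show ?thesis
      using ext_dim_insert_nonface[OF False] ext_dim_empty[OF singleton(1)] in_K by (cases i) auto
  qed
next
  case (insert w W)
  then have w: "w \<notin> \<pi>" and fin: "finite \<pi>" using simplex_finite by auto
  have in_K: "insert w \<pi> \<in> K \<longleftrightarrow> card \<pi> \<le> k" using insert.prems w fin by (auto simp: skel)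
  have cW: "card W = Suc (card W - 1)" using insert.hyps by (simp add: card_gt_0_iff)
  have IH: "i + card \<pi> \<le> k \<Longrightarrow> ext_dim \<pi> W i \<le> 0"
    "i + card \<pi> = Suc k \<Longrightarrow> int ((card W - 1) choose i) \<le> ext_dim \<pi> W i" for i
    using insert.IH[of \<pi> i] insert.prems by blast+
  show ?case
  proof (cases "card \<pi> \<le> k")
    case False
    then have "insert w \<pi> \<notin> K" using in_K by simp
    then show ?thesis using ext_dim_insert_nonface IH[of i] False by (cases i) auto
  next
    case True
    then have wK: "insert w \<pi> \<in> K" using in_K by simp
    have disj: "W \<inter> insert w \<pi> = {}" using insert by blast
    have c: "card (insert w \<pi>) = Suc (card \<pi>)" using w fin by simp
    have "W \<subseteq> V - insert w \<pi>" using insert by blast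
    then have IH': "i + Suc (card \<pi>) \<le> k \<Longrightarrow> ext_dim (insert w \<pi>) W i \<le> 0"
      "i + Suc (card \<pi>) = Suc k \<Longrightarrow> int ((card W - 1) choose i) \<le> ext_dim (insert w \<pi>) W i" for i
      using insert.IH[OF wK, of i] c by auto
    note ins = ext_dim_insert[OF insert.prems(1) wK disj]
    show ?thesis
    proof (cases i)
      case 0
      then show ?thesis using ins(1) IH(1)[of 0] True by simp
    next
      case (Suc i')
      have upper: "ext_dim \<pi> (insert w W) i \<le> 0" if "i + card \<pi> \<le> k"
        using ins(2)[of i'] IH(1)[of i] IH'(1)[of i'] that Suc by simp
      have lower: "int (card W choose i) \<le> ext_dim \<pi> (insert w W) i" if i: "i + card \<pi> = Suc k"
      proof -
        have "card (insert w \<pi> \<union> A) = Suc (Suc k)" if A: "A \<subseteq> W" "card A = i" for A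
        proof -
          have "finite A" using A insert.hyps finite_subset by blast
          moreover have "insert w \<pi> \<inter> A = {}" using disj A by blast
          ultimately show ?thesis using card_Un_disjoint[of "insert w \<pi>" A] fin c A i by simp
        qed
        \<comment> \<open>Simplices of the complex have at most k + 1 vertices.\<close>
        then have "cofaces (insert w \<pi>) W i = {}" by (auto simp: cofaces_def skel)
        then have "ext_dim (insert w \<pi>) W i \<le> 0"
          using ext_dim_le_card_cofaces[OF insert.hyps(1) wK disj, of i] by simp
        moreover have "card W choose i = ((card W - 1) choose i) + ((card W - 1) choose i')"
          using cW Suc by (metis add.commute binomial_Suc_Suc)
        ultimately show ?thesis
          using ins(3)[of i'] IH(2)[of i] IH(1)[of i'] IH'(2)[of i'] i Suc by simp
      qed
      show ?thesis using upper lower insert.hyps by simp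
    qed
  qed
qed

end

text \<open>In a resolution whose differentials vanish on socles, the complex of socles is its own cohomology.\<close>

lemma const_mult_eq_ext_dim:
  fixes K :: "'v set set"
  assumes K: "finite_simplicial_complex K"
  obtains I :: "nat \<Rightarrow> ('v set, 'k::field) sheaf" and \<epsilon> d where "const_resolution K I \<epsilon> d"
    "\<And>\<pi> j. \<pi> \<in> K \<Longrightarrow> int (const_mult TYPE('k) K j \<pi>) = const_resolution.ext_dim K I d \<pi> (\<Union>K - \<pi>) j"
proof -
  interpret simplicial_poset K by unfold_locales (rule K)
  obtain J :: "nat \<Rightarrow> ('v set, 'k) sheaf" and \<eta> e where J: "socle_resolution K const_sheaf J \<eta> e"
    using exists_socle_resolution[OF finite_K is_sheaf_const] by blast
  interpret R: const_resolution K J \<eta> e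
    by unfold_locales (use J in \<open>simp add: socle_resolution_def\<close>)
  have "int (const_mult TYPE('k) K j \<pi>) = R.ext_dim \<pi> (\<Union>K - \<pi>) j" if \<pi>: "\<pi> \<in> K" for \<pi> j
  proof -
    have eq: "avoiding (J j) \<pi> (\<Union>K - \<pi>) = socle K (J j) \<pi>" for j
      using avoiding_all_vertices[OF R.resD(3) \<pi>] .
    have d0: "e j \<pi> x = 0" if "x \<in> socle K (J j) \<pi>" for j x
      using J \<pi> that by (auto simp: socle_resolution_def ker_at_def)
    have "cocycles (\<lambda>j. socle K (J j) \<pi>) (\<lambda>j. e j \<pi>) j = socle K (J j) \<pi>"
      using d0 by (auto simp: cocycles_def)
    moreover have "coboundaries (\<lambda>j. socle K (J j) \<pi>) (\<lambda>j. e j \<pi>) j \<subseteq> coord.span {}"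
      using d0 by (auto simp: coboundaries_def split: nat.splits)
    then have "coord.dim (coboundaries (\<lambda>j. socle K (J j) \<pi>) (\<lambda>j. e j \<pi>) j) = 0"
      using coord.dim_le_card[of "coboundaries (\<lambda>j. socle K (J j) \<pi>) (\<lambda>j. e j \<pi>) j" "{}"] by simp
    ultimately have "R.ext_dim \<pi> (\<Union>K - \<pi>) j = int (coord.dim (socle K (J j) \<pi>))"
      by (simp add: R.ext_dim_def cohomology_dim_def eq)
    then show ?thesis
      unfolding const_mult_def using dim_socle_min_inj_res[OF finite_K J \<pi>, of j] by simp
  qed
  then show ?thesis using that[OF R.const_resolution_axioms] by blast
qed

section \<open>The upper bound\<close>

lemma const_mult_le_card_cofaces:
  fixes K :: "'v set set"
  assumes K: "finite_simplicial_complex K" and \<pi>: "\<pi> \<in> K"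
  shows "const_mult TYPE('k::field) K j \<pi> \<le> card {A. A \<subseteq> \<Union>K - \<pi> \<and> card A = j \<and> \<pi> \<union> A \<in> K}"
proof -
  obtain I :: "nat \<Rightarrow> ('v set, 'k) sheaf" and \<epsilon> d where res: "const_resolution K I \<epsilon> d"
    and eq: "\<And>\<pi> j. \<pi> \<in> K \<Longrightarrow> int (const_mult TYPE('k) K j \<pi>) = const_resolution.ext_dim K I d \<pi> (\<Union>K - \<pi>) j"
    using const_mult_eq_ext_dim[OF K] by blast
  interpret const_resolution K I \<epsilon> d by (rule res)
  have "finite (\<Union>K - \<pi>)" using finite_K simplex_finite by blast
  from ext_dim_le_card_cofaces[OF this \<pi>, of j] show ?thesis
    using eq[OF \<pi>, of j] by (simp add: cofaces_def Int_commute)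
qed

text \<open>Double counting of the pairs \<open>\<pi> \<le> \<tau>\<close> in the star of \<open>\<sigma>\<close> with \<open>\<tau>\<close> of codimension \<open>j\<close> over \<open>\<pi>\<close>: given \<open>\<tau>\<close>,
  the simplex \<open>\<pi>\<close> is determined by the set \<open>\<tau> - \<pi>\<close> of \<open>j\<close> vertices of \<open>\<tau>\<close> outside \<open>\<sigma>\<close>.\<close>

lemma star_mult_le:
  fixes K :: "'v set set"
  assumes K: "finite_simplicial_complex K" and \<sigma>: "\<sigma> \<in> K" and k: "k = complex_dim K - simplex_dim \<sigma>"
  shows "star_mult TYPE('k::field) K j \<sigma> \<le> card (star K \<sigma>) * (k choose j)"
proof -
  interpret simplicial_poset K by unfold_locales (rule K)
  have fin_star: "finite (star K \<sigma>)" using finite_K by (simp add: star_def)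
  let ?C = "\<lambda>\<pi>. {A. A \<subseteq> \<Union>K - \<pi> \<and> card A = j \<and> \<pi> \<union> A \<in> K}"
  let ?D = "\<lambda>\<tau>. {A. A \<subseteq> \<tau> - \<sigma> \<and> card A = j}"
  have fin_V: "finite (\<Union>K)" using finite_K simplex_finite by blast
  have fin_C: "finite (?C \<pi>)" for \<pi>
    by (rule finite_subset[of _ "Pow (\<Union>K)"]) (use fin_V in auto)
  have fin_D: "finite (?D \<tau>)" if "\<tau> \<in> star K \<sigma>" for \<tau>
    by (rule finite_subset[of _ "Pow \<tau>"]) (use that simplex_finite in \<open>auto simp: star_def\<close>)
  have "star_mult TYPE('k) K j \<sigma> \<le> (\<Sum>\<pi>\<in>star K \<sigma>. card (?C \<pi>))"
    unfolding star_mult_def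
    by (rule sum_mono) (rule const_mult_le_card_cofaces[OF K], simp add: star_def)
  also have "\<dots> = card (SIGMA \<pi>:star K \<sigma>. ?C \<pi>)"
    using fin_star fin_C by (simp add: card_SigmaI)
  also have "\<dots> \<le> card (SIGMA \<tau>:star K \<sigma>. ?D \<tau>)"
  proof (rule card_inj_on_le)
    show "inj_on (\<lambda>(\<pi>, A). (\<pi> \<union> A, A)) (SIGMA \<pi>:star K \<sigma>. ?C \<pi>)"
      by (rule inj_onI) auto
    show "(\<lambda>(\<pi>, A). (\<pi> \<union> A, A)) ` (SIGMA \<pi>:star K \<sigma>. ?C \<pi>) \<subseteq> (SIGMA \<tau>:star K \<sigma>. ?D \<tau>)"
      by (auto simp: star_def)
    show "finite (SIGMA \<tau>:star K \<sigma>. ?D \<tau>)" using fin_star fin_D by blast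
  qed
  also have "\<dots> = (\<Sum>\<tau>\<in>star K \<sigma>. card (?D \<tau>))"
    using fin_star fin_D by (simp add: card_SigmaI)
  also have "\<dots> \<le> (\<Sum>\<tau>\<in>star K \<sigma>. k choose j)"
  proof (rule sum_mono)
    fix \<tau> assume "\<tau> \<in> star K \<sigma>"
    then have \<tau>: "\<tau> \<in> K" "\<sigma> \<subseteq> \<tau>" by (auto simp: star_def)
    have "simplex_dim \<tau> \<le> complex_dim K"
      unfolding complex_dim_def using finite_K \<tau> by simp
    moreover have "card \<sigma> > 0" using simplex_finite[OF \<sigma>] simplex_nonempty[OF \<sigma>] by (simp add: card_gt_0_iff)
    moreover have "card (\<tau> - \<sigma>) = card \<tau> - card \<sigma>"
      using \<tau> simplex_finite[OF \<sigma>] by (simp add: card_Diff_subset)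
    ultimately have "card (\<tau> - \<sigma>) \<le> k" unfolding k simplex_dim_def by linarith
    moreover have "card (?D \<tau>) = card (\<tau> - \<sigma>) choose j"
      using simplex_finite[OF \<tau>(1)] by (simp add: n_subsets)
    ultimately show "card (?D \<tau>) \<le> k choose j" using binomial_right_mono by simp
  qed
  finally show ?thesis by simp
qed

lemma star_complexity_le:
  fixes K :: "'v set set"
  assumes K: "finite_simplicial_complex K" and \<sigma>: "\<sigma> \<in> K" and k: "k = complex_dim K - simplex_dim \<sigma>"
  shows "star_complexity TYPE('k::field) K j \<sigma> \<le> real (k choose j)"
proof -
  have "finite K" using K by (simp add: finite_simplicial_complex_def)
  then have "finite (star K \<sigma>)" "\<sigma> \<in> star K \<sigma>" using \<sigma> by (auto simp: star_def)
  then have "0 < real (card (star K \<sigma>))" by (auto simp: card_gt_0_iff)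
  moreover have "real (star_mult TYPE('k) K j \<sigma>) \<le> real (k choose j) * real (card (star K \<sigma>))"
    using of_nat_mono[OF star_mult_le[OF assms, of j, where ?'k = 'k], where ?'a = real] by (simp add: mult.commute)
  ultimately show ?thesis by (simp add: star_complexity_def divide_le_eq)
qed

section \<open>Skeleta of simplices\<close>

lemma mem_skeleton: "\<tau> \<in> skeleton k (full_simplex n) \<longleftrightarrow> \<tau> \<subseteq> {0..n} \<and> \<tau> \<noteq> {} \<and> card \<tau> \<le> Suc k"
  by (auto simp: skeleton_def full_simplex_def simplex_dim_def)

lemma skeleton_complex: "finite_simplicial_complex (skeleton k (full_simplex n))"
proof -
  have "finite (skeleton k (full_simplex n))"
    by (rule finite_subset[of _ "Pow {0..n}"]) (use mem_skeleton[of _ k n] in blast, simp)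
  moreover have fin: "finite \<sigma>" if "\<sigma> \<in> skeleton k (full_simplex n)" for \<sigma>
    using that finite_subset[of \<sigma> "{0..n}"] by (simp add: mem_skeleton)
  moreover have "\<tau> \<in> skeleton k (full_simplex n)"
    if \<sigma>: "\<sigma> \<in> skeleton k (full_simplex n)" and \<tau>: "\<tau> \<subseteq> \<sigma>" "\<tau> \<noteq> {}" for \<sigma> \<tau>
  proof -
    have "card \<tau> \<le> card \<sigma>" using fin[OF \<sigma>] \<tau>(1) by (rule card_mono)
    then show ?thesis using \<sigma> \<tau> order_trans[OF \<tau>(1)] unfolding mem_skeleton by simp
  qed
  moreover have "\<sigma> \<noteq> {}" if "\<sigma> \<in> skeleton k (full_simplex n)" for \<sigma>
    using that unfolding mem_skeleton by simp
  ultimately show ?thesis unfolding finite_simplicial_complex_def by blast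
qed

lemma complex_dim_skeleton:
  assumes "k \<le> n"
  shows "complex_dim (skeleton k (full_simplex n)) = k"
  unfolding complex_dim_def
proof (rule Max_eqI)
  show "finite (simplex_dim ` skeleton k (full_simplex n))"
    using skeleton_complex by (auto simp: finite_simplicial_complex_def)
  show "y \<le> k" if "y \<in> simplex_dim ` skeleton k (full_simplex n)" for y
    using that by (auto simp: skeleton_def)
  have "{0..k} \<in> skeleton k (full_simplex n)" using assms by (auto simp: mem_skeleton)
  then show "k \<in> simplex_dim ` skeleton k (full_simplex n)" by (force simp: simplex_dim_def)
qed

text \<open>The link of \<open>\<pi>\<close> has \<open>n + 1 - card \<pi>\<close> vertices, and the bound has one vertex less, as for the reduced
  cohomology of a skeleton.\<close>

lemma const_mult_skeleton_ge:
  assumes \<pi>: "\<pi> \<in> skeleton k (full_simplex n)" and card: "j + card \<pi> = Suc k" and n: "k < n"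
  shows "(n - card \<pi>) choose j \<le> const_mult TYPE('k::field) (skeleton k (full_simplex n)) j \<pi>"
proof -
  let ?K = "skeleton k (full_simplex n)"
  obtain I :: "nat \<Rightarrow> (nat set, 'k) sheaf" and \<epsilon> d where res: "const_resolution ?K I \<epsilon> d"
    and eq: "\<And>\<pi> j. \<pi> \<in> ?K \<Longrightarrow> int (const_mult TYPE('k) ?K j \<pi>) = const_resolution.ext_dim ?K I d \<pi> (\<Union>?K - \<pi>) j"
    using const_mult_eq_ext_dim[OF skeleton_complex] by blast
  interpret const_resolution ?K I \<epsilon> d by (rule res)
  have "{x} \<in> ?K" if "x \<le> n" for x using that by (auto simp: mem_skeleton)
  then have "{0..n} \<subseteq> \<Union>?K" by fastforce
  then have V: "\<Union>?K = {0..n}" using mem_skeleton[of _ k n] by blast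
  have \<pi>V: "\<pi> \<subseteq> {0..n}" using \<pi> by (simp add: mem_skeleton)
  then have cW: "card ({0..n} - \<pi>) = Suc n - card \<pi>" by (simp add: card_Diff_subset finite_subset)
  then have "{0..n} - \<pi> \<noteq> {}" using card n by (intro notI) simp
  from ext_dim_skeleton[OF mem_skeleton _ this \<pi>, of j]
  have "int ((card ({0..n} - \<pi>) - 1) choose j) \<le> ext_dim \<pi> ({0..n} - \<pi>) j" using card by simp
  moreover have "card ({0..n} - \<pi>) - 1 = n - card \<pi>" using cW by simp
  ultimately show ?thesis using eq[OF \<pi>, of j] V by simp
qed

text \<open>Only the simplices of dimension \<open>k - j\<close> are counted in the star; for these, the degree \<open>j\<close> is the top
  degree of the link.\<close>

lemma star_complexity_skeleton_ge:
  assumes v: "{v} \<in> skeleton k (full_simplex n)" and j: "j \<le> k" and n: "k < n"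
  shows "real (n choose (k - j)) * real ((n - Suc (k - j)) choose j) / (\<Sum>i\<le>k. real (n choose i))
    \<le> star_complexity TYPE('k::field) (skeleton k (full_simplex n)) j {v}"
proof -
  let ?K = "skeleton k (full_simplex n)"
  have vn: "v \<le> n" using v by (simp add: mem_skeleton)
  let ?N = "\<lambda>i. {A. A \<subseteq> {0..n} - {v} \<and> card A = i}"
  have fin: "finite (?N i)" for i by (rule finite_subset[of _ "Pow {0..n}"]) auto
  have card_N: "card (?N i) = n choose i" for i using vn by (simp add: n_subsets)
  have star: "star ?K {v} \<subseteq> insert v ` (\<Union>i\<le>k. ?N i)"
  proof
    fix \<tau> assume "\<tau> \<in> star ?K {v}"
    then have \<tau>: "\<tau> \<subseteq> {0..n}" "v \<in> \<tau>" "card \<tau> \<le> Suc k" by (auto simp: star_def mem_skeleton)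
    have "card (\<tau> - {v}) \<le> k" using \<tau> by (simp add: finite_subset)
    then have "\<tau> - {v} \<in> (\<Union>i\<le>k. ?N i)" using \<tau>(1) by blast
    moreover have "\<tau> = insert v (\<tau> - {v})" using \<tau>(2) by blast
    ultimately show "\<tau> \<in> insert v ` (\<Union>i\<le>k. ?N i)" by (rule image_eqI[rotated])
  qed
  have "card (star ?K {v}) \<le> card (insert v ` (\<Union>i\<le>k. ?N i))"
    by (rule card_mono[OF _ star]) (use fin in auto)
  also have "\<dots> \<le> card (\<Union>i\<le>k. ?N i)" by (rule card_image_le) (use fin in auto)
  also have "\<dots> \<le> (\<Sum>i\<le>k. n choose i)" using card_UN_le[of "{..k}" ?N] card_N by simp
  finally have card_star: "real (card (star ?K {v})) \<le> (\<Sum>i\<le>k. real (n choose i))"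
    by (metis of_nat_le_iff of_nat_sum)
  have fin_star: "finite (star ?K {v})"
    using skeleton_complex[of k n] by (simp add: star_def finite_simplicial_complex_def)
  have "{v} \<in> star ?K {v}" using v by (simp add: star_def)
  then have pos: "0 < real (card (star ?K {v}))" using fin_star by (auto simp: card_gt_0_iff)
  let ?P = "insert v ` ?N (k - j)"
  have memP: "\<pi> \<in> star ?K {v} \<and> card \<pi> = Suc (k - j)" if \<pi>: "\<pi> \<in> ?P" for \<pi>
  proof -
    from \<pi> obtain A where A3: "\<pi> = insert v A" and "A \<in> ?N (k - j)" by (rule imageE)
    then have A: "A \<subseteq> {0..n} - {v}" "card A = k - j" by (simp_all only: mem_Collect_eq)
    then have "finite A" "v \<notin> A" using finite_subset[OF A(1)] by auto
    then have "card \<pi> = Suc (k - j)" using A(2) A3 by simp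
    moreover have "v \<in> {0..n}" using vn by simp
    then have "\<pi> \<subseteq> {0..n}" using A(1) A3 by blast
    ultimately show ?thesis using A3 j by (simp add: star_def mem_skeleton)
  qed
  have "inj_on (insert v) (?N (k - j))"
  proof (rule inj_onI)
    fix A B assume "A \<in> ?N (k - j)" "B \<in> ?N (k - j)" "insert v A = insert v B"
    then have "v \<notin> A" "v \<notin> B" by blast+
    then show "A = B" using \<open>insert v A = insert v B\<close> by (simp add: insert_ident)
  qed
  then have "(n choose (k - j)) * ((n - Suc (k - j)) choose j) = (\<Sum>\<pi>\<in>?P. (n - Suc (k - j)) choose j)"
    using card_N by (simp add: card_image)
  also have "\<dots> \<le> (\<Sum>\<pi>\<in>?P. const_mult TYPE('k) ?K j \<pi>)"
  proof (rule sum_mono)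
    fix \<pi> assume "\<pi> \<in> ?P"
    from memP[OF this] have \<pi>: "\<pi> \<in> ?K" "card \<pi> = Suc (k - j)" unfolding star_def by blast+
    show "(n - Suc (k - j)) choose j \<le> const_mult TYPE('k) ?K j \<pi>"
      using const_mult_skeleton_ge[OF \<pi>(1) _ n, of j, where ?'k = 'k] \<pi>(2) j by simp
  qed
  also have "\<dots> \<le> star_mult TYPE('k) ?K j {v}"
    unfolding star_mult_def by (rule sum_mono2[OF fin_star subsetI]) (use memP in blast, simp)
  finally have "real (n choose (k - j)) * real ((n - Suc (k - j)) choose j) \<le> real (star_mult TYPE('k) ?K j {v})"
    using of_nat_mono[where ?'a = real] by fastforce
  then show ?thesis unfolding star_complexity_def
    using card_star pos by (intro frac_le) auto
qed

text \<open>The shift \<open>a\<close> and the truncated subtraction affect only lower order terms.\<close>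

lemma binomial_shift_asymptotics: "(\<lambda>n. real ((n - a) choose j) / real n ^ j) \<longlonglongrightarrow> 1 / fact j"
proof (induction j)
  case (Suc j)
  have "(\<lambda>n. 1 - real (a + j) / real n) \<longlonglongrightarrow> 1 - 0"
    by (intro tendsto_diff tendsto_const lim_const_over_n)
  moreover have "\<forall>\<^sub>F n in sequentially. 1 - real (a + j) / real n = real (n - a - j) / real n"
    using eventually_gt_at_top[of "a + j"] by eventually_elim (auto simp: field_simps of_nat_diff)
  ultimately have "(\<lambda>n. real (n - a - j) / real n) \<longlonglongrightarrow> 1"
    using Lim_transform_eventually by fastforce
  from tendsto_divide[OF tendsto_mult[OF Suc this] tendsto_const[of "real (Suc j)"]]
  have "(\<lambda>n. real ((n - a) choose j) / real n ^ j * (real (n - a - j) / real n) / real (Suc j)) \<longlonglongrightarrow> 1 / fact (Suc j)"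
    by (simp add: mult.commute)
  moreover have "real ((n - a) choose j) / real n ^ j * (real (n - a - j) / real n) / real (Suc j)
      = real ((n - a) choose Suc j) / real n ^ Suc j" for n
  proof -
    have "Suc j * ((n - a) choose Suc j) = (n - a - j) * ((n - a) choose j)"
      unfolding binomial_absorption binomial_absorb_comp by simp
    then have "real (Suc j) * real ((n - a) choose Suc j) = real (n - a - j) * real ((n - a) choose j)"
      by (metis of_nat_mult)
    then have "real ((n - a) choose Suc j) = real ((n - a) choose j) * real (n - a - j) / real (Suc j)"
      by (simp add: eq_divide_eq mult.commute del: of_nat_Suc)
    then show ?thesis by simp
  qed
  ultimately show ?case by simp
qed simp

lemma sum_binomial_asymptotics: "(\<lambda>n. (\<Sum>i\<le>k. real (n choose i)) / real n ^ k) \<longlonglongrightarrow> 1 / fact k"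
proof -
  have "(\<lambda>n. \<Sum>i\<le>k. real (n choose i) / real n ^ k) \<longlonglongrightarrow> (\<Sum>i\<le>k. if i = k then 1 / fact k else 0)"
  proof (rule tendsto_sum)
    fix i assume i: "i \<in> {..k}"
    have c: "(\<lambda>n. real (n choose i) / real n ^ i) \<longlonglongrightarrow> 1 / fact i"
      using binomial_shift_asymptotics[of 0 i] by simp
    show "(\<lambda>n. real (n choose i) / real n ^ k) \<longlonglongrightarrow> (if i = k then 1 / fact k else 0)"
    proof (cases "i = k")
      case False
      then have "k - i > 0" using i by simp
      then have "(\<lambda>n. (1 / real n) ^ (k - i)) \<longlonglongrightarrow> 0 ^ (k - i)"
        by (intro tendsto_power lim_const_over_n)
      from tendsto_mult[OF c this]
      have "(\<lambda>n. real (n choose i) / real n ^ i * (1 / real n) ^ (k - i)) \<longlonglongrightarrow> 0"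
        using \<open>k - i > 0\<close> by (simp add: zero_power)
      moreover have "real (n choose i) / real n ^ i * (1 / real n) ^ (k - i) = real (n choose i) / real n ^ k" for n
        using i by (simp add: power_divide flip: power_add)
      ultimately show ?thesis using False by simp
    qed (use c in simp)
  qed
  then show ?thesis by (simp add: sum_divide_distrib)
qed

text \<open>After division by \<open>n\<^sup>k\<close> the numerator tends to \<open>1 / ((k - j)! j!)\<close> and the denominator to \<open>1 / k!\<close>.\<close>

lemma skeleton_lower_bound_limit:
  assumes "j \<le> k"
  shows "(\<lambda>n. real (n choose (k - j)) * real ((n - Suc (k - j)) choose j) / (\<Sum>i\<le>k. real (n choose i)))
    \<longlonglongrightarrow> real (k choose j)"
proof -
  have p: "(\<lambda>n. real (n choose (k - j)) / real n ^ (k - j)) \<longlonglongrightarrow> 1 / fact (k - j)"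
    using binomial_shift_asymptotics[of 0 "k - j"] by simp
  have "(\<lambda>n. real (n choose (k - j)) / real n ^ (k - j) * (real ((n - Suc (k - j)) choose j) / real n ^ j)
      / ((\<Sum>i\<le>k. real (n choose i)) / real n ^ k)) \<longlonglongrightarrow> 1 / fact (k - j) * (1 / fact j) / (1 / fact k)"
    by (intro tendsto_divide tendsto_mult p binomial_shift_asymptotics sum_binomial_asymptotics) simp
  moreover have "1 / fact (k - j) * (1 / fact j) / (1 / fact k) = real (k choose j)"
    using binomial_fact[OF assms, where ?'a = real] by (simp add: mult.commute)
  moreover have "\<forall>\<^sub>F n in sequentially. real (n choose (k - j)) / real n ^ (k - j) * (real ((n - Suc (k - j)) choose j) / real n ^ j)
      / ((\<Sum>i\<le>k. real (n choose i)) / real n ^ k)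
    = real (n choose (k - j)) * real ((n - Suc (k - j)) choose j) / (\<Sum>i\<le>k. real (n choose i))"
    using eventually_gt_at_top[of 0]
  proof eventually_elim
    fix n :: nat assume "0 < n"
    moreover have "real n ^ (k - j) * real n ^ j = real n ^ k" using assms by (simp flip: power_add)
    ultimately show "real (n choose (k - j)) / real n ^ (k - j) * (real ((n - Suc (k - j)) choose j) / real n ^ j)
      / ((\<Sum>i\<le>k. real (n choose i)) / real n ^ k)
    = real (n choose (k - j)) * real ((n - Suc (k - j)) choose j) / (\<Sum>i\<le>k. real (n choose i))"
      by (simp add: times_divide_times_eq)
  qed
  ultimately show ?thesis using Lim_transform_eventually by fastforce
qed

lemma star_complexity_skeleton_limit:
  assumes v: "\<And>n. {v n} \<in> skeleton k (full_simplex n)"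
  shows "(\<lambda>n. star_complexity TYPE('k::field) (skeleton k (full_simplex n)) j {v n}) \<longlonglongrightarrow> real (k choose j)"
proof -
  let ?S = "\<lambda>n. star_complexity TYPE('k) (skeleton k (full_simplex n)) j {v n}"
  have upper: "?S n \<le> real (k choose j)" if "k \<le> n" for n
    by (rule star_complexity_le[OF skeleton_complex v]) (simp add: complex_dim_skeleton[OF that] simplex_dim_def)
  have up: "\<forall>\<^sub>F n in sequentially. ?S n \<le> real (k choose j)"
    using eventually_ge_at_top[of k] by eventually_elim (rule upper)
  show ?thesis
  proof (cases "j \<le> k")
    case True
    have "\<forall>\<^sub>F n in sequentially. real (n choose (k - j)) * real ((n - Suc (k - j)) choose j) / (\<Sum>i\<le>k. real (n choose i)) \<le> ?S n"
      using eventually_gt_at_top[of k] by eventually_elim (rule star_complexity_skeleton_ge[OF v True])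
    from tendsto_sandwich[OF this up skeleton_lower_bound_limit[OF True] tendsto_const] show ?thesis .
  next
    case False
    then have 0: "k choose j = 0" by simp
    have "\<forall>\<^sub>F n in sequentially. 0 \<le> ?S n" by (simp add: star_complexity_def)
    from tendsto_sandwich[OF this up tendsto_const] have "?S \<longlonglongrightarrow> 0" using 0 by simp
    then show ?thesis unfolding 0 by simp
  qed
qed

theorem proposition32:
  shows "(\<forall>(K :: 'v set set) \<sigma> k j.
            finite_simplicial_complex K \<longrightarrow> \<sigma> \<in> K \<longrightarrow> k = complex_dim K - simplex_dim \<sigma> \<longrightarrow>
            star_complexity TYPE('k::field) K j \<sigma> \<le> real (k choose j)) \<and>
         (\<forall>(k::nat) (j::nat) (v :: nat \<Rightarrow> nat).
            (\<forall>n. {v n} \<in> skeleton k (full_simplex n)) \<longrightarrow>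
            (\<lambda>n. star_complexity TYPE('k) (skeleton k (full_simplex n)) j {v n})
              \<longlonglongrightarrow> real (k choose j))"
  using star_complexity_le star_complexity_skeleton_limit by blast

end
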